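(* Suppose that the class $\mathcal F$ is uniformly bounded by an absolute constant and is VC-subgraph of VC-dimension $\nu_n$, that $f(\cdot,\cdot;\boldsymbol\theta_0)\equiv 0$, and let $h$ be the degenerate kernel defined in the context. If $\nu_n/n\to 0$, then the following two claims hold. (i) Let $r_n$ and $\epsilon_n$ be two sequences of nonnegative real numbers converging to zero. If $$\sup_{\boldsymbol\theta\in\overline{\mathcal B}(\boldsymbol\theta_0,r_n)}\mathbb E h^2(\cdot,\cdot;\boldsymbol\theta)\le \epsilon_n ,$$ then there exists a sequence of nonnegative real numbers $\delta_n$, depending only on $\epsilon_n,\nu_n,n$, converging to zero and such that $$\mathbb P\Big\{\sup_{\boldsymbol\theta\in\overline{\mathcal B}(\boldsymbol\theta_0,r_n)}|\mathbb U_n h(\cdot,\cdot;\boldsymbol\theta)|\le \delta_n\nu_n/n\Big\}=1-o(1).$$ (ii) Let $r_n=r(\nu_n,p_n,n)$ be a sequence of nonnegative real numbers converging to zero, and let $\tilde\epsilon_n=\epsilon(\nu_n,p_n,n,r_n)$ be a sequence of nonnegative real numbers (depending only on $\nu_n,p_n,n,r_n$) converging to zero. Put $\tilde\eta_n=\sqrt{\nu_n/n}\vee\tilde\epsilon_n$. Suppose $$\sup_{\boldsymbol\theta\in\overline{\mathcal B}(\boldsymbol\theta_0,r_n)}\mathbb E h^2(\cdot,\cdot;\boldsymbol\theta)\le\tilde\epsilon_n .$$ Then, for an absolute constant $C>0$, $$\mathbb E\sup_{\boldsymbol\theta\in\overline{\mathcal B}(\boldsymbol\theta_0,r_n)}|\mathbb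 U_n h(\cdot,\cdot;\boldsymbol\theta)|\le\frac{C\log(1/\tilde\eta_n)\,\tilde\eta_n^{1/2}\,\nu_n}{n}$$ holds for all sufficiently large $n$.
   Context: Triangular array setting: for each $n$, $\mathbf Z_1,\dots,\mathbf Z_n\in\mathbb R^{m_n}$ are i.i.d. from a probability measure $\mathbb P$ (which may change with $n$), and $\mathcal F=\{f(\cdot,\cdot;\boldsymbol\theta):\boldsymbol\theta\in\Theta\subset\mathbb R^{p_n}\}$ is a class of real-valued, possibly asymmetric and possibly discontinuous functions on $\mathbb R^{m_n}\times\mathbb R^{m_n}$. $\mathcal F$, $\Theta$, $\boldsymbol\theta_0$ may change with $n$; $m_n,p_n,\nu_n$ may tend to infinity. An "absolute constant" does not depend on $n$. $\mathcal F$ is a VC-subgraph class and $\nu_n$ is its VC-dimension. $\mathbb E f(\mathbf z,\cdot;\boldsymbol\theta)$, $\mathbb E f(\cdot,\mathbf z;\boldsymbol\theta)$ denote expectation over the remaining argument with law $\mathbb P$, and $\mathbb E f(\cdot,\cdot;\boldsymbol\theta)$ denotes expectation under $\mathbb P\otimes\mathbb P$. Let $\Gamma_n(\boldsymbol\theta)=\frac1{n(n-1)}\sum_{i\ne j}f(\mathbf Z_i,\mathbf Z_j;\boldsymbol\theta)$, $\Gamma(\boldsymbol\theta)=\mathbb E\Gamma_n(\boldsymbol\theta)$, and $\boldsymbol\theta_0=\arg\max_{\boldsymbol\theta\in\Theta}\Gamma(\boldsymbol\theta)$. Define $$h(\mathbf z_1,\mathbf z_2;\boldsymbol\theta)=f(\mathbf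 z_1,\mathbf z_2;\boldsymbol\theta)-\mathbb E f(\mathbf z_1,\cdot;\boldsymbol\theta)-\mathbb E f(\cdot,\mathbf z_2;\boldsymbol\theta)+\Gamma(\boldsymbol\theta),\qquad \mathbb U_n h(\cdot,\cdot;\boldsymbol\theta)=\frac1{n(n-1)}\sum_{i\neq j}h(\mathbf Z_i,\mathbf Z_j;\boldsymbol\theta).$$ $\overline{\mathcal B}(\boldsymbol\theta_0,r)=\{\boldsymbol\theta\in\Theta:\|\boldsymbol\theta-\boldsymbol\theta_0\|\le r\}$ with $\|\cdot\|$ the Euclidean norm; $a\vee b=\max(a,b)$.
   Formalization: It is assumed in addition that Θ is a Borel set and f(z1,z2;θ) is jointly Borel measurable in (z1,z2,θ), with the probability and expectation of the supremum taken under the completed measure; without such a measurability condition the claim can fail (under CH). *)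

theory Defs
  imports "HOL-Probability.Probability"
begin

text \<open>
  The dimensions vary with the sample size, so a vector of dimension \<open>d\<close> is a function
  \<open>nat \<Rightarrow> real\<close> that is extensional on \<open>{..<d}\<close>; \<open>euclid d\<close> is Euclidean \<open>d\<close>-space with its
  Borel sets (the product sigma-algebra).
\<close>

type_synonym vec = "nat \<Rightarrow> real"

definition euclid :: "nat \<Rightarrow> vec measure" where
  "euclid d = (\<Pi>\<^sub>M i\<in>{..<d}. (borel :: real measure))"

definition param_ball :: "nat \<Rightarrow> vec set \<Rightarrow> vec \<Rightarrow> real \<Rightarrow> vec set" where
  "param_ball p \<Theta> \<theta>0 r = {\<theta>\<in>\<Theta>. L2_set (\<lambda>i. \<theta> i - \<theta>0 i) {..<p} \<le> r}"


text \<open>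
  VC-dimension is the largest cardinality of a shattered set (not the VC-index, which is
  larger by one).
\<close>

definition shatters :: "'a set set \<Rightarrow> 'a set \<Rightarrow> bool" where
  "shatters \<C> S \<longleftrightarrow> (\<forall>T\<subseteq>S. \<exists>c\<in>\<C>. c \<inter> S = T)"

definition vc_dim :: "'a set set \<Rightarrow> enat" where
  "vc_dim \<C> = (SUP S\<in>{S. finite S \<and> shatters \<C> S}. enat (card S))"

definition subgraph :: "'a set \<Rightarrow> ('a \<Rightarrow> real) \<Rightarrow> ('a \<times> real) set" where
  "subgraph X g = {(x, t). x \<in> X \<and> t < g x}"

text \<open>
  The class of functions \<open>f(\<cdot>,\<cdot>;\<theta>)\<close>, \<open>\<theta> \<in> \<Theta>\<close>, on pairs of \<open>m\<close>-vectors is VC-subgraph with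
  VC-dimension \<open>\<nu>\<close>; being VC-subgraph is the finiteness of the dimension.
\<close>

definition VC_subgraph_class ::
  "nat \<Rightarrow> vec set \<Rightarrow> (vec \<Rightarrow> vec \<Rightarrow> vec \<Rightarrow> real) \<Rightarrow> nat \<Rightarrow> bool" where
  "VC_subgraph_class m \<Theta> f \<nu> \<longleftrightarrow>
     vc_dim ((\<lambda>\<theta>. subgraph (space (euclid m) \<times> space (euclid m)) (\<lambda>(z1, z2). f z1 z2 \<theta>)) ` \<Theta>)
       = enat \<nu>"


definition U_stat :: "nat \<Rightarrow> (nat \<Rightarrow> 'b) \<Rightarrow> ('b \<Rightarrow> 'b \<Rightarrow> real) \<Rightarrow> real" where
  "U_stat n z g =
     1 / (real n * (real n - 1)) *
       (\<Sum>(i, j) \<in> {(i, j). i \<in> {1..n} \<and> j \<in> {1..n} \<and> i \<noteq> j}. g (z i) (z j))"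

definition Gamma_obj ::
  "nat \<Rightarrow> 'a measure \<Rightarrow> (nat \<Rightarrow> 'a \<Rightarrow> vec) \<Rightarrow> (vec \<Rightarrow> vec \<Rightarrow> vec \<Rightarrow> real) \<Rightarrow> vec \<Rightarrow> real" where
  "Gamma_obj n M Z f \<theta> = (\<integral>\<omega>. U_stat n (\<lambda>i. Z i \<omega>) (\<lambda>z1 z2. f z1 z2 \<theta>) \<partial>M)"

definition degenerate_kernel ::
  "nat \<Rightarrow> 'a measure \<Rightarrow> (nat \<Rightarrow> 'a \<Rightarrow> vec) \<Rightarrow> vec measure \<Rightarrow>
     (vec \<Rightarrow> vec \<Rightarrow> vec \<Rightarrow> real) \<Rightarrow> vec \<Rightarrow> vec \<Rightarrow> vec \<Rightarrow> real" where
  "degenerate_kernel n M Z P f \<theta> z1 z2 =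
     f z1 z2 \<theta> - (\<integral>w. f z1 w \<theta> \<partial>P) - (\<integral>w. f w z2 \<theta> \<partial>P) + Gamma_obj n M Z f \<theta>"

definition second_moment ::
  "nat \<Rightarrow> 'a measure \<Rightarrow> (nat \<Rightarrow> 'a \<Rightarrow> vec) \<Rightarrow> vec measure \<Rightarrow>
     (vec \<Rightarrow> vec \<Rightarrow> vec \<Rightarrow> real) \<Rightarrow> vec \<Rightarrow> real" where
  "second_moment n M Z P f \<theta> =
     (\<integral>(z1, z2). (degenerate_kernel n M Z P f \<theta> z1 z2)\<^sup>2 \<partial>(P \<Otimes>\<^sub>M P))"

definition sup_U_process ::
  "nat \<Rightarrow> 'a measure \<Rightarrow> (nat \<Rightarrow> 'a \<Rightarrow> vec) \<Rightarrow> vec measure \<Rightarrow>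
     (vec \<Rightarrow> vec \<Rightarrow> vec \<Rightarrow> real) \<Rightarrow> vec set \<Rightarrow> 'a \<Rightarrow> real" where
  "sup_U_process n M Z P f T \<omega> =
     (SUP \<theta>\<in>T. \<bar>U_stat n (\<lambda>i. Z i \<omega>) (degenerate_kernel n M Z P f \<theta>)\<bar>)"


text \<open>
  Row \<open>n\<close> of the triangular array: \<open>Z 1, \<dots>, Z n\<close> are i.i.d. with law \<open>P\<close>, defined on the
  probability space \<open>M\<close>.
\<close>

definition iid_sample ::
  "nat \<Rightarrow> nat \<Rightarrow> 'a measure \<Rightarrow> vec measure \<Rightarrow> (nat \<Rightarrow> 'a \<Rightarrow> vec) \<Rightarrow> bool" where
  "iid_sample n m M P Z \<longleftrightarrow>
     prob_space M \<and>
     prob_space.indep_vars M (\<lambda>_. euclid m) Z {1..n} \<and>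
     (\<forall>i\<in>{1..n}. distr M (euclid m) (Z i) = P)"

text \<open>
  Measurability of the class: \<open>\<Theta>\<close> is a Borel set and \<open>f\<close> is jointly Borel measurable (no
  continuity is assumed). By measurable projection, suprema over \<open>\<Theta>\<close> or over a closed ball in
  \<open>\<Theta>\<close> are then measurable for the completed probability measure, but in general not for the
  measure itself. Measurability of \<open>f(\<cdot>,\<cdot>;\<theta>)\<close> for each separate \<open>\<theta>\<close> would not suffice for
  maximal inequalities over an uncountable VC class.
\<close>

definition measurable_class ::
  "nat \<Rightarrow> nat \<Rightarrow> vec set \<Rightarrow> (vec \<Rightarrow> vec \<Rightarrow> vec \<Rightarrow> real) \<Rightarrow> bool" where
  "measurable_class m p \<Theta> f \<longleftrightarrow>
     \<Theta> \<in> sets (euclid p) \<and>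
     (\<lambda>(z1, z2, \<theta>). f z1 z2 \<theta>) \<in>
       borel_measurable (euclid m \<Otimes>\<^sub>M euclid m \<Otimes>\<^sub>M restrict_space (euclid p) \<Theta>)"

end

theory Submission
  imports Defs
begin

text \<open>
  Splitting the sample at random into two halves of size \<open>b\<close> turns the U-statistic into an
  average of bilinear sums \<open>\<Sum>\<^sub>i\<^sub>j h(Z\<^sub>i, Z\<^sub>b\<^sub>+\<^sub>j)\<close>. Comparing each observation with an independent copy
  replaces \<open>h\<close> by a second difference of \<open>f\<close>, which changes sign under exchanging an observation
  with its copy; the sum may therefore be replaced by a Rademacher chaos. Conditionally on the
  data such a chaos has exponential moments at the scale of its Hilbert--Schmidt norm. Chaining
  through nets whose cardinality is controlled by the VC-dimension, starting at scale
  \<open>\<surd>\<eta>\<close>, costs \<open>\<nu> ln (1/\<eta>) \<surd>\<eta>\<close>, provided that the empirical second moment is uniformly of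
  order \<open>\<eta>\<close> in expectation. The latter follows from a one-sided comparison with an independent
  copy, where a single net suffices because \<open>\<surd>(\<nu>/n) \<le> \<eta>\<close> is allowed as an error. Suprema over
  the parameter set are measurable for the completed measure by the measurable projection
  theorem, which is proved by capacitability of Suslin sets. Part (i) follows from the
  expectation bound by Markov's inequality.
\<close>

section \<open>Measurable projections\<close>

text \<open>The projections subtracted in \<open>h\<close> need not preserve the VC property, so
  entropy is never estimated for \<open>h\<close> itself. A second difference with copies involves
  only four values of \<open>f\<close>, and the covering bound for \<open>f\<close> applies to the
  finitely many points that occur. Boundedness dominates squared \<open>L^2\<close> distances by
  \<open>L^1\<close> distances, so \<open>L^1\<close> nets suffice. Two disjoint halves give a
  decoupled sum at once, and permutations of the sample average such sums back to the U-statistic.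
  The obstacle is the empirical second moment, itself a supremum over dependent terms. Only along a
  diagonal of the index square do the terms use disjoint observations, so the square is cut into
  cyclic diagonals, each with the law of the main one. The resulting quantity \<open>D\<close>
  enters the chaining bound linearly, through the radius \<open>\<rho> + D / \<rho>\<close> in place
  of a square root, so that expectations can be taken directly. Everything is realised on infinite
  i.i.d. sequences, where injective relabelling preserves the law and fresh copies are always at
  hand.\<close>

definition suslin_scheme ::
  "'a set set \<Rightarrow> (nat \<Rightarrow> (nat \<Rightarrow> nat) \<Rightarrow> 'a set) \<Rightarrow> 'a set \<Rightarrow> bool" where
  "suslin_scheme \<P> S A \<longleftrightarrow>
      (\<forall>k \<sigma>. S k \<sigma> \<in> \<P>) \<and> (\<forall>k \<sigma> \<tau>. (\<forall>i<k. \<sigma> i = \<tau> i) \<longrightarrow> S k \<sigma> = S k \<tau>) \<and>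
      A = {x. \<exists>\<sigma>. \<forall>k. x \<in> S k \<sigma>}"

text \<open>The Suslin operation. A node at level \<open>k\<close> is given by an infinite sequence
  of which only the first \<open>k\<close> entries count, so finite sequences need no type of their
  own; level 0 is the root. The levels need not decrease, hence the intersections over
  \<open>j \<le> k\<close> later on.\<close>

definition suslin :: "'a set set \<Rightarrow> 'a set set" where
  "suslin \<P> = {A. \<exists>S. suslin_scheme \<P> S A}"

lemma suslin_schemeD:
  assumes "suslin_scheme \<P> S A"
  shows "S k \<sigma> \<in> \<P>"
    and "(\<And>i. i < k \<Longrightarrow> \<sigma> i = \<tau> i) \<Longrightarrow> S k \<sigma> = S k \<tau>"
    and "A = {x. \<exists>\<sigma>. \<forall>k. x \<in> S k \<sigma>}"
  using assms unfolding suslin_scheme_def by blast+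

lemma suslinI:
  fixes S :: "nat \<Rightarrow> (nat \<Rightarrow> nat) \<Rightarrow> 'a set"
  assumes "\<And>k \<sigma>. S k \<sigma> \<in> \<P>"
    and "\<And>k \<sigma> \<tau>. (\<And>i. i < k \<Longrightarrow> \<sigma> i = \<tau> i) \<Longrightarrow> S k \<sigma> = S k \<tau>"
    and "A = {x. \<exists>\<sigma>. \<forall>k. x \<in> S k \<sigma>}"
  shows "A \<in> suslin \<P>"
proof -
  have "suslin_scheme \<P> S A"
    unfolding suslin_scheme_def by (intro conjI allI impI) (use assms in blast)+
  then show ?thesis unfolding suslin_def by blast
qed

lemma suslin_base: "A \<in> \<P> \<Longrightarrow> A \<in> suslin \<P>"
  by (rule suslinI[where S = "\<lambda>_ _. A"]) auto

text \<open>The first entry of \<open>\<sigma>\<close> selects a member of the union and the shifted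
  sequence runs through the scheme of that member. Level 0 must not depend on
  \<open>\<sigma>\<close>, which is why a common superset \<open>X\<close> from the paving is put
  there.\<close>

lemma suslin_UN:
  fixes A :: "nat \<Rightarrow> 'a set"
  assumes "\<And>n. A n \<in> suslin \<P>" and "X \<in> \<P>" and "\<And>n. A n \<subseteq> X"
  shows "(\<Union>n. A n) \<in> suslin \<P>"
proof -
  have "\<forall>n. \<exists>S. suslin_scheme \<P> S (A n)"
    using assms(1) unfolding suslin_def by simp
  from choice[OF this] obtain S where "\<forall>n. suslin_scheme \<P> (S n) (A n)" ..
  note S = suslin_schemeD[OF this[rule_format]]
  define S' where "S' k \<sigma> = (case k of 0 \<Rightarrow> X | Suc j \<Rightarrow> S (\<sigma> 0) j (\<lambda>i. \<sigma> (Suc i)))"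
    for k and \<sigma> :: "nat \<Rightarrow> nat"
  show ?thesis
  proof (rule suslinI[where S = S'])
    show "S' k \<sigma> \<in> \<P>" for k \<sigma>
      unfolding S'_def using assms(2) S(1) by (auto split: nat.split)
    show "S' k \<sigma> = S' k \<tau>" if "\<And>i. i < k \<Longrightarrow> \<sigma> i = \<tau> i" for k \<sigma> \<tau>
    proof (cases k)
      case 0 then show ?thesis by (simp add: S'_def)
    next
      case (Suc j)
      have "S (\<sigma> 0) j (\<lambda>i. \<sigma> (Suc i)) = S (\<sigma> 0) j (\<lambda>i. \<tau> (Suc i))"
        by (rule S(2)) (use that Suc in auto)
      then show ?thesis using that[of 0] Suc by (simp add: S'_def)
    qed
    show "(\<Union>n. A n) = {x. \<exists>\<sigma>. \<forall>k. x \<in> S' k \<sigma>}"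
    proof (intro set_eqI iffI)
      fix x assume "x \<in> (\<Union>n. A n)"
      then obtain n \<sigma> where n: "x \<in> A n" "\<And>k. x \<in> S n k \<sigma>" using S(3) by auto
      have "\<forall>k. x \<in> S' k (case_nat n \<sigma>)"
        using n assms(3) by (auto simp: S'_def split: nat.split)
      then show "x \<in> {x. \<exists>\<sigma>. \<forall>k. x \<in> S' k \<sigma>}" by blast
    next
      fix x assume "x \<in> {x. \<exists>\<sigma>. \<forall>k. x \<in> S' k \<sigma>}"
      then obtain \<sigma> where "\<And>k. x \<in> S' k \<sigma>" by auto
      from this[of "Suc _"] have "\<And>k. x \<in> S (\<sigma> 0) k (\<lambda>i. \<sigma> (Suc i))"
        by (simp add: S'_def)
      then show "x \<in> (\<Union>n. A n)" using S(3) by auto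
    qed
  qed
qed

text \<open>Guarantees that a prefix of length \<open>prod_encode (n, k)\<close> already contains
  the first \<open>k\<close> entries of row \<open>n\<close>, as the dependence condition in
  \<open>suslin_INT\<close> demands.\<close>

lemma prod_encode_mono_right: "i < k \<Longrightarrow> prod_encode (n, i) < prod_encode (n, k)"
proof -
  assume "i < k"
  then have "triangle (n + i) < triangle (n + k)"
  proof (induction k)
    case (Suc k) then show ?case by (cases "i = k") auto
  qed simp
  then show ?thesis by (simp add: prod_encode_def)
qed

text \<open>One sequence codes countably many: row \<open>n\<close> consists of the entries at
  \<open>prod_encode (n, i)\<close>. Level \<open>prod_encode (n, k)\<close> tests level
  \<open>k\<close> of the \<open>n\<close>-th scheme on row \<open>n\<close>, so one sequence
  witnesses membership in all sets simultaneously.\<close>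

lemma suslin_INT:
  fixes A :: "nat \<Rightarrow> 'a set"
  assumes "\<And>n. A n \<in> suslin \<P>"
  shows "(\<Inter>n. A n) \<in> suslin \<P>"
proof -
  have "\<forall>n. \<exists>S. suslin_scheme \<P> S (A n)"
    using assms(1) unfolding suslin_def by simp
  from choice[OF this] obtain S where "\<forall>n. suslin_scheme \<P> (S n) (A n)" ..
  note S = suslin_schemeD[OF this[rule_format]]
  define S' where "S' k \<sigma> = S (fst (prod_decode k)) (snd (prod_decode k))
      (\<lambda>i. \<sigma> (prod_encode (fst (prod_decode k), i)))"
    for k and \<sigma> :: "nat \<Rightarrow> nat"
  have S'_enc: "S' (prod_encode (n, k)) \<sigma> = S n k (\<lambda>i. \<sigma> (prod_encode (n, i)))" for n k \<sigma>
    by (simp add: S'_def)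
  show ?thesis
  proof (rule suslinI[where S = S'])
    show "S' k \<sigma> \<in> \<P>" for k \<sigma> unfolding S'_def using S(1) by auto
    show "S' K \<sigma> = S' K \<tau>" if *: "\<And>i. i < K \<Longrightarrow> \<sigma> i = \<tau> i" for K \<sigma> \<tau>
    proof -
      obtain n k where K: "K = prod_encode (n, k)" by (metis prod_decode_inverse surj_pair)
      show ?thesis unfolding K S'_enc
        by (rule S(2)) (use * K prod_encode_mono_right in auto)
    qed
    show "(\<Inter>n. A n) = {x. \<exists>\<sigma>. \<forall>k. x \<in> S' k \<sigma>}"
    proof (intro set_eqI iffI)
      fix x assume "x \<in> (\<Inter>n. A n)"
      then have "\<forall>n. \<exists>\<sigma>. \<forall>k. x \<in> S n k \<sigma>" using S(3) by auto
      then obtain s where s: "\<And>n k. x \<in> S n k (s n)" by metis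
      define \<sigma> where "\<sigma> j = s (fst (prod_decode j)) (snd (prod_decode j))" for j
      have "(\<lambda>i. \<sigma> (prod_encode (n, i))) = s n" for n by (auto simp: \<sigma>_def)
      then have "x \<in> S' k \<sigma>" for k
        unfolding S'_def using s by simp
      then show "x \<in> {x. \<exists>\<sigma>. \<forall>k. x \<in> S' k \<sigma>}" by blast
    next
      fix x assume "x \<in> {x. \<exists>\<sigma>. \<forall>k. x \<in> S' k \<sigma>}"
      then obtain \<sigma> where "\<And>k. x \<in> S' k \<sigma>" by auto
      then have "x \<in> S n k (\<lambda>i. \<sigma> (prod_encode (n, i)))" for n k
        unfolding S'_enc[symmetric] by blast
      then have "x \<in> A n" for n unfolding S(3) by blast
      then show "x \<in> (\<Inter>n. A n)" by blast
    qed
  qed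
qed

section \<open>Compactness and inner approximation of projections\<close>

text \<open>Koenig's lemma for a finitely branching tree. \<open>R k \<sigma>\<close> says that the
  prefix of length \<open>k\<close> extends to bounded solutions of every length; this property can
  always be prolonged by one entry, and the limit of the prolongations satisfies every
  \<open>Q k\<close>.\<close>

lemma koenig_bounded:
  fixes Q :: "nat \<Rightarrow> (nat \<Rightarrow> nat) \<Rightarrow> bool" and b :: "nat \<Rightarrow> nat"
  assumes mono: "\<And>k \<sigma>. Q (Suc k) \<sigma> \<Longrightarrow> Q k \<sigma>"
    and dep: "\<And>k \<sigma> \<tau>. (\<And>i. i < k \<Longrightarrow> \<sigma> i = \<tau> i) \<Longrightarrow> Q k \<sigma> = Q k \<tau>"
    and ex: "\<And>k. \<exists>\<sigma>. (\<forall>i<k. \<sigma> i \<le> b i) \<and> Q k \<sigma>"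
  shows "\<exists>\<sigma>. \<forall>k. Q k \<sigma>"
proof -
  have mono': "Q l \<sigma> \<Longrightarrow> k \<le> l \<Longrightarrow> Q k \<sigma>" for k l \<sigma>
    by (induction l) (auto simp: le_Suc_eq dest: mono)
  define R where "R k \<sigma> \<longleftrightarrow> (\<forall>l. \<exists>\<tau>. (\<forall>i<k. \<tau> i = \<sigma> i) \<and> (\<forall>i<l. \<tau> i \<le> b i) \<and> Q l \<tau>)" for k \<sigma>
  have step: "\<exists>\<tau>. R (Suc k) \<tau> \<and> (\<forall>i<k. \<tau> i = \<sigma> i)" if R: "R k \<sigma>" for k \<sigma>
  proof (rule ccontr)
    assume "\<not> ?thesis"
    then have "\<not> R (Suc k) (\<sigma>(k := m))" for m by auto
    then have "\<forall>m. \<exists>l. \<forall>\<tau>. \<not> ((\<forall>i<Suc k. \<tau> i = (\<sigma>(k := m)) i) \<and> (\<forall>i<l. \<tau> i \<le> b i) \<and> Q l \<tau>)"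
      unfolding R_def by (simp only: not_all not_ex) simp
    from choice[OF this] obtain l where
      l: "\<And>m \<tau>. \<not> ((\<forall>i<Suc k. \<tau> i = (\<sigma>(k := m)) i) \<and> (\<forall>i<l m. \<tau> i \<le> b i) \<and> Q (l m) \<tau>)"
      by blast
    \<comment> \<open>\<open>L\<close> dominates the failing lengths of all finitely many candidates
      \<open>m \<le> b k\<close>. The summand \<open>Suc k\<close> makes \<open>L\<close> exceed
      \<open>k\<close>, so that the bound \<open>\<tau> k \<le> b k\<close> is available.\<close>
    define L where "L = Suc k + (\<Sum>m\<le>b k. l m)"
    obtain \<tau> where \<tau>: "\<forall>i<k. \<tau> i = \<sigma> i" "\<forall>i<L. \<tau> i \<le> b i" "Q L \<tau>"
      using R unfolding R_def by blast
    have "\<tau> k \<le> b k" using \<tau>(2) by (auto simp: L_def)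
    then have "l (\<tau> k) \<le> (\<Sum>m\<le>b k. l m)" by (intro member_le_sum) auto
    then have le: "l (\<tau> k) \<le> L" by (simp add: L_def)
    have "\<tau> i = (\<sigma>(k := \<tau> k)) i" if "i < Suc k" for i
      using \<tau>(1) that by (auto simp: less_Suc_eq)
    moreover have "\<tau> i \<le> b i" if "i < l (\<tau> k)" for i
      using \<tau>(2) le that by auto
    ultimately have "\<not> Q (l (\<tau> k)) \<tau>" using l[of \<tau> "\<tau> k"] by blast
    then show False using mono'[OF \<tau>(3) le] by simp
  qed
  have "\<exists>f. \<forall>k. R k (f k) \<and> (\<forall>i<k. f (Suc k) i = f k i)"
  proof (rule dependent_nat_choice)
    show "\<exists>\<sigma>. R 0 \<sigma>" unfolding R_def using ex by auto
    show "\<exists>\<tau>. R (Suc n) \<tau> \<and> (\<forall>i<n. \<tau> i = \<sigma> i)" if "R n \<sigma>" for \<sigma> n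
      using step[OF that] by blast
  qed
  then obtain f where f: "\<And>k. R k (f k)" "\<And>k i. i < k \<Longrightarrow> f (Suc k) i = f k i" by blast
  have stable: "f k i = f (Suc i) i" if "i < k" for i k
    using that
  proof (induction k)
    case (Suc k)
    show ?case
    proof (cases "i = k")
      case False
      with Suc have "i < k" by simp
      then show ?thesis using f(2)[of i k] Suc.IH by metis
    qed simp
  qed simp
  define \<sigma> where "\<sigma> i = f (Suc i) i" for i
  have "Q k \<sigma>" for k
  proof -
    obtain \<tau> where "\<forall>i<k. \<tau> i = f k i" "Q k \<tau>" using f(1)[of k] unfolding R_def by blast
    have "Q k \<tau> = Q k \<sigma>"
    proof (rule dep)
      fix i assume "i < k"
      then show "\<tau> i = \<sigma> i"
        using \<open>\<forall>i<k. \<tau> i = f k i\<close> stable[OF \<open>i < k\<close>] unfolding \<sigma>_def by metis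
    qed
    then show ?thesis using \<open>Q k \<tau>\<close> by simp
  qed
  then show ?thesis by blast
qed


text \<open>
  The values of the index sequence are bounded one coordinate at a time, with little loss of outer
  measure. Under such bounds every level of the scheme is a finite union of measurable rectangles,
  and compactness recovers a point of the set in the limit.
\<close>

lemma measurable_bounded_projection:
  assumes comp: "\<And>C :: nat \<Rightarrow> 'b set. (\<And>k. C k \<in> \<C>) \<Longrightarrow> (\<And>k. (\<Inter>j\<le>k. C j) \<noteq> {}) \<Longrightarrow> (\<Inter>k. C k) \<noteq> {}"
    and S: "suslin_scheme {E \<times> C | E C. E \<in> sets M \<and> C \<in> \<C>} S A"
    and a: "a < outer_measure_of M (fst ` A)"
    and M: "finite_measure M"
  shows "\<exists>B\<in>sets M. B \<subseteq> fst ` A \<and> a \<le> emeasure M B"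
proof -
  interpret finite_measure M by fact
  note Sd = suslin_schemeD[OF S]
  have "\<exists>E C. S k \<sigma> = E \<times> C \<and> E \<in> sets M \<and> C \<in> \<C>" for k \<sigma>
    using Sd(1)[of k \<sigma>] by blast
  then obtain E C where EC: "\<And>k \<sigma>. S k \<sigma> = E k \<sigma> \<times> C k \<sigma>" "\<And>k \<sigma>. E k \<sigma> \<in> sets M" "\<And>k \<sigma>. C k \<sigma> \<in> \<C>"
    by metis
  define A' where "A' k b = {x. \<exists>\<sigma>. (\<forall>i<k. \<sigma> i \<le> b i) \<and> (\<forall>j. x \<in> S j \<sigma>)}"
    for k and b :: "nat \<Rightarrow> nat"
  have A'_cong: "A' k b = A' k b'" if "\<And>i. i < k \<Longrightarrow> b i = b' i" for k b b'
    unfolding A'_def using that by auto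
  have A'_mono: "A' k b \<subseteq> A' k b'" if "\<And>i. i < k \<Longrightarrow> b i \<le> b' i" for k b b'
    unfolding A'_def using that by (blast intro: order_trans)
  have sub: "fst ` A' k b \<subseteq> space M" for k b
  proof -
    have "A' k b \<subseteq> (\<Union>\<sigma>. S 0 \<sigma>)" unfolding A'_def by blast
    also have "\<dots> \<subseteq> space M \<times> UNIV" unfolding EC(1) using EC(2) sets.sets_into_space by fastforce
    finally show ?thesis by auto
  qed
  \<comment> \<open>The sets with entry \<open>k\<close> bounded by \<open>m\<close> increase to
    \<open>A' k b\<close>, and outer measure is continuous from below along increasing sequences of
    arbitrary sets; hence some \<open>m\<close> keeps the strict inequality.\<close>
  have step: "\<exists>b'. a < outer_measure_of M (fst ` A' (Suc k) b') \<and> (\<forall>i<k. b' i = b i)"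
    if lt: "a < outer_measure_of M (fst ` A' k b)" for k b
  proof -
    have inc: "incseq (\<lambda>m. fst ` A' (Suc k) (b(k := m)))"
      by (intro incseq_SucI image_mono A'_mono) auto
    have "A' k b = (\<Union>m. A' (Suc k) (b(k := m)))"
      by (auto simp: A'_def less_Suc_eq)
    then have "fst ` A' k b = (\<Union>m. fst ` A' (Suc k) (b(k := m)))" by (simp only: image_UN)
    then have eq: "outer_measure_of M (fst ` A' k b) = (SUP m. outer_measure_of M (fst ` A' (Suc k) (b(k := m))))"
      using SUP_outer_measure_of_incseq[OF _ inc] sub by simp
    obtain m where "a < outer_measure_of M (fst ` A' (Suc k) (b(k := m)))"
      using lt unfolding eq less_SUP_iff by blast
    then show ?thesis by (intro exI[of _ "b(k := m)"]) auto
  qed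
  have "\<exists>f. \<forall>k. a < outer_measure_of M (fst ` A' k (f k)) \<and> (\<forall>i<k. f (Suc k) i = f k i)"
  proof (rule dependent_nat_choice)
    have "A' 0 b = A" for b unfolding A'_def Sd(3) by auto
    then show "\<exists>b. a < outer_measure_of M (fst ` A' 0 b)" using a by simp
    show "\<exists>b'. a < outer_measure_of M (fst ` A' (Suc k) b') \<and> (\<forall>i<k. b' i = b i)"
      if "a < outer_measure_of M (fst ` A' k b)" for k b
      using step[OF that] .
  qed
  then obtain f where f: "\<And>k. a < outer_measure_of M (fst ` A' k (f k))" "\<And>k i. i < k \<Longrightarrow> f (Suc k) i = f k i"
    by blast
  have stable: "f k i = f (Suc i) i" if "i < k" for i k
    using that
  proof (induction k)
    case (Suc k)
    show ?case
    proof (cases "i = k")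
      case False
      with Suc have "i < k" by simp
      then show ?thesis using f(2)[of i k] Suc.IH by metis
    qed simp
  qed simp
  define b where "b i = f (Suc i) i" for i
  have fA: "a < outer_measure_of M (fst ` A' k b)" for k
  proof -
    have "A' k (f k) = A' k b"
      by (rule A'_cong) (unfold b_def, erule stable)
    then show ?thesis using f(1)[of k] by simp
  qed
  define B where "B k = fst ` {x. \<exists>\<sigma>. (\<forall>i<k. \<sigma> i \<le> b i) \<and> (\<forall>j\<le>k. x \<in> S j \<sigma>)}" for k
  have B_eq: "B k = (\<Union>\<sigma>\<in>PiE {..<k} (\<lambda>i. {..b i}). fst ` (\<Inter>j\<le>k. S j \<sigma>))" for k
  proof -
    have "{x. \<exists>\<sigma>. (\<forall>i<k. \<sigma> i \<le> b i) \<and> (\<forall>j\<le>k. x \<in> S j \<sigma>)} = (\<Union>\<sigma>\<in>PiE {..<k} (\<lambda>i. {..b i}). (\<Inter>j\<le>k. S j \<sigma>))"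
    proof (intro set_eqI iffI)
      fix x assume "x \<in> {x. \<exists>\<sigma>. (\<forall>i<k. \<sigma> i \<le> b i) \<and> (\<forall>j\<le>k. x \<in> S j \<sigma>)}"
      then obtain \<sigma> where \<sigma>: "\<forall>i<k. \<sigma> i \<le> b i" "\<forall>j\<le>k. x \<in> S j \<sigma>" by blast
      have "S j \<sigma> = S j (restrict \<sigma> {..<k})" if "j \<le> k" for j
        by (rule Sd(2)) (use that in auto)
      then have "x \<in> (\<Inter>j\<le>k. S j (restrict \<sigma> {..<k}))" using \<sigma>(2) by blast
      moreover have "restrict \<sigma> {..<k} \<in> PiE {..<k} (\<lambda>i. {..b i})" using \<sigma>(1) by auto
      ultimately show "x \<in> (\<Union>\<sigma>\<in>PiE {..<k} (\<lambda>i. {..b i}). (\<Inter>j\<le>k. S j \<sigma>))" by blast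
    next
      fix x assume "x \<in> (\<Union>\<sigma>\<in>PiE {..<k} (\<lambda>i. {..b i}). (\<Inter>j\<le>k. S j \<sigma>))"
      then obtain \<sigma> where "\<sigma> \<in> PiE {..<k} (\<lambda>i. {..b i})" "\<forall>j\<le>k. x \<in> S j \<sigma>" by blast
      then show "x \<in> {x. \<exists>\<sigma>. (\<forall>i<k. \<sigma> i \<le> b i) \<and> (\<forall>j\<le>k. x \<in> S j \<sigma>)}"
        by (auto simp: PiE_iff)
    qed
    then show ?thesis unfolding B_def by (simp only: image_UN)
  qed
  have Bm: "B k \<in> sets M" for k
  proof -
    have "fst ` (\<Inter>j\<le>k. S j \<sigma>) \<in> sets M" for \<sigma>
    proof -
      have "(\<Inter>j\<le>k. S j \<sigma>) = (\<Inter>j\<le>k. E j \<sigma>) \<times> (\<Inter>j\<le>k. C j \<sigma>)" unfolding EC(1) by auto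
      moreover have "(\<Inter>j\<le>k. E j \<sigma>) \<in> sets M" using EC(2) by (intro sets.finite_INT) auto
      ultimately show ?thesis by (auto simp: fst_image_times)
    qed
    then show ?thesis unfolding B_eq by (intro sets.finite_UN finite_PiE) auto
  qed
  have "fst ` A' k b \<subseteq> B k" for k unfolding A'_def B_def by (intro image_mono) blast
  then have "outer_measure_of M (fst ` A' k b) \<le> emeasure M (B k)" for k
    using outer_measure_of_mono[of "fst ` A' k b" "B k" M] Bm by simp
  then have Ba: "a \<le> emeasure M (B k)" for k using fA[of k] by (meson less_le_trans order.strict_implies_order)
  have "B (Suc k) \<subseteq> B k" for k
    unfolding B_def
  proof (rule image_mono, rule Collect_mono, rule impI, elim exE conjE)
    fix x \<sigma> assume "\<forall>i<Suc k. \<sigma> i \<le> b i" "\<forall>j\<le>Suc k. x \<in> S j \<sigma>"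
    then show "\<exists>\<sigma>. (\<forall>i<k. \<sigma> i \<le> b i) \<and> (\<forall>j\<le>k. x \<in> S j \<sigma>)"
      by (intro exI[of _ \<sigma>]) simp
  qed
  then have "decseq B" by (rule decseq_SucI)
  then have "(INF k. emeasure M (B k)) = emeasure M (\<Inter>k. B k)"
    using Bm by (intro INF_emeasure_decseq) auto
  moreover have "a \<le> (INF k. emeasure M (B k))" using Ba by (simp add: le_INF_iff)
  ultimately have "a \<le> emeasure M (\<Inter>k. B k)" by simp
  moreover have "(\<Inter>k. B k) \<subseteq> fst ` A"
  proof
    fix w assume w: "w \<in> (\<Inter>k. B k)"
    \<comment> \<open>The point \<open>w\<close> is fixed, and the tree consists of the prefixes
      whose levels share a point of the fibre over \<open>w\<close>. Compactness of
      \<open>\<C>\<close> is applied only along the infinite branch.\<close>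
    define Q where "Q k \<sigma> \<longleftrightarrow> (\<exists>y. \<forall>j\<le>k. (w, y) \<in> S j \<sigma>)" for k \<sigma>
    have "\<exists>\<sigma>. \<forall>k. Q k \<sigma>"
    proof (rule koenig_bounded[where b = b])
      show "Q k \<sigma>" if "Q (Suc k) \<sigma>" for k \<sigma> using that le_SucI unfolding Q_def by blast
      show "Q k \<sigma> = Q k \<tau>" if "\<And>i. i < k \<Longrightarrow> \<sigma> i = \<tau> i" for k \<sigma> \<tau>
      proof -
        have "S j \<sigma> = S j \<tau>" if "j \<le> k" for j
          by (rule Sd(2)) (use \<open>\<And>i. i < k \<Longrightarrow> \<sigma> i = \<tau> i\<close> that in auto)
        then show ?thesis unfolding Q_def by metis
      qed
      show "\<exists>\<sigma>. (\<forall>i<k. \<sigma> i \<le> b i) \<and> Q k \<sigma>" for k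
      proof -
        have "w \<in> B k" using w by blast
        then obtain x \<sigma> where x: "w = fst x" and \<sigma>: "\<forall>i<k. \<sigma> i \<le> b i" "\<forall>j\<le>k. x \<in> S j \<sigma>"
          unfolding B_def by blast
        have "(w, snd x) = x" using x by simp
        then have "Q k \<sigma>" unfolding Q_def using \<sigma>(2) by (intro exI[of _ "snd x"]) simp
        then show ?thesis using \<sigma>(1) by blast
      qed
    qed
    then obtain \<sigma> where \<sigma>: "\<And>k. Q k \<sigma>" by blast
    have "(\<Inter>k. C k \<sigma>) \<noteq> {}"
    proof (rule comp)
      show "C k \<sigma> \<in> \<C>" for k by (rule EC(3))
      show "(\<Inter>j\<le>k. C j \<sigma>) \<noteq> {}" for k using \<sigma>[of k] unfolding Q_def EC(1) by blast
    qed
    then obtain y where "\<And>k. y \<in> C k \<sigma>" by blast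
    moreover have "w \<in> E k \<sigma>" for k using \<sigma>[of k] unfolding Q_def EC(1) by blast
    ultimately have "(w, y) \<in> A" unfolding Sd(3) EC(1) by blast
    then show "w \<in> fst ` A" by force
  qed
  moreover have "(\<Inter>k. B k) \<in> sets M" using Bm by auto
  ultimately show ?thesis by blast
qed

text \<open>Measurable subsets with measure approaching the outer measure are united into one that
  attains it. Together with a measurable hull of the same finite measure it encloses the projection
  up to a null set.\<close>

lemma suslin_projection_measurable:
  assumes comp: "\<And>C :: nat \<Rightarrow> 'b set. (\<And>k. C k \<in> \<C>) \<Longrightarrow> (\<And>k. (\<Inter>j\<le>k. C j) \<noteq> {}) \<Longrightarrow> (\<Inter>k. C k) \<noteq> {}"
    and A: "A \<in> suslin {E \<times> C | E C. E \<in> sets M \<and> C \<in> \<C>}"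
    and M: "finite_measure M"
  shows "fst ` A \<in> sets (completion M)"
proof -
  interpret finite_measure M by fact
  from A obtain S where S: "suslin_scheme {E \<times> C | E C. E \<in> sets M \<and> C \<in> \<C>} S A"
    unfolding suslin_def by blast
  note Sd = suslin_schemeD[OF S]
  have "A \<subseteq> space M \<times> UNIV"
  proof
    fix x assume "x \<in> A"
    then obtain \<sigma> where "x \<in> S 0 \<sigma>" unfolding Sd(3) by blast
    then show "x \<in> space M \<times> UNIV" using Sd(1)[of 0 \<sigma>] sets.sets_into_space by fastforce
  qed
  then have sub: "fst ` A \<subseteq> space M" by auto
  obtain E where E: "E \<in> sets M" "fst ` A \<subseteq> E" "outer_measure_of M (fst ` A) = emeasure M E"
    using outer_measure_of_attain[OF sub] by blast
  let ?m = "outer_measure_of M (fst ` A)"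
  have "\<exists>B\<in>sets M. B \<subseteq> fst ` A \<and> emeasure M B = ?m"
  proof (cases "?m = 0")
    case True then show ?thesis by (intro bexI[of _ "{}"]) auto
  next
    case False
    have fin: "?m < \<infinity>" using E(3) by (simp add: less_top[symmetric])
    obtain u where u: "\<And>n. u n < ?m" "u \<longlonglongrightarrow> ?m"
    proof -
      have "bot < ?m" using False by (simp add: bot_ennreal zero_less_iff_neq_zero)
      from approx_from_below_dense_linorder[OF this] show ?thesis using that by blast
    qed
    have "\<forall>n. \<exists>B. B \<in> sets M \<and> B \<subseteq> fst ` A \<and> u n \<le> emeasure M B"
      using measurable_bounded_projection[OF comp S u(1) M] by blast
    from choice[OF this] obtain B where B: "\<And>n. B n \<in> sets M" "\<And>n. B n \<subseteq> fst ` A" "\<And>n. u n \<le> emeasure M (B n)"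
      by blast
    let ?B = "\<Union>n. B n"
    have Bs: "?B \<in> sets M" "?B \<subseteq> fst ` A" using B by auto
    have "u n \<le> emeasure M ?B" for n
      by (rule order_trans[OF B(3)[of n]], rule emeasure_mono) (use Bs in auto)
    then have "?m \<le> emeasure M ?B" by (intro LIMSEQ_le_const2[OF u(2)]) auto
    moreover have "emeasure M ?B \<le> ?m" unfolding E(3) using Bs E by (intro emeasure_mono) auto
    ultimately show ?thesis using Bs by (intro bexI[of _ ?B]) auto
  qed
  then obtain B where B: "B \<in> sets M" "B \<subseteq> fst ` A" "emeasure M B = emeasure M E" using E(3) by auto
  have "emeasure M (E - B) = 0"
    using B E by (subst emeasure_Diff) auto
  then have "E - B \<in> null_sets M" using E B by auto
  moreover have "fst ` A = B \<union> (fst ` A - B)" "fst ` A - B \<subseteq> E - B" using B E by auto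
  ultimately show ?thesis using B(1) by (metis sets_completionI)
qed

section \<open>Closed boxes as a compact paving of Euclidean space\<close>

text \<open>\<open>UNIV\<close> supplies the common superset for countable unions and the empty
  rectangle \<open>{} \<times> UNIV\<close>; it imposes no condition, so the finite intersection
  property is unaffected.\<close>

definition box_paving :: "nat \<Rightarrow> vec set set" where
  "box_paving p = insert UNIV {PiE {..<p} (\<lambda>i. {a i..b i}) | a b. True}"

text \<open>Any two of the boxes meet, so in each coordinate every left endpoint lies below every
  right endpoint. The coordinatewise supremum of the left endpoints over the genuine boxes
  \<open>K\<close> is then a common point.\<close>

lemma box_paving_compact:
  fixes C :: "nat \<Rightarrow> vec set"
  assumes C: "\<And>k. C k \<in> box_paving p" and ne: "\<And>k. (\<Inter>j\<le>k. C j) \<noteq> {}"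
  shows "(\<Inter>k. C k) \<noteq> {}"
proof (cases "\<forall>k. C k = UNIV")
  case True then show ?thesis by simp
next
  case False
  define K where "K = {k. C k \<noteq> UNIV}"
  obtain k0 where k0: "k0 \<in> K" using False by (auto simp: K_def)
  have "\<forall>k. \<exists>ab. k \<in> K \<longrightarrow> C k = PiE {..<p} (\<lambda>i. {fst ab i..snd ab i})"
  proof
    fix k
    show "\<exists>ab. k \<in> K \<longrightarrow> C k = PiE {..<p} (\<lambda>i. {fst ab i..snd ab i})"
    proof (cases "k \<in> K")
      case True
      then obtain a b where "C k = PiE {..<p} (\<lambda>i. {a i..b i})"
        using C[of k] unfolding K_def box_paving_def by blast
      then show ?thesis by (intro exI[of _ "(a, b)"]) simp
    qed simp
  qed
  from choice[OF this] obtain ab where ab: "\<And>k. k \<in> K \<Longrightarrow> C k = PiE {..<p} (\<lambda>i. {fst (ab k) i..snd (ab k) i})"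
    by blast
  have le: "fst (ab k) i \<le> snd (ab l) i" if "k \<in> K" "l \<in> K" "i < p" for k l i
  proof -
    obtain x where "x \<in> (\<Inter>j\<le>max k l. C j)" using ne[of "max k l"] by blast
    then have "x \<in> C k" "x \<in> C l" by auto
    then have "fst (ab k) i \<le> x i" "x i \<le> snd (ab l) i"
      using ab that by (auto simp: PiE_iff)
    then show ?thesis by simp
  qed
  define y where "y = restrict (\<lambda>i. SUP k\<in>K. fst (ab k) i) {..<p}"
  have "y \<in> C k" for k
  proof (cases "k \<in> K")
    case True
    have "y i \<in> {fst (ab k) i..snd (ab k) i}" if "i < p" for i
    proof -
      have "bdd_above ((\<lambda>k. fst (ab k) i) ` K)" using le k0 that by (auto intro!: bdd_aboveI2)
      then have "fst (ab k) i \<le> (SUP k\<in>K. fst (ab k) i)" using True by (rule cSUP_upper2) simp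
      moreover have "(SUP k\<in>K. fst (ab k) i) \<le> snd (ab k) i"
        using k0 le True that by (intro cSUP_least) auto
      ultimately show ?thesis using that by (simp add: y_def)
    qed
    then show ?thesis unfolding ab[OF True] by (auto simp: PiE_iff y_def)
  next
    case False then show ?thesis by (simp add: K_def)
  qed
  then show ?thesis by blast
qed

lemma space_euclid: "space (euclid p) = PiE {..<p} (\<lambda>_. UNIV)"
  by (simp add: euclid_def space_PiM)

text \<open>The sets that are Suslin together with their complements form a sigma-algebra
  \<open>G\<close>. Equipped with \<open>G\<close>, the product space has measurable projections to
  both factors, so the identity is measurable and \<open>G\<close> contains the product
  sigma-algebra. Only half-spaces in one coordinate have to be checked by hand.\<close>

lemma sets_pair_euclid_suslin:
  assumes A: "A \<in> sets (M \<Otimes>\<^sub>M euclid p)"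
  shows "A \<in> suslin {E \<times> C | E C. E \<in> sets M \<and> C \<in> box_paving p}" (is "_ \<in> suslin ?P")
proof -
  define \<Omega> where "\<Omega> = space M \<times> space (euclid p)"
  define G where "G = {A. A \<subseteq> \<Omega> \<and> A \<in> suslin ?P \<and> \<Omega> - A \<in> suslin ?P}"
  have X: "space M \<times> UNIV \<in> ?P" by (auto simp: box_paving_def)
  have UN: "(\<Union>n. A n) \<in> suslin ?P" if "\<And>n. A n \<in> suslin ?P" "\<And>n. A n \<subseteq> \<Omega>" for A :: "nat \<Rightarrow> _"
    by (rule suslin_UN[OF that(1) X]) (use that(2) in \<open>auto simp: \<Omega>_def\<close>)
  have box: "E \<times> PiE {..<p} (\<lambda>i. {a i..b i}) \<in> suslin ?P" if "E \<in> sets M" for E a b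
    by (rule suslin_base) (use that in \<open>auto simp: box_paving_def\<close>)
  have boxsub: "E \<times> PiE {..<p} (\<lambda>i. {a i..b i}) \<subseteq> \<Omega>" if "E \<in> sets M" for E and a b :: vec
    using sets.sets_into_space[OF that] by (auto simp: \<Omega>_def space_euclid)
  have ubox: "(\<Union>n. E \<times> PiE {..<p} (\<lambda>i. {a n i..b n i})) \<in> suslin ?P" if "E \<in> sets M"
    for E and a b :: "nat \<Rightarrow> vec"
    by (rule UN[OF box boxsub]) (use that in auto)
  have big: "\<exists>n::nat. \<forall>j<p. - real n \<le> x j \<and> x j \<le> real n" for x :: vec
  proof -
    obtain n :: nat where n: "(\<Sum>j<p. \<bar>x j\<bar>) \<le> real n" using real_arch_simple by blast
    have "\<bar>x j\<bar> \<le> real n" if "j < p" for j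
      using member_le_sum[of j "{..<p}" "\<lambda>j. \<bar>x j\<bar>"] that n by simp
    then show ?thesis by (intro exI[of _ n]) (fastforce simp: abs_le_iff)
  qed
  have rect: "E \<times> space (euclid p) \<in> suslin ?P" if "E \<in> sets M" for E
  proof -
    have "E \<times> space (euclid p) = (\<Union>n. E \<times> PiE {..<p} (\<lambda>i. {- real n..real n}))"
      using big by (fastforce simp: space_euclid PiE_iff)
    then show ?thesis using ubox[OF that, of "\<lambda>n i. - real n" "\<lambda>n i. real n"] by simp
  qed
  have le: "{wx \<in> \<Omega>. snd wx i \<le> c} \<in> suslin ?P" if "i < p" for i c
  proof -
    have "{wx \<in> \<Omega>. snd wx i \<le> c} = (\<Union>n. space M \<times> PiE {..<p} (\<lambda>j. {- real n..if j = i then min c (real n) else real n}))" (is "_ = ?U")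
    proof (intro set_eqI iffI)
      fix wx assume wx: "wx \<in> {wx \<in> \<Omega>. snd wx i \<le> c}"
      obtain n :: nat where "\<forall>j<p. - real n \<le> snd wx j \<and> snd wx j \<le> real n" using big by blast
      then have "wx \<in> space M \<times> PiE {..<p} (\<lambda>j. {- real n..if j = i then min c (real n) else real n})"
        using wx by (auto simp: \<Omega>_def space_euclid PiE_iff)
      then show "wx \<in> ?U"
        by blast
    next
      fix wx assume "wx \<in> ?U"
      then obtain n where "fst wx \<in> space M" "snd wx \<in> PiE {..<p} (\<lambda>j. {- real n..if j = i then min c (real n) else real n})"
        by force
      then show "wx \<in> {wx \<in> \<Omega>. snd wx i \<le> c}"
        using that by (cases wx) (force simp: \<Omega>_def space_euclid PiE_iff)
    qed
    then show ?thesis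
      using ubox[OF sets.top, of "\<lambda>n i. - real n" "\<lambda>n j. if j = i then min c (real n) else real n"] by simp
  qed
  have gt: "{wx \<in> \<Omega>. \<not> snd wx i \<le> c} \<in> suslin ?P" if "i < p" for i c
  proof -
    \<comment> \<open>An open half-space is exhausted by closed boxes that keep the margin
      \<open>1 / real (Suc n)\<close> from its boundary.\<close>
    have "{wx \<in> \<Omega>. \<not> snd wx i \<le> c} = (\<Union>n. space M \<times> PiE {..<p} (\<lambda>j. {if j = i then c + 1 / real (Suc n) else - real n..real n}))" (is "_ = ?U")
    proof (intro set_eqI iffI)
      fix wx assume wx: "wx \<in> {wx \<in> \<Omega>. \<not> snd wx i \<le> c}"
      obtain n :: nat where n: "\<forall>j<p. - real n \<le> snd wx j \<and> snd wx j \<le> real n" using big by blast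
      obtain m :: nat where "inverse (real (Suc m)) < snd wx i - c"
        using wx reals_Archimedean[of "snd wx i - c"] by auto
      then have m: "1 / real (Suc m) < snd wx i - c" by (simp add: inverse_eq_divide)
      define l where "l = max m n"
      have "1 / real (Suc l) \<le> 1 / real (Suc m)" by (simp add: l_def frac_le)
      then have "c + 1 / real (Suc l) \<le> snd wx i" using m by linarith
      moreover have "\<forall>j<p. - real l \<le> snd wx j \<and> snd wx j \<le> real l"
        using n by (fastforce simp: l_def max_def)
      ultimately have "wx \<in> space M \<times> PiE {..<p} (\<lambda>j. {if j = i then c + 1 / real (Suc l) else - real l..real l})"
        using wx by (auto simp: \<Omega>_def space_euclid PiE_iff)
      then show "wx \<in> ?U"
        by blast
    next
      fix wx assume "wx \<in> ?U"
      then obtain n where n: "fst wx \<in> space M" "snd wx \<in> PiE {..<p} (\<lambda>j. {if j = i then c + 1 / real (Suc n) else - real n..real n})"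
        by force
      then have "c + 1 / real (Suc n) \<le> snd wx i" using that by (force simp: PiE_iff)
      moreover have "0 < 1 / real (Suc n)" by simp
      ultimately have "\<not> snd wx i \<le> c" by linarith
      then show "wx \<in> {wx \<in> \<Omega>. \<not> snd wx i \<le> c}"
        using n by (cases wx) (auto simp: \<Omega>_def space_euclid PiE_iff)
    qed
    then show ?thesis
      using ubox[OF sets.top, of "\<lambda>n j. if j = i then c + 1 / real (Suc n) else - real n" "\<lambda>n i. real n"] by simp
  qed
  have sa: "sigma_algebra \<Omega> G"
    unfolding sigma_algebra_iff2
  proof (intro conjI ballI allI impI)
    show "G \<subseteq> Pow \<Omega>" by (auto simp: G_def)
    have "{} \<times> UNIV \<in> ?P" unfolding box_paving_def by blast
    then have "{} \<in> ?P" by simp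
    then have "{} \<in> suslin ?P" by (rule suslin_base)
    moreover have "\<Omega> \<in> suslin ?P" unfolding \<Omega>_def by (rule rect) simp
    ultimately show "{} \<in> G" by (simp add: G_def)
    show "\<Omega> - s \<in> G" if "s \<in> G" for s
      using that by (auto simp: G_def double_diff)
    show "(\<Union>i. A i) \<in> G" if "range A \<subseteq> G" for A :: "nat \<Rightarrow> _"
    proof -
      have A: "A n \<subseteq> \<Omega>" "A n \<in> suslin ?P" "\<Omega> - A n \<in> suslin ?P" for n using that by (auto simp: G_def)
      have "\<Omega> - (\<Union>n. A n) = (\<Inter>n. \<Omega> - A n)" by blast
      then show ?thesis using A UN[of A] suslin_INT[of "\<lambda>n. \<Omega> - A n"] by (auto simp: G_def)
    qed
  qed
  define S where "S = sigma \<Omega> G"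
  have space_S: "space S = \<Omega>" and sets_S: "sets S = G"
    using sa unfolding S_def by (auto simp: sigma_algebra.sets_measure_of_eq sigma_algebra.space_measure_of_eq)
  have "fst \<in> measurable S M"
  proof (rule measurableI)
    show "fst x \<in> space M" if "x \<in> space S" for x using that by (auto simp: space_S \<Omega>_def)
    fix E assume E: "E \<in> sets M"
    have "fst -` E \<inter> space S = E \<times> space (euclid p)"
      using sets.sets_into_space[OF E] by (auto simp: space_S \<Omega>_def)
    moreover have "\<Omega> - E \<times> space (euclid p) = (space M - E) \<times> space (euclid p)" by (auto simp: \<Omega>_def)
    moreover have "E \<times> space (euclid p) \<subseteq> \<Omega>" using sets.sets_into_space[OF E] by (auto simp: \<Omega>_def)
    ultimately show "fst -` E \<inter> space S \<in> sets S"
      using rect[OF E] rect[of "space M - E"] E by (simp add: sets_S G_def)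
  qed
  moreover have "snd \<in> measurable S (euclid p)"
    unfolding euclid_def
  proof (rule measurable_PiM_single')
    show "snd \<in> space S \<rightarrow> (\<Pi>\<^sub>E i\<in>{..<p}. space borel)" by (auto simp: space_S \<Omega>_def space_euclid)
    fix i assume "i \<in> {..<p}"
    then have i: "i < p" by simp
    show "(\<lambda>\<omega>. snd \<omega> i) \<in> borel_measurable S"
    proof (rule borel_measurable_iff_le[THEN iffD2], rule allI)
      fix c
      have "\<Omega> - {wx \<in> \<Omega>. snd wx i \<le> c} = {wx \<in> \<Omega>. \<not> snd wx i \<le> c}" by auto
      then show "{w \<in> space S. snd w i \<le> c} \<in> sets S"
        using le[OF i, of c] gt[OF i, of c] by (auto simp: sets_S space_S G_def)
    qed
  qed
  ultimately have "(\<lambda>x. (fst x, snd x)) \<in> measurable S (M \<Otimes>\<^sub>M euclid p)" by (rule measurable_Pair)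
  then have "(\<lambda>x. x) -` A \<inter> space S \<in> sets S" using A by (simp add: measurable_sets)
  moreover have "A \<subseteq> \<Omega>" using sets.sets_into_space[OF A] by (simp add: \<Omega>_def space_pair_measure)
  ultimately show ?thesis by (simp add: space_S sets_S G_def Int_absorb2)
qed

lemma measurable_projection:
  assumes "finite_measure M" and "A \<in> sets (M \<Otimes>\<^sub>M euclid p)"
  shows "fst ` A \<in> sets (completion M)"
  by (rule suslin_projection_measurable[OF box_paving_compact sets_pair_euclid_suslin[OF assms(2)] assms(1)])

text \<open>The set where the supremum exceeds \<open>c\<close> is the projection of the measurable
  set of pairs with \<open>\<theta> \<in> T\<close> and \<open>c < g \<omega> \<theta>\<close>.
  Boundedness is what makes the real supremum satisfy this equivalence.\<close>

lemma borel_measurable_SUP_param: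
  fixes g :: "'a \<Rightarrow> vec \<Rightarrow> real"
  assumes M: "finite_measure M" and T: "T \<in> sets (euclid p)" "T \<noteq> {}"
    and g: "(\<lambda>(\<omega>, \<theta>). g \<omega> \<theta>) \<in> borel_measurable (M \<Otimes>\<^sub>M euclid p)"
    and bdd: "\<And>\<omega>. \<omega> \<in> space M \<Longrightarrow> bdd_above (g \<omega> ` T)"
  shows "(\<lambda>\<omega>. SUP \<theta>\<in>T. g \<omega> \<theta>) \<in> borel_measurable (completion M)"
proof (rule borel_measurable_iff_greater[THEN iffD2], rule allI)
  fix c
  let ?A = "{x \<in> space (M \<Otimes>\<^sub>M euclid p). snd x \<in> T \<and> c < (\<lambda>(\<omega>, \<theta>). g \<omega> \<theta>) x}"
  have "?A = {x \<in> space (M \<Otimes>\<^sub>M euclid p). snd x \<in> T} \<inter> {x \<in> space (M \<Otimes>\<^sub>M euclid p). c < (\<lambda>(\<omega>, \<theta>). g \<omega> \<theta>) x}"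
    by auto
  also have "\<dots> \<in> sets (M \<Otimes>\<^sub>M euclid p)"
  proof (rule sets.Int)
    show "{x \<in> space (M \<Otimes>\<^sub>M euclid p). snd x \<in> T} \<in> sets (M \<Otimes>\<^sub>M euclid p)"
      using measurable_sets[OF measurable_snd T(1), of M] by (simp add: vimage_def Int_def conj_commute)
    show "{x \<in> space (M \<Otimes>\<^sub>M euclid p). c < (\<lambda>(\<omega>, \<theta>). g \<omega> \<theta>) x} \<in> sets (M \<Otimes>\<^sub>M euclid p)"
      using g borel_measurable_iff_greater by blast
  qed
  finally have "fst ` ?A \<in> sets (completion M)" by (rule measurable_projection[OF M])
  moreover have "fst ` ?A = {\<omega> \<in> space (completion M). c < (SUP \<theta>\<in>T. g \<omega> \<theta>)}"
  proof (intro set_eqI iffI)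
    fix \<omega> assume "\<omega> \<in> fst ` ?A"
    then obtain \<theta> where \<theta>: "\<omega> \<in> space M" "\<theta> \<in> T" "c < g \<omega> \<theta>" by (auto simp: space_pair_measure)
    then show "\<omega> \<in> {\<omega> \<in> space (completion M). c < (SUP \<theta>\<in>T. g \<omega> \<theta>)}"
      using less_cSUP_iff[OF T(2) bdd] by auto
  next
    fix \<omega> assume "\<omega> \<in> {\<omega> \<in> space (completion M). c < (SUP \<theta>\<in>T. g \<omega> \<theta>)}"
    then have "\<omega> \<in> space M" "c < (SUP \<theta>\<in>T. g \<omega> \<theta>)" by auto
    then obtain \<theta> where "\<theta> \<in> T" "c < g \<omega> \<theta>" using less_cSUP_iff[OF T(2) bdd] by auto
    then have "(\<omega>, \<theta>) \<in> ?A"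
      using \<open>\<omega> \<in> space M\<close> sets.sets_into_space[OF T(1)] by (auto simp: space_pair_measure)
    then show "\<omega> \<in> fst ` ?A" by force
  qed
  ultimately show "{\<omega> \<in> space (completion M). c < (SUP \<theta>\<in>T. g \<omega> \<theta>)} \<in> sets (completion M)" by simp
qed

section \<open>Covering numbers of VC-subgraph classes\<close>

lemma shattersD: "shatters \<C> S \<Longrightarrow> T \<subseteq> S \<Longrightarrow> \<exists>c\<in>\<C>. c \<inter> S = T"
  by (simp add: shatters_def)

text \<open>Pajor's form of the Sauer-Shelah lemma. Removing \<open>x\<close> splits
  \<open>F\<close> into its traces \<open>F0\<close> and the traces \<open>F1\<close> that occur
  both with and without \<open>x\<close>. A set shattered by \<open>F1\<close> remains shattered by
  \<open>F\<close> after adding \<open>x\<close>, so the two induction hypotheses count disjoint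
  families.\<close>

lemma card_le_card_shattered:
  assumes "finite X" "F \<subseteq> Pow X"
  shows "card F \<le> card {S. S \<subseteq> X \<and> shatters F S}"
  using assms
proof (induction X arbitrary: F)
  case empty
  then have "F = {} \<or> F = {{}}" by auto
  then show ?case
  proof
    assume "F = {{}}"
    then have "{S. S \<subseteq> {} \<and> shatters F S} = {{}}" by (auto simp: shatters_def)
    then show ?thesis using \<open>F = {{}}\<close> by simp
  qed simp
next
  case (insert x X)
  define F0 where "F0 = (\<lambda>c. c - {x}) ` F"
  define F1 where "F1 = {c. c \<in> F \<and> x \<notin> c \<and> insert x c \<in> F}"
  have finF: "finite F" using insert.prems insert.hyps by (meson finite.insertI finite_Pow_iff finite_subset)
  have sub0: "F0 \<subseteq> Pow X" using insert.prems by (auto simp: F0_def)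
  have sub1: "F1 \<subseteq> Pow X" using insert.prems by (auto simp: F1_def)
  have "card F = card F0 + card F1"
  proof -
    let ?A = "{c \<in> F. x \<notin> c}" and ?B = "{c \<in> F. x \<in> c}"
    have "F = ?A \<union> ?B" by auto
    then have "card F = card ?A + card ?B"
      using finF by (metis (no_types, lifting) card_Un_disjoint disjoint_iff finite_Un mem_Collect_eq)
    also have "card ?B = card ((\<lambda>c. c - {x}) ` ?B)"
      by (rule card_image[symmetric]) (auto simp: inj_on_def)
    finally have 1: "card F = card ?A + card ((\<lambda>c. c - {x}) ` ?B)" .
    have "F0 = (\<lambda>c. c - {x}) ` (?A \<union> ?B)"
      unfolding F0_def using \<open>F = ?A \<union> ?B\<close> by (rule arg_cong)
    also have "\<dots> = (\<lambda>c. c - {x}) ` ?A \<union> (\<lambda>c. c - {x}) ` ?B" by (rule image_Un)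
    also have "(\<lambda>c. c - {x}) ` ?A = (\<lambda>c. c) ` ?A" by (rule image_cong) auto
    finally have F0: "F0 = ?A \<union> (\<lambda>c. c - {x}) ` ?B" by simp
    have F1: "F1 = ?A \<inter> (\<lambda>c. c - {x}) ` ?B"
    proof (intro set_eqI iffI)
      fix c assume c: "c \<in> F1"
      then have "c = insert x c - {x}" by (auto simp: F1_def)
      then show "c \<in> ?A \<inter> (\<lambda>c. c - {x}) ` ?B" using c by (auto simp: F1_def)
    next
      fix c assume "c \<in> ?A \<inter> (\<lambda>c. c - {x}) ` ?B"
      then show "c \<in> F1" by (auto simp: F1_def insert_absorb)
    qed
    show ?thesis unfolding 1 F0 F1 by (rule card_Un_Int) (use finF in auto)
  qed
  also have "\<dots> \<le> card {S. S \<subseteq> X \<and> shatters F0 S} + card {S. S \<subseteq> X \<and> shatters F1 S}"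
    by (intro add_mono insert.IH sub0 sub1)
  also have "\<dots> = card {S. S \<subseteq> X \<and> shatters F0 S} + card (insert x ` {S. S \<subseteq> X \<and> shatters F1 S})"
  proof -
    have "inj_on (insert x) {S. S \<subseteq> X \<and> shatters F1 S}"
      using insert.hyps(2) by (auto simp: inj_on_def dest!: insert_ident[THEN iffD1, rotated 2])
    then show ?thesis by (simp add: card_image)
  qed
  also have "\<dots> = card ({S. S \<subseteq> X \<and> shatters F0 S} \<union> insert x ` {S. S \<subseteq> X \<and> shatters F1 S})"
    using insert.hyps by (intro card_Un_disjoint[symmetric]) auto
  also have "\<dots> \<le> card {S. S \<subseteq> insert x X \<and> shatters F S}"
  proof (rule card_mono)
    show "finite {S. S \<subseteq> insert x X \<and> shatters F S}" using insert.hyps by simp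
    have "shatters F S" if S: "S \<subseteq> X" "shatters F0 S" for S
      unfolding shatters_def
    proof (intro allI impI)
      fix T assume "T \<subseteq> S"
      then obtain c where c: "c \<in> F0" "c \<inter> S = T" using shattersD[OF S(2)] by blast
      then obtain d where "d \<in> F" "c = d - {x}" by (auto simp: F0_def)
      moreover have "(d - {x}) \<inter> S = d \<inter> S" for d using S(1) insert.hyps by auto
      ultimately show "\<exists>c\<in>F. c \<inter> S = T" using c by metis
    qed
    moreover have "shatters F (insert x S)" if S: "S \<subseteq> X" "shatters F1 S" for S
      unfolding shatters_def
    proof (intro allI impI)
      fix T assume T: "T \<subseteq> insert x S"
      then have "T - {x} \<subseteq> S" by auto
      then obtain c where c: "c \<in> F1" "c \<inter> S = T - {x}" using shattersD[OF S(2)] by blast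
      show "\<exists>c\<in>F. c \<inter> insert x S = T"
      proof (cases "x \<in> T")
        case True
        then have "insert x c \<inter> insert x S = T" using c(2) by auto
        moreover have "insert x c \<in> F" using c(1) by (simp add: F1_def)
        ultimately show ?thesis by (rule bexI)
      next
        case False
        moreover have "c \<in> F" "x \<notin> c" using c(1) by (simp_all add: F1_def)
        ultimately have "c \<inter> insert x S = T" using c(2) by auto
        then show ?thesis using \<open>c \<in> F\<close> by (rule bexI)
      qed
    qed
    ultimately show "{S. S \<subseteq> X \<and> shatters F0 S} \<union> insert x ` {S. S \<subseteq> X \<and> shatters F1 S}
        \<subseteq> {S. S \<subseteq> insert x X \<and> shatters F S}" by auto
  qed
  finally show ?case .
qed

lemma sum_power_card_Pow:
  fixes x :: real
  assumes "finite X"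
  shows "(\<Sum>S\<in>Pow X. x ^ card S) = (1 + x) ^ card X"
  using assms
proof (induction X)
  case (insert a X)
  have "(\<Sum>S\<in>Pow (insert a X). x ^ card S) = (\<Sum>S\<in>Pow X. x ^ card S) + (\<Sum>S\<in>insert a ` Pow X. x ^ card S)"
    unfolding Pow_insert using insert by (intro sum.union_disjoint) auto
  also have "(\<Sum>S\<in>insert a ` Pow X. x ^ card S) = (\<Sum>S\<in>Pow X. x ^ card (insert a S))"
    using insert.hyps by (subst sum.reindex) (auto simp: inj_on_def dest!: insert_ident[THEN iffD1, rotated 2])
  also have "\<dots> = (\<Sum>S\<in>Pow X. x * x ^ card S)"
    using insert.hyps by (intro sum.cong) (auto simp: card_insert_if finite_subset)
  finally show ?case using insert by (simp add: sum_distrib_left[symmetric] algebra_simps)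
qed simp

text \<open>An upper bound instead of the exact dimension, because it is inherited by subclasses, in
  particular by a ball in the parameter set and by finite nets.\<close>

definition vc_le :: "'a set set \<Rightarrow> nat \<Rightarrow> bool" where
  "vc_le \<C> \<nu> \<longleftrightarrow> (\<forall>S. finite S \<longrightarrow> shatters \<C> S \<longrightarrow> card S \<le> \<nu>)"

lemma vc_dim_imp_vc_le:
  assumes "vc_dim \<C> = enat \<nu>"
  shows "vc_le \<C> \<nu>"
  unfolding vc_le_def
proof (intro allI impI)
  fix S assume "finite S" "shatters \<C> S"
  then have "enat (card S) \<le> vc_dim \<C>" unfolding vc_dim_def by (intro SUP_upper) simp
  then show "card S \<le> \<nu>" using assms by simp
qed

lemma vc_le_mono: "vc_le \<C> \<nu> \<Longrightarrow> \<D> \<subseteq> \<C> \<Longrightarrow> vc_le \<D> \<nu>"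
  unfolding vc_le_def
proof (intro allI impI)
  fix S assume vc: "\<forall>S. finite S \<longrightarrow> shatters \<C> S \<longrightarrow> card S \<le> \<nu>" and sub: "\<D> \<subseteq> \<C>"
    and S: "finite S" "shatters \<D> S"
  have "\<exists>c\<in>\<C>. c \<inter> S = T" if "T \<subseteq> S" for T
    using shattersD[OF S(2) that] sub by blast
  then have "shatters \<C> S" by (simp add: shatters_def)
  then show "card S \<le> \<nu>" using vc S(1) by blast
qed

text \<open>A shattered set has at most \<open>\<nu>\<close> elements, so for
  \<open>x \<le> 1\<close> it may be counted with the weight \<open>x ^ card S / x ^ \<nu>\<close>,
  which is at least 1. Extending the sum to all subsets gives a closed form with a free parameter in
  place of a binomial sum.\<close>

lemma card_traces_le:
  fixes x :: real
  assumes V: "finite V" and F: "F \<subseteq> Pow V" and vc: "vc_le F \<nu>" and x: "0 < x" "x \<le> 1"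
  shows "real (card F) \<le> (1 + x) ^ card V / x ^ \<nu>"
proof -
  have "real (card F) \<le> real (card {S. S \<subseteq> V \<and> shatters F S})"
    using card_le_card_shattered[OF V F] by simp
  also have "\<dots> = (\<Sum>S\<in>{S. S \<subseteq> V \<and> shatters F S}. 1)" by simp
  also have "\<dots> \<le> (\<Sum>S\<in>{S. S \<subseteq> V \<and> shatters F S}. x ^ card S / x ^ \<nu>)"
  proof (rule sum_mono)
    fix S assume "S \<in> {S. S \<subseteq> V \<and> shatters F S}"
    then have "card S \<le> \<nu>" using vc V by (auto simp: vc_le_def intro: finite_subset)
    then have "x ^ \<nu> \<le> x ^ card S" using x by (intro power_decreasing) auto
    then show "1 \<le> x ^ card S / x ^ \<nu>" using x by simp
  qed
  also have "\<dots> \<le> (\<Sum>S\<in>Pow V. x ^ card S / x ^ \<nu>)"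
    using V x by (intro sum_mono2) auto
  also have "\<dots> = (1 + x) ^ card V / x ^ \<nu>"
    by (simp add: sum_divide_distrib[symmetric] sum_power_card_Pow[OF V])
  finally show ?thesis .
qed

text \<open>
  If two functions are far apart in \<open>L\<^sup>1\<close>, then a large proportion of the points below the bound
  separates them; hence some point separates a fixed proportion of any set of such pairs.
\<close>

definition separates :: "('p \<Rightarrow> 'q \<Rightarrow> real) \<Rightarrow> 'q \<times> real \<Rightarrow> 'p \<times> 'p \<Rightarrow> bool" where
  "separates g v ab \<longleftrightarrow> (snd v < g (fst ab) (fst v)) \<noteq> (snd v < g (snd ab) (fst v))"

lemma exists_separating_point:
  fixes g :: "'p \<Rightarrow> 'q \<Rightarrow> real"
  assumes Q: "finite Q" and U: "finite U" "U \<noteq> {}" and B: "0 \<le> B"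
    and g: "\<And>a b q. (a, b) \<in> U \<Longrightarrow> q \<in> Q \<Longrightarrow> \<bar>g a q\<bar> \<le> B \<and> \<bar>g b q\<bar> \<le> B"
    and sep: "\<And>a b. (a, b) \<in> U \<Longrightarrow> 2 * B * u * real (card Q) < (\<Sum>q\<in>Q. \<bar>g a q - g b q\<bar>)"
  shows "\<exists>v\<in>Q \<times> UNIV. u * real (card U) \<le> real (card {ab \<in> U. separates g v ab})"
proof (rule ccontr)
  assume neg: "\<not> ?thesis"
  have cnt: "real (card {ab \<in> U. separates g (q, t) ab}) \<le> u * real (card U)" if "q \<in> Q" for q t
  proof -
    have "(q, t) \<in> Q \<times> UNIV" using that by simp
    then have "\<not> u * real (card U) \<le> real (card {ab \<in> U. separates g (q, t) ab})"
      using neg by blast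
    then show ?thesis by simp
  qed
  \<comment> \<open>At a fixed \<open>q\<close> the thresholds \<open>t\<close> separating a pair
    form an interval of length equal to the difference of the two values. Integrating the counting
    bound over \<open>t\<close>, where only \<open>{-B..B}\<close> contributes, bounds the summed
    differences.\<close>
  have q: "(\<Sum>ab\<in>U. \<bar>g (fst ab) q - g (snd ab) q\<bar>) \<le> 2 * B * u * real (card U)" if q: "q \<in> Q" for q
  proof -
    let ?I = "\<lambda>ab. {min (g (fst ab) q) (g (snd ab) q)..<max (g (fst ab) q) (g (snd ab) q)}"
    have sepI: "separates g (q, t) ab \<longleftrightarrow> t \<in> ?I ab" for ab t
      by (auto simp: separates_def min_def max_def)
    have fin: "emeasure lborel (?I ab) < \<infinity>" for ab
      by (subst emeasure_lborel_Ico) (auto simp: min_def max_def)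
    have "(\<Sum>ab\<in>U. \<bar>g (fst ab) q - g (snd ab) q\<bar>) = (\<Sum>ab\<in>U. \<integral>t. indicator (?I ab) t \<partial>lborel)"
      by (intro sum.cong) (auto simp: min_def max_def)
    also have "\<dots> = (\<integral>t. (\<Sum>ab\<in>U. indicator (?I ab) t) \<partial>lborel)"
      by (intro Bochner_Integration.integral_sum[symmetric]) (use fin in auto)
    also have "\<dots> \<le> (\<integral>t. u * real (card U) * indicator {-B..B} t \<partial>lborel)"
    proof (rule integral_mono)
      show "integrable lborel (\<lambda>t. \<Sum>ab\<in>U. indicator (?I ab) t :: real)"
        by (intro Bochner_Integration.integrable_sum) (use fin in auto)
      show "integrable lborel (\<lambda>t. u * real (card U) * indicator {-B..B} t)"
        using B by (intro integrable_mult_right) (auto simp: emeasure_lborel_Icc)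
      fix t :: real
      have eq: "(\<Sum>ab\<in>U. indicator (?I ab) t :: real) = real (card {ab \<in> U. separates g (q, t) ab})"
        unfolding sepI indicator_def using U(1)
        by (simp add: sum.If_cases Int_def)
      show "(\<Sum>ab\<in>U. indicator (?I ab) t :: real) \<le> u * real (card U) * indicator {-B..B} t"
      proof (cases "t \<in> {-B..B}")
        case True then show ?thesis unfolding eq using cnt[OF q] by simp
      next
        case False
        have "t \<notin> ?I ab" if "ab \<in> U" for ab
          using g[of "fst ab" "snd ab" q] that q False by (auto simp: min_def max_def abs_le_iff)
        then show ?thesis using False by simp
      qed
    qed
    also have "\<dots> = 2 * B * u * real (card U)" using B by simp
    finally show ?thesis .
  qed
  have "2 * B * u * real (card Q) * real (card U) = (\<Sum>ab\<in>U. 2 * B * u * real (card Q))" by simp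
  also have "\<dots> < (\<Sum>ab\<in>U. \<Sum>q\<in>Q. \<bar>g (fst ab) q - g (snd ab) q\<bar>)"
    using U sep by (intro sum_strict_mono) auto
  also have "\<dots> = (\<Sum>q\<in>Q. \<Sum>ab\<in>U. \<bar>g (fst ab) q - g (snd ab) q\<bar>)" by (rule sum.swap)
  also have "\<dots> \<le> (\<Sum>q\<in>Q. 2 * B * u * real (card U))" by (intro sum_mono q)
  also have "\<dots> = 2 * B * u * real (card Q) * real (card U)" by simp
  finally show False by simp
qed

text \<open>A greedy choice plays the role of random sampling: each new point separates at least the
  fraction \<open>u\<close> of the pairs not yet separated, so the remaining number decays
  geometrically.\<close>

lemma exists_separating_set:
  fixes g :: "'p \<Rightarrow> 'q \<Rightarrow> real"
  assumes Q: "finite Q" and U: "finite U" and B: "0 \<le> B" and u: "u \<le> 1"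
    and g: "\<And>a b q. (a, b) \<in> U \<Longrightarrow> q \<in> Q \<Longrightarrow> \<bar>g a q\<bar> \<le> B \<and> \<bar>g b q\<bar> \<le> B"
    and sep: "\<And>a b. (a, b) \<in> U \<Longrightarrow> 2 * B * u * real (card Q) < (\<Sum>q\<in>Q. \<bar>g a q - g b q\<bar>)"
  shows "\<exists>V. finite V \<and> card V \<le> k \<and> V \<subseteq> Q \<times> UNIV \<and>
     real (card {ab \<in> U. \<forall>v\<in>V. \<not> separates g v ab}) \<le> (1 - u) ^ k * real (card U)"
proof (induction k)
  case 0 show ?case by (intro exI[of _ "{}"]) simp
next
  case (Suc k)
  then obtain V where V: "finite V" "card V \<le> k" "V \<subseteq> Q \<times> UNIV"
    "real (card {ab \<in> U. \<forall>v\<in>V. \<not> separates g v ab}) \<le> (1 - u) ^ k * real (card U)" by blast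
  define W where "W = {ab \<in> U. \<forall>v\<in>V. \<not> separates g v ab}"
  have W: "finite W" "W \<subseteq> U" using U by (auto simp: W_def)
  show ?case
  proof (cases "W = {}")
    case True
    show ?thesis
    proof (intro exI[of _ V] conjI)
      have "0 \<le> (1 - u) ^ Suc k * real (card U)" using u by simp
      then show "real (card {ab \<in> U. \<forall>v\<in>V. \<not> separates g v ab}) \<le> (1 - u) ^ Suc k * real (card U)"
        using True unfolding W_def[symmetric] by simp
    qed (use V in auto)
  next
    case False
    have "\<exists>v\<in>Q \<times> UNIV. u * real (card W) \<le> real (card {ab \<in> W. separates g v ab})"
      by (rule exists_separating_point[OF Q W(1) False B]) (use W g sep in blast)+
    then obtain v where v: "v \<in> Q \<times> UNIV" "u * real (card W) \<le> real (card {ab \<in> W. separates g v ab})" by blast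
    have eq: "{ab \<in> U. \<forall>w\<in>insert v V. \<not> separates g w ab} = W - {ab \<in> W. separates g v ab}"
      by (auto simp: W_def)
    have "card (W - {ab \<in> W. separates g v ab}) = card W - card {ab \<in> W. separates g v ab}"
      using W by (intro card_Diff_subset) auto
    moreover have "card {ab \<in> W. separates g v ab} \<le> card W" using W by (intro card_mono) auto
    ultimately have "real (card {ab \<in> U. \<forall>w\<in>insert v V. \<not> separates g w ab}) \<le> (1 - u) * real (card W)"
      unfolding eq using v(2) by (simp add: algebra_simps of_nat_diff)
    also have "\<dots> \<le> (1 - u) * ((1 - u) ^ k * real (card U))"
      using V(4) u unfolding W_def by (intro mult_left_mono) auto
    finally show ?thesis
      using V v by (intro exI[of _ "insert v V"]) (auto simp: card_insert_if)
  qed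
qed

text \<open>Few points already distinguish all members of the packing, so its cardinality is a
  number of traces and the shattering bound applies. That bound contains the number of points, hence
  the logarithm \<open>L\<close> itself, but with the factor one half, and can be solved for
  \<open>L\<close>.\<close>

lemma ln_card_separated_le:
  fixes g :: "'p \<Rightarrow> 'x \<Rightarrow> real" and pt :: "'q \<Rightarrow> 'x"
  assumes Q: "finite Q" and pt: "pt \<in> Q \<rightarrow> X" and T: "finite T" and B: "0 \<le> B"
    and u: "0 < u" "u \<le> 1" and \<nu>: "1 \<le> \<nu>"
    and g: "\<And>a x. a \<in> T \<Longrightarrow> x \<in> X \<Longrightarrow> \<bar>g a x\<bar> \<le> B"
    and vc: "vc_le ((\<lambda>a. subgraph X (g a)) ` T) \<nu>"
    and sep: "\<And>a b. a \<in> T \<Longrightarrow> b \<in> T \<Longrightarrow> a \<noteq> b \<Longrightarrow>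
      2 * B * u * real (card Q) < (\<Sum>q\<in>Q. \<bar>g a (pt q) - g b (pt q)\<bar>)"
  shows "ln (real (card T)) \<le> 3 * real \<nu> * ln (4 / u)"
proof (cases "card T \<le> 1")
  case True
  have "1 \<le> 4 / u" using u by (simp add: field_simps)
  then have "0 \<le> 3 * real \<nu> * ln (4 / u)" by simp
  moreover have "ln (real (card T)) = 0" using True by (cases "card T") auto
  ultimately show ?thesis by simp
next
  case False
  define L where "L = ln (real (card T))"
  have L: "0 < L" "exp L = real (card T)" using False by (auto simp: L_def)
  \<comment> \<open>The least choice for which \<open>exp (- u * k)\<close> falls strictly below
    \<open>1 / (card T)^2\<close>, so that less than one unseparated pair remains.\<close>
  define k where "k = nat \<lfloor>2 * L / u\<rfloor> + 1"
  have k: "2 * L / u < real k" "real k \<le> 2 * L / u + 1"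
  proof -
    have "0 \<le> 2 * L / u" using L u by simp
    then show "2 * L / u < real k" "real k \<le> 2 * L / u + 1" unfolding k_def by linarith+
  qed
  define g' where "g' a q = g a (pt q)" for a q
  define U where "U = {(a, b). a \<in> T \<and> b \<in> T \<and> a \<noteq> b}"
  have Usub: "U \<subseteq> T \<times> T" by (auto simp: U_def)
  then have finU: "finite U" using T finite_subset by blast
  have "\<exists>V. finite V \<and> card V \<le> k \<and> V \<subseteq> Q \<times> UNIV \<and>
     real (card {ab \<in> U. \<forall>v\<in>V. \<not> separates g' v ab}) \<le> (1 - u) ^ k * real (card U)"
    by (rule exists_separating_set[OF Q finU B u(2)])
      (use g sep pt in \<open>auto simp: U_def g'_def Pi_iff\<close>)
  then obtain V where V: "finite V" "card V \<le> k" "V \<subseteq> Q \<times> UNIV"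
     "real (card {ab \<in> U. \<forall>v\<in>V. \<not> separates g' v ab}) \<le> (1 - u) ^ k * real (card U)" by blast
  have "(1 - u) ^ k \<le> exp (- u) ^ k"
    using u exp_ge_add_one_self[of "-u"] by (intro power_mono) auto
  also have "\<dots> = exp (- (u * real k))" by (simp add: exp_of_nat_mult[symmetric] mult.commute)
  also have "\<dots> < exp (- (2 * L))" using k(1) u by (simp add: field_simps)
  also have "exp (- (2 * L)) = 1 / (real (card T))\<^sup>2"
    unfolding L(2)[symmetric] by (simp add: exp_minus exp_double inverse_eq_divide)
  finally have "(1 - u) ^ k * (real (card T))\<^sup>2 < 1" using False by (simp add: field_simps)
  moreover have "real (card U) \<le> (real (card T))\<^sup>2"
    using card_mono[OF _ Usub] T by (simp add: card_cartesian_product power2_eq_square of_nat_mult[symmetric] del: of_nat_mult)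
  then have "(1 - u) ^ k * real (card U) \<le> (1 - u) ^ k * (real (card T))\<^sup>2"
    using u by (intro mult_left_mono) auto
  ultimately have "real (card {ab \<in> U. \<forall>v\<in>V. \<not> separates g' v ab}) < 1" using V(4) by linarith
  then have "{ab \<in> U. \<forall>v\<in>V. \<not> separates g' v ab} = {}" using finU by simp
  then have Vsep: "\<exists>v\<in>V. separates g' v (a, b)" if "a \<in> T" "b \<in> T" "a \<noteq> b" for a b
    using that by (auto simp: U_def)
  \<comment> \<open>The VC condition concerns points of \<open>X\<close>, while the separating
    points are indexed by \<open>Q\<close>. The map \<open>pt\<close> may repeat points; passing to
    the image does not increase the number of points.\<close>
  define V' where "V' = (\<lambda>(q, t). (pt q, t)) ` V"
  define tr where "tr a = subgraph X (g a) \<inter> V'" for a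
  have V': "finite V'" "card V' \<le> k"
    unfolding V'_def using V card_image_le[OF V(1)] by (auto intro: order_trans)
  have "inj_on tr T"
  proof (rule inj_onI, rule ccontr)
    fix a b assume ab: "a \<in> T" "b \<in> T" "tr a = tr b" "a \<noteq> b"
    obtain q t where v: "(q, t) \<in> V" "separates g' (q, t) (a, b)" using Vsep[OF ab(1,2,4)] by auto
    have "pt q \<in> X" "(pt q, t) \<in> V'" using v V(3) pt by (auto simp: V'_def Pi_iff)
    then have "(pt q, t) \<in> tr c \<longleftrightarrow> t < g c (pt q)" for c by (simp add: tr_def subgraph_def)
    then show False using v(2) ab(3) by (auto simp: separates_def g'_def)
  qed
  then have "card (tr ` T) = card T" by (rule card_image)
  have "vc_le (tr ` T) \<nu>"
    unfolding vc_le_def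
  proof (intro allI impI)
    fix S assume S: "finite S" "shatters (tr ` T) S"
    obtain a where "a \<in> T" "tr a \<inter> S = S" using shattersD[OF S(2), of S] by auto
    then have SV: "S \<subseteq> V'" by (auto simp: tr_def)
    have "shatters ((\<lambda>a. subgraph X (g a)) ` T) S"
      unfolding shatters_def
    proof (intro allI impI)
      fix R assume "R \<subseteq> S"
      then obtain a where "a \<in> T" "tr a \<inter> S = R" using shattersD[OF S(2), of R] by auto
      then have "subgraph X (g a) \<inter> S = R" using SV by (auto simp: tr_def)
      then show "\<exists>c\<in>(\<lambda>a. subgraph X (g a)) ` T. c \<inter> S = R" using \<open>a \<in> T\<close> by blast
    qed
    then show "card S \<le> \<nu>" using vc S(1) by (simp add: vc_le_def)
  qed
  \<comment> \<open>The weight \<open>x = u / 4\<close> makes the contribution of the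
    \<open>k\<close> points at most \<open>u / 4 * k\<close>, which is \<open>L / 2\<close> plus a
    small term. The resulting \<open>u / 2\<close> is absorbed at the end because
    \<open>ln (4 / u)\<close> is at least 1.\<close>
  then have "real (card (tr ` T)) \<le> (1 + u / 4) ^ card V' / (u / 4) ^ \<nu>"
    using u V' by (intro card_traces_le) (auto simp: tr_def)
  also have "\<dots> \<le> (1 + u / 4) ^ k / (u / 4) ^ \<nu>"
    using u V' by (intro divide_right_mono power_increasing) auto
  also have "\<dots> \<le> exp (u / 4) ^ k / (u / 4) ^ \<nu>"
    using u exp_ge_add_one_self[of "u / 4"] by (intro divide_right_mono power_mono) auto
  also have "\<dots> = exp (u / 4 * real k + real \<nu> * ln (4 / u))"
  proof -
    have "exp (real \<nu> * ln (4 / u)) = (4 / u) ^ \<nu>"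
      using u by (simp add: exp_of_nat_mult)
    then show ?thesis using u by (simp add: exp_add exp_of_nat_mult[symmetric] mult.commute power_divide)
  qed
  finally have "exp L \<le> exp (u / 4 * real k + real \<nu> * ln (4 / u))"
    unfolding L(2) \<open>card (tr ` T) = card T\<close> .
  then have 1: "L \<le> u / 4 * real k + real \<nu> * ln (4 / u)" by simp
  have "u / 4 * real k \<le> u / 4 * (2 * L / u + 1)" using k(2) u by (intro mult_left_mono) auto
  also have "\<dots> = L / 2 + u / 4" using u by (simp add: field_simps)
  finally have 2: "L \<le> u / 2 + 2 * (real \<nu> * ln (4 / u))" using 1 by simp
  have "exp 1 \<le> (4::real)" using exp_le by linarith
  also have "4 \<le> 4 / u" using u by (simp add: field_simps)
  finally have "1 \<le> ln (4 / u)" using u by (simp add: ln_ge_iff)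
  then have "1 * 1 \<le> real \<nu> * ln (4 / u)" using \<nu> by (intro mult_mono) auto
  then show ?thesis using 2 u unfolding L_def by simp
qed

text \<open>A separated subset of maximal cardinality is a net, since any point far from all its
  members could be added. The maximum exists because the packing bound limits the cardinality
  uniformly.\<close>

lemma exists_vc_cover:
  fixes g :: "'p \<Rightarrow> 'x \<Rightarrow> real" and pt :: "'q \<Rightarrow> 'x"
  assumes Q: "finite Q" and pt: "pt \<in> Q \<rightarrow> X" and T: "T \<noteq> {}" and B: "0 \<le> B"
    and u: "0 < u" "u \<le> 1" and \<nu>: "1 \<le> \<nu>"
    and g: "\<And>a x. a \<in> T \<Longrightarrow> x \<in> X \<Longrightarrow> \<bar>g a x\<bar> \<le> B"
    and vc: "vc_le ((\<lambda>a. subgraph X (g a)) ` T) \<nu>"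
  shows "\<exists>N. finite N \<and> N \<noteq> {} \<and> N \<subseteq> T \<and> ln (real (card N)) \<le> 3 * real \<nu> * ln (4 / u) \<and>
     (\<forall>a\<in>T. \<exists>s\<in>N. (\<Sum>q\<in>Q. \<bar>g a (pt q) - g s (pt q)\<bar>) \<le> 2 * B * u * real (card Q))"
proof -
  define far where "far a b \<longleftrightarrow> 2 * B * u * real (card Q) < (\<Sum>q\<in>Q. \<bar>g a (pt q) - g b (pt q)\<bar>)" for a b
  have far_sym: "far a b = far b a" for a b unfolding far_def by (simp add: abs_minus_commute)
  define P where "P N \<longleftrightarrow> finite N \<and> N \<subseteq> T \<and> (\<forall>a\<in>N. \<forall>b\<in>N. a \<noteq> b \<longrightarrow> far a b)" for N
  have bound: "ln (real (card N)) \<le> 3 * real \<nu> * ln (4 / u)" if "P N" for N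
  proof (rule ln_card_separated_le[OF Q pt _ B u \<nu>, where g = g])
    show "vc_le ((\<lambda>a. subgraph X (g a)) ` N) \<nu>"
      by (rule vc_le_mono[OF vc]) (use that in \<open>auto simp: P_def\<close>)
  qed (use that g in \<open>auto simp: P_def far_def\<close>)
  define K where "K = nat \<lfloor>exp (3 * real \<nu> * ln (4 / u))\<rfloor>"
  have "card N < Suc K" if "P N" for N
  proof (cases "card N = 0")
    case False
    then have "real (card N) = exp (ln (real (card N)))" by simp
    also have "\<dots> \<le> exp (3 * real \<nu> * ln (4 / u))" using bound[OF that] by simp
    finally have "card N \<le> K" unfolding K_def by linarith
    then show ?thesis by simp
  qed simp
  moreover have "P {}" by (simp add: P_def)
  ultimately obtain N where N: "P N" "\<And>N'. P N' \<Longrightarrow> card N' \<le> card N"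
    using ex_has_greatest_nat[of P "{}" card "Suc K"] by blast
  have cov: "\<exists>s\<in>N. \<not> far a s" if a: "a \<in> T" for a
  proof (cases "a \<in> N")
    case True
    have "0 \<le> 2 * B * u * real (card Q)" using B u by simp
    then have "\<not> far a a" unfolding far_def by simp
    then show ?thesis using True by blast
  next
    case False
    show ?thesis
    proof (rule ccontr)
      assume "\<not> ?thesis"
      then have "P (insert a N)" using N(1) a far_sym unfolding P_def by auto
      then have "card (insert a N) \<le> card N" by (rule N(2))
      then show False using False N(1) by (auto simp: P_def)
    qed
  qed
  moreover have "N \<noteq> {}" using cov T by blast
  ultimately show ?thesis
    using N(1) bound[OF N(1)] unfolding P_def far_def not_less
    by (intro exI[of _ N] conjI ballI) auto
qed

section \<open>Rademacher averages and chaining\<close>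

text \<open>A sign vector is coded by the set of its negative entries. Rademacher expectations then
  are finite averages over \<open>Pow A\<close>, and the same set later names the observations
  exchanged with their copies.\<close>

definition rsign :: "nat set \<Rightarrow> nat \<Rightarrow> real" where
  "rsign S i = (if i \<in> S then - 1 else 1)"

definition rmean :: "nat set \<Rightarrow> (nat set \<Rightarrow> real) \<Rightarrow> real" where
  "rmean A F = (\<Sum>S\<in>Pow A. F S) / 2 ^ card A"

lemma rmean_mono: "(\<And>S. S \<subseteq> A \<Longrightarrow> F S \<le> G S) \<Longrightarrow> rmean A F \<le> rmean A G"
  unfolding rmean_def by (intro divide_right_mono sum_mono) auto

lemma rmean_cong: "(\<And>S. S \<subseteq> A \<Longrightarrow> F S = G S) \<Longrightarrow> rmean A F = rmean A G"
  unfolding rmean_def by (intro arg_cong2[where f = "(/)"] sum.cong) auto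

lemma rmean_const: "finite A \<Longrightarrow> rmean A (\<lambda>_. c) = c"
  by (simp add: rmean_def card_Pow)

lemma rmean_add: "rmean A (\<lambda>S. F S + G S) = rmean A F + rmean A G"
  by (simp add: rmean_def sum.distrib add_divide_distrib)

lemma rmean_cmult: "rmean A (\<lambda>S. c * F S) = c * rmean A F"
  by (simp add: rmean_def sum_distrib_left)

lemma rmean_divide: "rmean A (\<lambda>S. F S / c) = rmean A F / c"
  by (simp add: rmean_def sum_divide_distrib field_simps)

lemma rmean_sum: "rmean A (\<lambda>S. \<Sum>k\<in>N. F k S) = (\<Sum>k\<in>N. rmean A (F k))"
  unfolding rmean_def sum_divide_distrib[symmetric] by (rule arg_cong2[where f = "(/)"], rule sum.swap) simp

lemma rmean_insert:
  assumes "finite A" "a \<notin> A"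
  shows "rmean (insert a A) F = (rmean A F + rmean A (\<lambda>S. F (insert a S))) / 2"
proof -
  have "(\<Sum>S\<in>Pow (insert a A). F S) = (\<Sum>S\<in>Pow A. F S) + (\<Sum>S\<in>insert a ` Pow A. F S)"
    unfolding Pow_insert using assms by (intro sum.union_disjoint) auto
  also have "(\<Sum>S\<in>insert a ` Pow A. F S) = (\<Sum>S\<in>Pow A. F (insert a S))"
    using assms by (subst sum.reindex) (auto simp: inj_on_def dest!: insert_ident[THEN iffD1, rotated 2])
  finally show ?thesis using assms by (simp add: rmean_def field_simps)
qed

text \<open>The induction step that averages over one sign. The functional acts on a vector-valued
  sum, so that exponentials of linear forms and of squared norms are both instances.\<close>

lemma rmean_insert_sum:
  fixes F :: "('k \<Rightarrow> real) \<Rightarrow> real"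
  assumes "finite A" "a \<notin> A"
  shows "rmean (insert a A) (\<lambda>S. F (\<lambda>k. \<Sum>i\<in>insert a A. rsign S i * v i k)) =
    rmean A (\<lambda>S. (F (\<lambda>k. v a k + (\<Sum>i\<in>A. rsign S i * v i k)) +
      F (\<lambda>k. - v a k + (\<Sum>i\<in>A. rsign S i * v i k))) / 2)"
proof -
  have 1: "(\<Sum>i\<in>insert a A. rsign S i * v i k) = v a k + (\<Sum>i\<in>A. rsign S i * v i k)" if "S \<subseteq> A" for S k
    using assms that by (auto simp: rsign_def)
  have 2: "(\<Sum>i\<in>insert a A. rsign (insert a S) i * v i k) = - v a k + (\<Sum>i\<in>A. rsign S i * v i k)" for S k
  proof -
    have "(\<Sum>i\<in>A. rsign (insert a S) i * v i k) = (\<Sum>i\<in>A. rsign S i * v i k)"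
      using assms by (intro sum.cong) (auto simp: rsign_def)
    then show ?thesis using assms by (simp add: rsign_def)
  qed
  show ?thesis
    unfolding rmean_insert[OF assms] rmean_divide rmean_add 2
    by (rule arg_cong2[where f = "(/)"], rule arg_cong2[where f = "(+)"], rule rmean_cong)
       (simp_all add: 1)
qed

text \<open>On the nonnegative axis \<open>t^2 / 2 - ln (cosh t)\<close> is nondecreasing because
  \<open>sinh t \<le> t * cosh t\<close>, and the latter holds because the difference has derivative
  \<open>s * sinh s\<close>.\<close>

lemma cosh_le_exp_half_square: "(exp y + exp (- y)) / 2 \<le> exp (y\<^sup>2 / 2)" for y :: real
proof -
  have *: "cosh x \<le> exp (x\<^sup>2 / 2)" if "0 \<le> x" for x :: real
  proof -
    define f where "f t = t\<^sup>2 / 2 - ln (cosh t)" for t :: real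
    have "f 0 \<le> f x"
    proof (rule DERIV_nonneg_imp_nondecreasing[OF that])
      fix t :: real assume t: "0 \<le> t" "t \<le> x"
      have "(f has_real_derivative t - sinh t / cosh t) (at t)"
        unfolding f_def by (auto intro!: derivative_eq_intros simp: cosh_real_pos)
      moreover have "sinh t \<le> t * cosh t"
      proof -
        define g where "g s = s * cosh s - sinh s" for s :: real
        have "g 0 \<le> g t"
        proof (rule DERIV_nonneg_imp_nondecreasing[OF t(1)])
          fix s :: real assume s: "0 \<le> s" "s \<le> t"
          have "(g has_real_derivative s * sinh s) (at s)"
            unfolding g_def by (auto intro!: derivative_eq_intros)
          then show "\<exists>y. (g has_real_derivative y) (at s) \<and> 0 \<le> y" using s by auto
        qed
        then show ?thesis by (simp add: g_def)
      qed
      then have "0 \<le> t - sinh t / cosh t" by (simp add: field_simps cosh_real_pos)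
      ultimately show "\<exists>y. (f has_real_derivative y) (at t) \<and> 0 \<le> y" by blast
    qed
    then have "ln (cosh x) \<le> x\<^sup>2 / 2" by (simp add: f_def)
    then have "exp (ln (cosh x)) \<le> exp (x\<^sup>2 / 2)" by (simp only: exp_le_cancel_iff)
    moreover have "exp (ln (cosh x)) = cosh x" by (simp add: cosh_real_pos)
    ultimately show ?thesis by (simp only:)
  qed
  have "cosh y \<le> exp (y\<^sup>2 / 2)"
    using *[of y] *[of "- y"] by (cases "0 \<le> y") auto
  then show ?thesis by (simp add: cosh_def)
qed

lemma rmean_exp_sum_le:
  assumes "finite A"
  shows "rmean A (\<lambda>S. exp (\<Sum>i\<in>A. rsign S i * y i)) \<le> exp ((\<Sum>i\<in>A. (y i)\<^sup>2) / 2)"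
  using assms
proof (induction A)
  case empty then show ?case by (simp add: rmean_def)
next
  case (insert a A)
  have "rmean (insert a A) (\<lambda>S. exp (\<Sum>i\<in>insert a A. rsign S i * y i))
      = rmean A (\<lambda>S. (exp (y a + (\<Sum>i\<in>A. rsign S i * y i)) + exp (- y a + (\<Sum>i\<in>A. rsign S i * y i))) / 2)"
    using rmean_insert_sum[OF insert.hyps, of "\<lambda>f. exp (f ())" "\<lambda>i _. y i"] by simp
  also have "\<dots> = rmean A (\<lambda>S. (exp (y a) + exp (- y a)) / 2 * exp (\<Sum>i\<in>A. rsign S i * y i))"
    by (rule rmean_cong) (simp add: exp_add exp_diff exp_minus field_simps)
  also have "\<dots> = (exp (y a) + exp (- y a)) / 2 * rmean A (\<lambda>S. exp (\<Sum>i\<in>A. rsign S i * y i))"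
    by (rule rmean_cmult)
  also have "\<dots> \<le> exp ((y a)\<^sup>2 / 2) * exp ((\<Sum>i\<in>A. (y i)\<^sup>2) / 2)"
    using cosh_le_exp_half_square[of "y a"] insert.IH
    by (intro mult_mono) (auto simp: rmean_def intro!: divide_nonneg_nonneg sum_nonneg)
  also have "\<dots> = exp ((\<Sum>i\<in>insert a A. (y i)\<^sup>2) / 2)"
    using insert.hyps by (simp add: exp_add[symmetric] add_divide_distrib)
  finally show ?case .
qed

text \<open>
  Averaging over the sign of one vector of squared norm \<open>w\<close> costs a factor \<open>exp (\<kappa> w)\<close> and
  replaces \<open>\<kappa>\<close> by \<open>\<kappa> + 2 \<kappa>\<^sup>2 w\<close>; the bound \<open>1 / (1 - 2 \<kappa> \<sigma>\<^sup>2)\<close> is stable under this step.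
\<close>

lemma rmean_exp_square_le:
  assumes "finite A" "0 \<le> \<kappa>" "2 * \<kappa> * (\<Sum>i\<in>A. \<Sum>k\<in>K. (v i k)\<^sup>2) < 1"
  shows "rmean A (\<lambda>S. exp (\<kappa> * (\<Sum>k\<in>K. (\<Sum>i\<in>A. rsign S i * v i k)\<^sup>2)))
    \<le> 1 / (1 - 2 * \<kappa> * (\<Sum>i\<in>A. \<Sum>k\<in>K. (v i k)\<^sup>2))"
  using assms
proof (induction A arbitrary: \<kappa>)
  case empty then show ?case by (simp add: rmean_def)
next
  case (insert a A)
  define w where "w = (\<Sum>k\<in>K. (v a k)\<^sup>2)"
  define s where "s = (\<Sum>i\<in>A. \<Sum>k\<in>K. (v i k)\<^sup>2)"
  have ws: "(\<Sum>i\<in>insert a A. \<Sum>k\<in>K. (v i k)\<^sup>2) = w + s" using insert.hyps by (simp add: w_def s_def)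
  have w0: "0 \<le> w" and s0: "0 \<le> s" by (auto simp: w_def s_def intro!: sum_nonneg)
  have \<kappa>0: "0 \<le> \<kappa>" and lt: "2 * \<kappa> * (w + s) < 1" using insert.prems ws by auto
  have \<kappa>s: "0 \<le> 2 * \<kappa> * s" "0 \<le> 2 * \<kappa> * w" using s0 w0 \<kappa>0 by auto
  have lt': "2 * \<kappa> * w + 2 * \<kappa> * s < 1" using lt by (simp add: distrib_left)
  define d where "d = 1 - 2 * \<kappa> * w"
  have d: "0 < d" "2 * \<kappa> * s < d" using lt' \<kappa>s by (auto simp: d_def)
  \<comment> \<open>The cross term contributes \<open>exp ((2 * \<kappa> * c)\<^sup>2 / 2)\<close>
    after the sign is averaged, and Cauchy-Schwarz gives \<open>c\<^sup>2 \<le> w * Z\<close>; this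
    is the source of \<open>2 * \<kappa>\<^sup>2 * w\<close>. Moreover
    \<open>\<kappa>' \<le> \<kappa> / d\<close>, so the two factors combine to
    \<open>1 / (d - 2 * \<kappa> * s)\<close>, the asserted bound.\<close>
  define \<kappa>' where "\<kappa>' = \<kappa> + 2 * \<kappa>\<^sup>2 * w"
  have \<kappa>'0: "0 \<le> \<kappa>'" using \<kappa>0 w0 by (simp add: \<kappa>'_def)
  have "\<kappa>' * d = \<kappa> - 4 * \<kappa>\<^sup>2 * \<kappa> * w\<^sup>2"
    by (simp add: \<kappa>'_def d_def power2_eq_square algebra_simps)
  also have "\<dots> \<le> \<kappa>" using \<kappa>0 by simp
  finally have \<kappa>'le: "\<kappa>' \<le> \<kappa> / d" using d by (simp add: field_simps)
  have "2 * \<kappa>' * s \<le> 2 * (\<kappa> / d) * s" using \<kappa>'le s0 by (intro mult_right_mono mult_left_mono) auto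
  then have k's: "2 * \<kappa>' * s \<le> 2 * \<kappa> * s / d" by simp
  have lt2: "2 * \<kappa> * s / d < 1" using d by simp
  have step: "(exp (\<kappa> * (\<Sum>k\<in>K. (v a k + Y k)\<^sup>2)) + exp (\<kappa> * (\<Sum>k\<in>K. (- v a k + Y k)\<^sup>2))) / 2
      \<le> exp (\<kappa> * w) * exp (\<kappa>' * (\<Sum>k\<in>K. (Y k)\<^sup>2))" for Y
  proof -
    define Z where "Z = (\<Sum>k\<in>K. (Y k)\<^sup>2)"
    define c where "c = (\<Sum>k\<in>K. v a k * Y k)"
    have p: "(\<Sum>k\<in>K. (v a k + Y k)\<^sup>2) = w + Z + 2 * c"
      by (simp add: w_def Z_def c_def power2_sum sum.distrib sum_distrib_left mult.assoc)
    have m: "(\<Sum>k\<in>K. (- v a k + Y k)\<^sup>2) = w + Z - 2 * c"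
      by (simp add: w_def Z_def c_def power2_diff sum.distrib sum_subtractf sum_distrib_left mult_ac)
    have c2: "c\<^sup>2 \<le> w * Z" unfolding c_def w_def Z_def by (rule Cauchy_Schwarz_ineq_sum)
    have "(exp (\<kappa> * (w + Z + 2 * c)) + exp (\<kappa> * (w + Z - 2 * c))) / 2
       = exp (\<kappa> * (w + Z)) * ((exp (2 * \<kappa> * c) + exp (- (2 * \<kappa> * c))) / 2)"
      by (simp add: algebra_simps exp_add exp_diff exp_minus field_simps)
    also have "\<dots> \<le> exp (\<kappa> * (w + Z)) * exp ((2 * \<kappa> * c)\<^sup>2 / 2)"
      by (intro mult_left_mono cosh_le_exp_half_square) simp
    also have "\<dots> = exp (\<kappa> * w + (\<kappa> * Z + 2 * \<kappa>\<^sup>2 * c\<^sup>2))"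
      by (simp add: exp_add[symmetric] power_mult_distrib algebra_simps)
    also have "\<dots> \<le> exp (\<kappa> * w + \<kappa>' * Z)"
    proof -
      have "2 * \<kappa>\<^sup>2 * c\<^sup>2 \<le> 2 * \<kappa>\<^sup>2 * (w * Z)" using c2 by (intro mult_left_mono) auto
      then show ?thesis by (simp add: \<kappa>'_def algebra_simps)
    qed
    also have "\<dots> = exp (\<kappa> * w) * exp (\<kappa>' * Z)" by (rule exp_add)
    finally show ?thesis unfolding p m Z_def .
  qed
  have "rmean (insert a A) (\<lambda>S. exp (\<kappa> * (\<Sum>k\<in>K. (\<Sum>i\<in>insert a A. rsign S i * v i k)\<^sup>2)))
      = rmean A (\<lambda>S. (exp (\<kappa> * (\<Sum>k\<in>K. (v a k + (\<Sum>i\<in>A. rsign S i * v i k))\<^sup>2)) +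
          exp (\<kappa> * (\<Sum>k\<in>K. (- v a k + (\<Sum>i\<in>A. rsign S i * v i k))\<^sup>2))) / 2)"
    by (rule rmean_insert_sum[OF insert.hyps, where F = "\<lambda>f. exp (\<kappa> * (\<Sum>k\<in>K. (f k)\<^sup>2))"])
  also have "\<dots> \<le> rmean A (\<lambda>S. exp (\<kappa> * w) * exp (\<kappa>' * (\<Sum>k\<in>K. (\<Sum>i\<in>A. rsign S i * v i k)\<^sup>2)))"
    by (intro rmean_mono step)
  also have "\<dots> = exp (\<kappa> * w) * rmean A (\<lambda>S. exp (\<kappa>' * (\<Sum>k\<in>K. (\<Sum>i\<in>A. rsign S i * v i k)\<^sup>2)))"
    by (rule rmean_cmult)
  also have "\<dots> \<le> (1 / d) * (1 / (1 - 2 * \<kappa> * s / d))"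
  proof (rule mult_mono)
    have "1 - \<kappa> * w \<le> exp (- (\<kappa> * w))" using exp_ge_add_one_self[of "- (\<kappa> * w)"] by simp
    moreover have "0 \<le> \<kappa> * w" using \<kappa>0 w0 by simp
    ultimately have "d \<le> exp (- (\<kappa> * w))" by (simp add: d_def)
    then show "exp (\<kappa> * w) \<le> 1 / d" using d by (simp add: exp_minus field_simps)
    have "rmean A (\<lambda>S. exp (\<kappa>' * (\<Sum>k\<in>K. (\<Sum>i\<in>A. rsign S i * v i k)\<^sup>2))) \<le> 1 / (1 - 2 * \<kappa>' * s)"
      unfolding s_def by (rule insert.IH[OF \<kappa>'0]) (use k's lt2 in \<open>simp add: s_def\<close>)
    also have "\<dots> \<le> 1 / (1 - 2 * \<kappa> * s / d)" using k's lt2 by (intro divide_left_mono) auto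
    finally show "rmean A (\<lambda>S. exp (\<kappa>' * (\<Sum>k\<in>K. (\<Sum>i\<in>A. rsign S i * v i k)\<^sup>2))) \<le> 1 / (1 - 2 * \<kappa> * s / d)" .
  qed (use d in \<open>auto simp: rmean_def intro!: divide_nonneg_nonneg sum_nonneg\<close>)
  also have "\<dots> = 1 / (1 - 2 * \<kappa> * (w + s))"
    using d by (simp add: field_simps d_def)
  finally show ?case unfolding ws .
qed

section \<open>Maximal inequality and chaining for Rademacher chaos\<close>

definition chaos :: "nat set \<Rightarrow> nat set \<Rightarrow> (nat \<Rightarrow> nat \<Rightarrow> real) \<Rightarrow> nat set \<Rightarrow> nat set \<Rightarrow> real" where
  "chaos I J a S' S = (\<Sum>i\<in>I. \<Sum>j\<in>J. rsign S i * rsign S' j * a i j)"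

text \<open>For fixed \<open>S'\<close> the chaos is linear in the row signs, and averaging over
  them leaves the exponential of \<open>l\<^sup>2 / 2\<close> times a squared norm. The bound for
  squares with \<open>\<kappa> = l\<^sup>2 / 2\<close> is then at most
  \<open>1 / (1 - 1 / 2)\<close>.\<close>

lemma rmean_exp_chaos_le:
  assumes IJ: "finite I" "finite J" and s: "l\<^sup>2 * (\<Sum>i\<in>I. \<Sum>j\<in>J. (a i j)\<^sup>2) \<le> 1 / 2"
  shows "rmean J (\<lambda>S'. rmean I (\<lambda>S. exp (l * chaos I J a S' S))) \<le> 2"
proof -
  define \<sigma> where "\<sigma> = (\<Sum>j\<in>J. \<Sum>i\<in>I. (a i j)\<^sup>2)"
  have \<sigma>: "l\<^sup>2 * \<sigma> \<le> 1 / 2" using s unfolding \<sigma>_def by (subst sum.swap)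
  have "rmean J (\<lambda>S'. rmean I (\<lambda>S. exp (l * chaos I J a S' S)))
     \<le> rmean J (\<lambda>S'. exp (l\<^sup>2 / 2 * (\<Sum>i\<in>I. (\<Sum>j\<in>J. rsign S' j * a i j)\<^sup>2)))"
  proof (rule rmean_mono)
    fix S' 
    have "rmean I (\<lambda>S. exp (l * chaos I J a S' S)) = rmean I (\<lambda>S. exp (\<Sum>i\<in>I. rsign S i * (l * (\<Sum>j\<in>J. rsign S' j * a i j))))"
      by (rule rmean_cong) (simp add: chaos_def sum_distrib_left mult_ac)
    also have "\<dots> \<le> exp ((\<Sum>i\<in>I. (l * (\<Sum>j\<in>J. rsign S' j * a i j))\<^sup>2) / 2)"
      by (rule rmean_exp_sum_le[OF IJ(1)])
    also have "\<dots> = exp (l\<^sup>2 / 2 * (\<Sum>i\<in>I. (\<Sum>j\<in>J. rsign S' j * a i j)\<^sup>2))"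
      by (simp only: power_mult_distrib sum_distrib_left[symmetric]) simp
    finally show "rmean I (\<lambda>S. exp (l * chaos I J a S' S))
        \<le> exp (l\<^sup>2 / 2 * (\<Sum>i\<in>I. (\<Sum>j\<in>J. rsign S' j * a i j)\<^sup>2))" .
  qed
  also have "\<dots> \<le> 1 / (1 - 2 * (l\<^sup>2 / 2) * \<sigma>)"
    unfolding \<sigma>_def by (rule rmean_exp_square_le[OF IJ(2)]) (use \<sigma> in \<open>simp_all add: \<sigma>_def\<close>)
  also have "\<dots> \<le> 2" using \<sigma> by (simp add: field_simps)
  finally show ?thesis .
qed

text \<open>The tangent to \<open>exp\<close> at \<open>ln c\<close>. It is linear in
  \<open>exp x\<close>, so it can be averaged directly and yields the logarithmic bound on an
  expected maximum that is usually drawn from Jensen's inequality.\<close>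

lemma le_ln_plus_exp: "0 < c \<Longrightarrow> x \<le> ln c + exp x / c - 1" for x c :: real
  using exp_ge_add_one_self[of "x - ln c"] by (simp add: exp_diff)

lemma rmean_Max_chaos_le:
  assumes IJ: "finite I" "finite J" and N: "finite N" "N \<noteq> {}" and \<sigma>: "0 < \<sigma>"
    and le: "\<And>k. k \<in> N \<Longrightarrow> (\<Sum>i\<in>I. \<Sum>j\<in>J. (a k i j)\<^sup>2) \<le> \<sigma>\<^sup>2"
  shows "rmean J (\<lambda>S'. rmean I (\<lambda>S. MAX k\<in>N. \<bar>chaos I J (a k) S' S\<bar>)) \<le> sqrt 2 * \<sigma> * ln (4 * real (card N))"
proof -
  \<comment> \<open>The largest \<open>l\<close> allowed by \<open>rmean_exp_chaos_le\<close> when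
    the squared norm is at most \<open>\<sigma>\<^sup>2\<close>.\<close>
  define l where "l = 1 / (sqrt 2 * \<sigma>)"
  have l: "0 < l" "l\<^sup>2 * \<sigma>\<^sup>2 = 1 / 2" using \<sigma> by (auto simp: l_def power_mult_distrib power_divide)
  \<comment> \<open>Each \<open>k\<close> contributes two exponentials, one for each sign of the
    chaos, of mean at most 2. With this \<open>c\<close> the averaged exponential term is at most 1
    and cancels the \<open>- 1\<close>.\<close>
  define c where "c = 4 * real (card N)"
  have c: "0 < c" using N by (simp add: c_def card_gt_0_iff)
  have pt: "l * (MAX k\<in>N. \<bar>chaos I J (a k) S' S\<bar>) \<le>
      (\<Sum>k\<in>N. exp (l * chaos I J (a k) S' S) + exp (- l * chaos I J (a k) S' S)) / c + (ln c - 1)" for S S'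
  proof -
    have "(MAX k\<in>N. \<bar>chaos I J (a k) S' S\<bar>) \<in> (\<lambda>k. \<bar>chaos I J (a k) S' S\<bar>) ` N"
      using N by (intro Max_in) auto
    then obtain k where k: "k \<in> N" "(MAX k\<in>N. \<bar>chaos I J (a k) S' S\<bar>) = \<bar>chaos I J (a k) S' S\<bar>" by auto
    let ?x = "chaos I J (a k) S' S"
    have "l * \<bar>?x\<bar> \<le> ln c + exp (l * \<bar>?x\<bar>) / c - 1" by (rule le_ln_plus_exp[OF c])
    also have "exp (l * \<bar>?x\<bar>) \<le> exp (l * ?x) + exp (- l * ?x)" by (cases "0 \<le> ?x") auto
    also have "\<dots> \<le> (\<Sum>k\<in>N. exp (l * chaos I J (a k) S' S) + exp (- l * chaos I J (a k) S' S))"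
      using N k(1) by (intro member_le_sum[where f = "\<lambda>k. exp (l * chaos I J (a k) S' S) + exp (- l * chaos I J (a k) S' S)"]) auto
    finally show ?thesis unfolding k(2) using c by (simp add: divide_right_mono)
  qed
  have "l * rmean J (\<lambda>S'. rmean I (\<lambda>S. MAX k\<in>N. \<bar>chaos I J (a k) S' S\<bar>)) =
     rmean J (\<lambda>S'. rmean I (\<lambda>S. l * (MAX k\<in>N. \<bar>chaos I J (a k) S' S\<bar>)))"
    by (simp add: rmean_cmult)
  also have "\<dots> \<le> rmean J (\<lambda>S'. rmean I (\<lambda>S. (\<Sum>k\<in>N. exp (l * chaos I J (a k) S' S) + exp (- l * chaos I J (a k) S' S)) / c + (ln c - 1)))"
    by (intro rmean_mono pt)
  also have "\<dots> = (\<Sum>k\<in>N. rmean J (\<lambda>S'. rmean I (\<lambda>S. exp (l * chaos I J (a k) S' S))) +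
      rmean J (\<lambda>S'. rmean I (\<lambda>S. exp (- l * chaos I J (a k) S' S)))) / c + (ln c - 1)"
    by (simp add: rmean_add rmean_divide rmean_sum rmean_const IJ del: mult_minus_left)
  also have "\<dots> \<le> (\<Sum>k\<in>N. 2 + 2) / c + (ln c - 1)"
  proof (intro add_right_mono divide_right_mono sum_mono add_mono)
    fix k assume "k \<in> N"
    then have "l\<^sup>2 * (\<Sum>i\<in>I. \<Sum>j\<in>J. (a k i j)\<^sup>2) \<le> l\<^sup>2 * \<sigma>\<^sup>2" using le by (intro mult_left_mono) auto
    then have "l\<^sup>2 * (\<Sum>i\<in>I. \<Sum>j\<in>J. (a k i j)\<^sup>2) \<le> 1 / 2" using l by simp
    then show "rmean J (\<lambda>S'. rmean I (\<lambda>S. exp (l * chaos I J (a k) S' S))) \<le> 2"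
      "rmean J (\<lambda>S'. rmean I (\<lambda>S. exp (- l * chaos I J (a k) S' S))) \<le> 2"
      using rmean_exp_chaos_le[OF IJ, of l "a k"] rmean_exp_chaos_le[OF IJ, of "- l" "a k"] by auto
  qed (use c in auto)
  also have "\<dots> = ln c" using c N by (simp add: c_def field_simps)
  finally have "rmean J (\<lambda>S'. rmean I (\<lambda>S. MAX k\<in>N. \<bar>chaos I J (a k) S' S\<bar>)) \<le> ln c / l"
    using l by (simp add: field_simps)
  also have "ln c / l = sqrt 2 * \<sigma> * ln (4 * real (card N))" by (simp add: l_def c_def)
  finally show ?thesis .
qed

lemma chaos_diff: "chaos I J a S' S - chaos I J b S' S = chaos I J (\<lambda>i j. a i j - b i j) S' S"
  by (simp add: chaos_def sum_subtractf right_diff_distrib)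

lemma abs_chaos_le:
  assumes "finite I" "finite J"
  shows "\<bar>chaos I J a S' S\<bar> \<le> sqrt (real (card I * card J)) * sqrt (\<Sum>i\<in>I. \<Sum>j\<in>J. (a i j)\<^sup>2)"
proof -
  have "\<bar>chaos I J a S' S\<bar> \<le> (\<Sum>i\<in>I. \<Sum>j\<in>J. \<bar>a i j\<bar>)"
    unfolding chaos_def
    by (intro order_trans[OF sum_abs] sum_mono) (simp add: abs_mult rsign_def)
  also have "\<dots> = (\<Sum>x\<in>I \<times> J. \<bar>1\<bar> * \<bar>case x of (i, j) \<Rightarrow> a i j\<bar>)"
    by (simp add: sum.cartesian_product case_prod_beta')
  also have "\<dots> \<le> L2_set (\<lambda>_. 1) (I \<times> J) * L2_set (\<lambda>x. case x of (i, j) \<Rightarrow> a i j) (I \<times> J)"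
    by (rule L2_set_mult_ineq)
  also have "\<dots> = sqrt (real (card I * card J)) * sqrt (\<Sum>i\<in>I. \<Sum>j\<in>J. (a i j)\<^sup>2)"
    by (simp add: L2_set_def sum.cartesian_product case_prod_beta' card_cartesian_product)
  finally show ?thesis .
qed

lemma sum_dyadic_le: "(\<Sum>k<K. (real k + 2) / 2 ^ k) \<le> 6"
proof -
  have "(\<Sum>k<K. (real k + 2) / 2 ^ k) = 6 - (2 * real K + 6) / 2 ^ K"
  proof (induction K)
    case (Suc K)
    have "6 - (2 * real K + 6) / 2 ^ K + (real K + 2) / 2 ^ K = 6 - (2 * real (Suc K) + 6) / 2 ^ Suc K"
      by (simp add: field_simps)
    then show ?case using Suc by simp
  qed simp
  then show ?thesis by simp
qed

lemma Max_le_add_Max: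
  fixes f :: "'a \<Rightarrow> real"
  assumes "finite A" "A \<noteq> {}" "finite B" "\<And>a. a \<in> A \<Longrightarrow> p a \<in> B"
  shows "(MAX a\<in>A. \<bar>f a\<bar>) \<le> (MAX b\<in>B. \<bar>f b\<bar>) + (MAX a\<in>A. \<bar>f a - f (p a)\<bar>)"
proof (rule Max.boundedI)
  fix x assume "x \<in> (\<lambda>a. \<bar>f a\<bar>) ` A"
  then obtain a where a: "a \<in> A" "x = \<bar>f a\<bar>" by auto
  have "\<bar>f (p a)\<bar> \<le> (MAX b\<in>B. \<bar>f b\<bar>)" using assms a by (intro Max_ge) auto
  moreover have "\<bar>f a - f (p a)\<bar> \<le> (MAX a\<in>A. \<bar>f a - f (p a)\<bar>)" using assms a by (intro Max_ge) auto
  ultimately show "x \<le> (MAX b\<in>B. \<bar>f b\<bar>) + (MAX a\<in>A. \<bar>f a - f (p a)\<bar>)"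
    unfolding a(2) by linarith
qed (use assms in auto)

text \<open>Links lead from points of \<open>N (Suc K)\<close>, rather than from arbitrary
  parameters, to \<open>N K\<close>. Hence only \<open>card (N (Suc K))\<close> differences occur at
  each step, each of norm at most \<open>\<rho> / 2 ^ K\<close>, and the logarithms grow linearly,
  which gives a convergent series bounded by 6. The starting net costs
  \<open>\<sigma>\<close>.\<close>

lemma rmean_SUP_chaos_le:
  fixes h :: "'t \<Rightarrow> nat \<Rightarrow> nat \<Rightarrow> real"
  assumes IJ: "finite I" "finite J" and T: "T \<noteq> {}"
    and N: "\<And>k. finite (N k)" "\<And>k. N k \<noteq> {}" "\<And>k. N k \<subseteq> T"
    and cov: "\<And>k \<theta>. \<theta> \<in> T \<Longrightarrow> \<exists>s\<in>N k. (\<Sum>i\<in>I. \<Sum>j\<in>J. (h \<theta> i j - h s i j)\<^sup>2) \<le> (\<rho> / 2 ^ k)\<^sup>2"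
    and card: "\<And>k. ln (4 * real (card (N k))) \<le> L * (real k + 1)"
    and \<sigma>: "0 < \<sigma>" "\<And>\<theta>. \<theta> \<in> T \<Longrightarrow> (\<Sum>i\<in>I. \<Sum>j\<in>J. (h \<theta> i j)\<^sup>2) \<le> \<sigma>\<^sup>2" and \<rho>: "0 < \<rho>"
  shows "rmean J (\<lambda>S'. rmean I (\<lambda>S. SUP \<theta>\<in>T. \<bar>chaos I J (h \<theta>) S' S\<bar>)) \<le> sqrt 2 * L * (\<sigma> + 6 * \<rho>)"
proof -
  have "\<forall>k. \<exists>p. \<forall>\<theta>\<in>T. p \<theta> \<in> N k \<and> (\<Sum>i\<in>I. \<Sum>j\<in>J. (h \<theta> i j - h (p \<theta>) i j)\<^sup>2) \<le> (\<rho> / 2 ^ k)\<^sup>2"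
    using cov by (intro allI bchoice) blast
  from choice[OF this] obtain p where
    p: "\<And>k \<theta>. \<theta> \<in> T \<Longrightarrow> p k \<theta> \<in> N k"
       "\<And>k \<theta>. \<theta> \<in> T \<Longrightarrow> (\<Sum>i\<in>I. \<Sum>j\<in>J. (h \<theta> i j - h (p k \<theta>) i j)\<^sup>2) \<le> (\<rho> / 2 ^ k)\<^sup>2" by blast
  define X where "X \<theta> S' S = chaos I J (h \<theta>) S' S" for \<theta> S' S
  have L: "0 \<le> L"
  proof -
    have "card (N 0) \<noteq> 0" using N[of 0] by simp
    then have "1 \<le> card (N 0)" by linarith
    then have "0 \<le> ln (4 * real (card (N 0)))" by (intro ln_ge_zero) linarith
    then show ?thesis using card[of 0] by simp
  qed
  have chain: "rmean J (\<lambda>S'. rmean I (\<lambda>S. MAX \<theta>\<in>N K. \<bar>X \<theta> S' S\<bar>))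
      \<le> sqrt 2 * L * (\<sigma> + \<rho> * (\<Sum>k<K. (real k + 2) / 2 ^ k))" for K
  proof (induction K)
    case 0
    have "rmean J (\<lambda>S'. rmean I (\<lambda>S. MAX \<theta>\<in>N 0. \<bar>X \<theta> S' S\<bar>)) \<le> sqrt 2 * \<sigma> * ln (4 * real (card (N 0)))"
      unfolding X_def by (rule rmean_Max_chaos_le[OF IJ N(1,2) \<sigma>(1)]) (use N \<sigma> in blast)
    also have "\<dots> \<le> sqrt 2 * \<sigma> * L" using card[of 0] \<sigma>(1) by (intro mult_left_mono) auto
    finally show ?case by (simp add: mult_ac)
  next
    case (Suc K)
    have "rmean J (\<lambda>S'. rmean I (\<lambda>S. MAX \<theta>\<in>N (Suc K). \<bar>X \<theta> S' S\<bar>))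
       \<le> rmean J (\<lambda>S'. rmean I (\<lambda>S. (MAX \<theta>\<in>N K. \<bar>X \<theta> S' S\<bar>) + (MAX \<theta>\<in>N (Suc K). \<bar>X \<theta> S' S - X (p K \<theta>) S' S\<bar>)))"
      using N p(1) by (intro rmean_mono Max_le_add_Max) blast+
    also have "\<dots> = rmean J (\<lambda>S'. rmean I (\<lambda>S. MAX \<theta>\<in>N K. \<bar>X \<theta> S' S\<bar>)) +
        rmean J (\<lambda>S'. rmean I (\<lambda>S. MAX \<theta>\<in>N (Suc K). \<bar>X \<theta> S' S - X (p K \<theta>) S' S\<bar>))"
      by (simp add: rmean_add)
    also have "rmean J (\<lambda>S'. rmean I (\<lambda>S. MAX \<theta>\<in>N (Suc K). \<bar>X \<theta> S' S - X (p K \<theta>) S' S\<bar>))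
        \<le> sqrt 2 * (\<rho> / 2 ^ K) * ln (4 * real (card (N (Suc K))))"
      unfolding X_def chaos_diff
      by (rule rmean_Max_chaos_le[OF IJ N(1,2)]) (use \<rho> p(2) N(3) in auto)
    also have "\<dots> \<le> sqrt 2 * (\<rho> / 2 ^ K) * (L * (real K + 2))"
      using card[of "Suc K"] \<rho> by (intro mult_left_mono) (auto simp: add_ac)
    finally show ?case using Suc by (simp add: algebra_simps)
  qed
  \<comment> \<open>Below the last net the crude Cauchy-Schwarz bound is enough: its factor depends
    on the sample size but not on \<open>K\<close>, so the remainder vanishes as \<open>K\<close>
    grows.\<close>
  have tail: "(SUP \<theta>\<in>T. \<bar>X \<theta> S' S\<bar>) \<le> (MAX \<theta>\<in>N K. \<bar>X \<theta> S' S\<bar>) + sqrt (real (card I * card J)) * (\<rho> / 2 ^ K)" for S' S K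
  proof (rule cSUP_least[OF T])
    fix \<theta> assume \<theta>: "\<theta> \<in> T"
    have "\<bar>X \<theta> S' S - X (p K \<theta>) S' S\<bar> \<le> sqrt (real (card I * card J)) * sqrt (\<Sum>i\<in>I. \<Sum>j\<in>J. (h \<theta> i j - h (p K \<theta>) i j)\<^sup>2)"
      unfolding X_def chaos_diff by (rule abs_chaos_le[OF IJ])
    also have "\<dots> \<le> sqrt (real (card I * card J)) * (\<rho> / 2 ^ K)"
      using p(2)[OF \<theta>, of K] \<rho> by (intro mult_left_mono real_le_lsqrt sum_nonneg) auto
    finally have 1: "\<bar>X \<theta> S' S - X (p K \<theta>) S' S\<bar> \<le> sqrt (real (card I * card J)) * (\<rho> / 2 ^ K)" .
    have "\<bar>X (p K \<theta>) S' S\<bar> \<le> (MAX \<theta>\<in>N K. \<bar>X \<theta> S' S\<bar>)"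
      using p(1)[OF \<theta>] N(1) by (intro Max_ge) auto
    then show "\<bar>X \<theta> S' S\<bar> \<le> (MAX \<theta>\<in>N K. \<bar>X \<theta> S' S\<bar>) + sqrt (real (card I * card J)) * (\<rho> / 2 ^ K)"
      using 1 by linarith
  qed
  define c where "c = sqrt (real (card I * card J)) * \<rho>"
  have bound: "rmean J (\<lambda>S'. rmean I (\<lambda>S. SUP \<theta>\<in>T. \<bar>X \<theta> S' S\<bar>)) \<le> sqrt 2 * L * (\<sigma> + 6 * \<rho>) + c * (1 / 2) ^ K" for K
  proof -
    have "rmean J (\<lambda>S'. rmean I (\<lambda>S. SUP \<theta>\<in>T. \<bar>X \<theta> S' S\<bar>))
      \<le> rmean J (\<lambda>S'. rmean I (\<lambda>S. (MAX \<theta>\<in>N K. \<bar>X \<theta> S' S\<bar>) + sqrt (real (card I * card J)) * (\<rho> / 2 ^ K)))"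
      by (intro rmean_mono tail)
    also have "\<dots> = rmean J (\<lambda>S'. rmean I (\<lambda>S. MAX \<theta>\<in>N K. \<bar>X \<theta> S' S\<bar>)) + c * (1 / 2) ^ K"
      by (simp add: rmean_add rmean_const IJ c_def power_divide)
    also have "\<dots> \<le> sqrt 2 * L * (\<sigma> + \<rho> * (\<Sum>k<K. (real k + 2) / 2 ^ k)) + c * (1 / 2) ^ K"
      using chain[of K] by simp
    also have "\<dots> \<le> sqrt 2 * L * (\<sigma> + 6 * \<rho>) + c * (1 / 2) ^ K"
    proof -
      have "\<rho> * (\<Sum>k<K. (real k + 2) / 2 ^ k) \<le> \<rho> * 6" using sum_dyadic_le \<rho> by (intro mult_left_mono) auto
      then show ?thesis using L by (intro add_right_mono mult_left_mono) auto
    qed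
    finally show ?thesis .
  qed
  have "(\<lambda>K. sqrt 2 * L * (\<sigma> + 6 * \<rho>) + c * (1 / 2) ^ K) \<longlonglongrightarrow> sqrt 2 * L * (\<sigma> + 6 * \<rho>) + c * 0"
    by (intro tendsto_intros LIMSEQ_power_zero) simp
  then have "rmean J (\<lambda>S'. rmean I (\<lambda>S. SUP \<theta>\<in>T. \<bar>X \<theta> S' S\<bar>)) \<le> sqrt 2 * L * (\<sigma> + 6 * \<rho>) + c * 0"
    by (rule LIMSEQ_le_const) (use bound in blast)
  then show ?thesis by (simp add: X_def)
qed

text \<open>
  Subtracting the copy twice leaves a negative drift that absorbs the variance.
\<close>

lemma rmean_exp_one_sided_le:
  assumes A: "finite A" and a: "\<And>i. i \<in> A \<Longrightarrow> 0 \<le> a i \<and> a i \<le> M \<and> 0 \<le> a' i \<and> a' i \<le> M"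
    and l: "0 \<le> l" "l * M \<le> 4 / 9"
  shows "rmean A (\<lambda>S. exp (l * (\<Sum>i\<in>A. if i \<in> S then a' i - 2 * a i else a i - 2 * a' i))) \<le> 1"
proof -
  have "rmean A (\<lambda>S. exp (l * (\<Sum>i\<in>A. if i \<in> S then a' i - 2 * a i else a i - 2 * a' i)))
     = rmean A (\<lambda>S. exp (- (\<Sum>i\<in>A. l * (a i + a' i) / 2)) * exp (\<Sum>i\<in>A. rsign S i * (3 / 2 * l * (a i - a' i))))"
  proof (rule rmean_cong)
    fix S
    \<comment> \<open>The split is \<open>a - 2 * a' = - (a + a') / 2 + 3 / 2 * (a - a')\<close>: a
      drift invariant under the exchange and a part whose sign is flipped by it.\<close>
    have "l * (\<Sum>i\<in>A. if i \<in> S then a' i - 2 * a i else a i - 2 * a' i)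
      = (\<Sum>i\<in>A. - (l * (a i + a' i) / 2) + rsign S i * (3 / 2 * l * (a i - a' i)))"
      unfolding sum_distrib_left by (rule sum.cong) (auto simp: rsign_def field_simps)
    also have "\<dots> = - (\<Sum>i\<in>A. l * (a i + a' i) / 2) + (\<Sum>i\<in>A. rsign S i * (3 / 2 * l * (a i - a' i)))"
      by (simp only: sum.distrib sum_negf)
    finally show "exp (l * (\<Sum>i\<in>A. if i \<in> S then a' i - 2 * a i else a i - 2 * a' i)) =
       exp (- (\<Sum>i\<in>A. l * (a i + a' i) / 2)) * exp (\<Sum>i\<in>A. rsign S i * (3 / 2 * l * (a i - a' i)))"
      by (simp only: exp_add)
  qed
  also have "\<dots> = exp (- (\<Sum>i\<in>A. l * (a i + a' i) / 2)) * rmean A (\<lambda>S. exp (\<Sum>i\<in>A. rsign S i * (3 / 2 * l * (a i - a' i))))"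
    by (rule rmean_cmult)
  also have "\<dots> \<le> exp (- (\<Sum>i\<in>A. l * (a i + a' i) / 2)) * exp ((\<Sum>i\<in>A. (3 / 2 * l * (a i - a' i))\<^sup>2) / 2)"
    by (intro mult_left_mono rmean_exp_sum_le[OF A]) simp
  also have "\<dots> = exp (\<Sum>i\<in>A. (3 / 2 * l * (a i - a' i))\<^sup>2 / 2 - l * (a i + a' i) / 2)"
    by (simp add: exp_add[symmetric] sum_subtractf sum_divide_distrib)
  also have "\<dots> \<le> exp 0"
  proof -
    \<comment> \<open>The variance term is at most
      \<open>9 / 8 * l * (l * M) * (a i + a' i)\<close>, and the drift is
      \<open>l * (a i + a' i) / 2\<close>; the threshold \<open>4 / 9\<close> is where they
      balance.\<close>
    have "(3 / 2 * l * (a i - a' i))\<^sup>2 / 2 - l * (a i + a' i) / 2 \<le> 0" if "i \<in> A" for i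
    proof -
      have "(a i - a' i)\<^sup>2 = \<bar>a i - a' i\<bar> * \<bar>a i - a' i\<bar>" by (simp add: power2_eq_square)
      also have "\<dots> \<le> M * (a i + a' i)" using a[OF that] by (intro mult_mono) auto
      finally have 1: "(a i - a' i)\<^sup>2 \<le> M * (a i + a' i)" .
      have "(3 / 2 * l * (a i - a' i))\<^sup>2 / 2 = 9 / 8 * l\<^sup>2 * (a i - a' i)\<^sup>2"
        by (simp add: power_mult_distrib power2_eq_square)
      also have "\<dots> \<le> 9 / 8 * l\<^sup>2 * (M * (a i + a' i))" using 1 by (intro mult_left_mono) auto
      also have "\<dots> = 9 / 8 * l * (l * M) * (a i + a' i)" by (simp add: power2_eq_square)
      also have "\<dots> \<le> 9 / 8 * l * (4 / 9) * (a i + a' i)"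
        using l a[OF that] by (intro mult_right_mono mult_left_mono) auto
      finally show ?thesis by simp
    qed
    then show ?thesis unfolding exp_le_cancel_iff by (intro sum_nonpos)
  qed
  finally show ?thesis by simp
qed

lemma rmean_Max_one_sided_le:
  assumes A: "finite A" and N: "finite N" "N \<noteq> {}"
    and a: "\<And>k i. k \<in> N \<Longrightarrow> i \<in> A \<Longrightarrow> 0 \<le> a k i \<and> a k i \<le> M \<and> 0 \<le> a' k i \<and> a' k i \<le> M"
    and M: "0 < M"
  shows "rmean A (\<lambda>S. MAX k\<in>N. \<Sum>i\<in>A. if i \<in> S then a' k i - 2 * a k i else a k i - 2 * a' k i)
     \<le> 9 / 4 * M * ln (real (card N))"
proof -
  \<comment> \<open>The extreme \<open>l\<close> permitted by the one-sided moment bound. Since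
    every moment is at most 1, normalising by \<open>card N\<close> alone is enough, and
    \<open>1 / l\<close> produces the factor \<open>9 / 4 * M\<close>.\<close>
  define l where "l = 4 / (9 * M)"
  have l: "0 < l" "l * M \<le> 4 / 9" using M by (auto simp: l_def)
  define c where "c = real (card N)"
  have c: "0 < c" using N by (simp add: c_def card_gt_0_iff)
  define Y where "Y k S = (\<Sum>i\<in>A. if i \<in> S then a' k i - 2 * a k i else a k i - 2 * a' k i)" for k S
  have pt: "l * (MAX k\<in>N. Y k S) \<le> (\<Sum>k\<in>N. exp (l * Y k S)) / c + (ln c - 1)" for S
  proof -
    have "(MAX k\<in>N. Y k S) \<in> (\<lambda>k. Y k S) ` N" using N by (intro Max_in) auto
    then obtain k where k: "k \<in> N" "(MAX k\<in>N. Y k S) = Y k S" by auto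
    have "l * Y k S \<le> ln c + exp (l * Y k S) / c - 1" by (rule le_ln_plus_exp[OF c])
    also have "exp (l * Y k S) \<le> (\<Sum>k\<in>N. exp (l * Y k S))"
      using N k(1) by (intro member_le_sum[where f = "\<lambda>k. exp (l * Y k S)"]) auto
    finally show ?thesis unfolding k(2) using c by (simp add: divide_right_mono)
  qed
  have "l * rmean A (\<lambda>S. MAX k\<in>N. Y k S) = rmean A (\<lambda>S. l * (MAX k\<in>N. Y k S))" by (simp add: rmean_cmult)
  also have "\<dots> \<le> rmean A (\<lambda>S. (\<Sum>k\<in>N. exp (l * Y k S)) / c + (ln c - 1))" by (intro rmean_mono pt)
  also have "\<dots> = (\<Sum>k\<in>N. rmean A (\<lambda>S. exp (l * Y k S))) / c + (ln c - 1)"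
    by (simp add: rmean_add rmean_divide rmean_sum rmean_const A)
  also have "\<dots> \<le> (\<Sum>k\<in>N. 1) / c + (ln c - 1)"
    unfolding Y_def using a A l c
    by (intro add_right_mono divide_right_mono sum_mono rmean_exp_one_sided_le[where M = M]) auto
  also have "\<dots> = ln c" using c by (simp add: c_def)
  finally show ?thesis using l M unfolding Y_def c_def l_def by (simp add: field_simps)
qed

section \<open>Upper expectations of i.i.d. sequences\<close>

text \<open>
  An upper expectation is used because suprema over an uncountable parameter set are only measurable
  for the completed measure.
\<close>

definition outer_le :: "'a measure \<Rightarrow> ('a \<Rightarrow> real) \<Rightarrow> real \<Rightarrow> bool" where
  "outer_le M X c \<longleftrightarrow> (\<exists>g\<in>borel_measurable M. \<exists>K.
     (\<forall>\<omega>\<in>space M. \<bar>g \<omega>\<bar> \<le> K \<and> X \<omega> \<le> g \<omega>) \<and> (\<integral>\<omega>. g \<omega> \<partial>M) \<le> c)"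

lemma outer_leI:
  assumes "g \<in> borel_measurable M" "\<And>\<omega>. \<omega> \<in> space M \<Longrightarrow> \<bar>g \<omega>\<bar> \<le> K"
    "\<And>\<omega>. \<omega> \<in> space M \<Longrightarrow> X \<omega> \<le> g \<omega>" "(\<integral>\<omega>. g \<omega> \<partial>M) \<le> c"
  shows "outer_le M X c"
  unfolding outer_le_def using assms by blast

lemma outer_leE:
  assumes "outer_le M X c"
  obtains g K where "g \<in> borel_measurable M" "\<And>\<omega>. \<omega> \<in> space M \<Longrightarrow> \<bar>g \<omega>\<bar> \<le> K"
    "\<And>\<omega>. \<omega> \<in> space M \<Longrightarrow> X \<omega> \<le> g \<omega>" "(\<integral>\<omega>. g \<omega> \<partial>M) \<le> c"
  using assms unfolding outer_le_def by blast

lemma outer_le_mono: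
  assumes "outer_le M Y c" "\<And>\<omega>. \<omega> \<in> space M \<Longrightarrow> X \<omega> \<le> Y \<omega>" "c \<le> d"
  shows "outer_le M X d"
proof -
  obtain g K where g: "g \<in> borel_measurable M" "\<And>\<omega>. \<omega> \<in> space M \<Longrightarrow> \<bar>g \<omega>\<bar> \<le> K"
    "\<And>\<omega>. \<omega> \<in> space M \<Longrightarrow> Y \<omega> \<le> g \<omega>" "(\<integral>\<omega>. g \<omega> \<partial>M) \<le> c"
    using assms(1) by (rule outer_leE) blast
  show ?thesis
    by (rule outer_leI[OF g(1,2)]) (use g(3,4) assms(2,3) in \<open>auto intro: order_trans\<close>)
qed

context prob_space
begin

lemma integrable_bounded:
  fixes g :: "'a \<Rightarrow> real"
  assumes "g \<in> borel_measurable M" "\<And>\<omega>. \<omega> \<in> space M \<Longrightarrow> \<bar>g \<omega>\<bar> \<le> K"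
  shows "integrable M g"
  by (rule integrable_const_bound[where B = K]) (use assms in auto)

lemma outer_le_const: "outer_le M (\<lambda>_. c) c"
  by (rule outer_leI[where g = "\<lambda>_. c" and K = "\<bar>c\<bar>"]) (auto simp: prob_space)

lemma outer_le_add:
  assumes "outer_le M X c" "outer_le M Y d"
  shows "outer_le M (\<lambda>\<omega>. X \<omega> + Y \<omega>) (c + d)"
proof -
  obtain g K where g: "g \<in> borel_measurable M" "\<And>\<omega>. \<omega> \<in> space M \<Longrightarrow> \<bar>g \<omega>\<bar> \<le> K"
    "\<And>\<omega>. \<omega> \<in> space M \<Longrightarrow> X \<omega> \<le> g \<omega>" "(\<integral>\<omega>. g \<omega> \<partial>M) \<le> c"
    using assms(1) by (rule outer_leE) blast
  obtain h L where h: "h \<in> borel_measurable M" "\<And>\<omega>. \<omega> \<in> space M \<Longrightarrow> \<bar>h \<omega>\<bar> \<le> L"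
    "\<And>\<omega>. \<omega> \<in> space M \<Longrightarrow> Y \<omega> \<le> h \<omega>" "(\<integral>\<omega>. h \<omega> \<partial>M) \<le> d"
    using assms(2) by (rule outer_leE) blast
  show ?thesis
  proof (rule outer_leI[where g = "\<lambda>\<omega>. g \<omega> + h \<omega>" and K = "K + L"])
    show "\<bar>g \<omega> + h \<omega>\<bar> \<le> K + L" "X \<omega> + Y \<omega> \<le> g \<omega> + h \<omega>" if "\<omega> \<in> space M" for \<omega>
      using g(2,3)[OF that] h(2,3)[OF that] by auto
    show "(\<integral>\<omega>. g \<omega> + h \<omega> \<partial>M) \<le> c + d"
      using g(4) h(4) integrable_bounded[OF g(1,2)] integrable_bounded[OF h(1,2)] by simp
  qed (use g h in auto)
qed

lemma outer_le_cmult: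
  assumes "outer_le M X c" "0 \<le> a"
  shows "outer_le M (\<lambda>\<omega>. a * X \<omega>) (a * c)"
proof -
  obtain g K where g: "g \<in> borel_measurable M" "\<And>\<omega>. \<omega> \<in> space M \<Longrightarrow> \<bar>g \<omega>\<bar> \<le> K"
    "\<And>\<omega>. \<omega> \<in> space M \<Longrightarrow> X \<omega> \<le> g \<omega>" "(\<integral>\<omega>. g \<omega> \<partial>M) \<le> c"
    using assms(1) by (rule outer_leE) blast
  show ?thesis
    by (rule outer_leI[where g = "\<lambda>\<omega>. a * g \<omega>" and K = "a * K"])
      (use g assms(2) in \<open>auto simp: abs_mult intro: mult_left_mono\<close>)
qed

lemma outer_le_sum:
  assumes "finite A" "\<And>a. a \<in> A \<Longrightarrow> outer_le M (X a) (c a)"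
  shows "outer_le M (\<lambda>\<omega>. \<Sum>a\<in>A. X a \<omega>) (\<Sum>a\<in>A. c a)"
  using assms
proof (induction A)
  case empty show ?case using outer_le_const[of 0] by simp
next
  case (insert a A)
  then show ?case using outer_le_add[of "X a" "c a"] by simp
qed

text \<open>Turns an upper expectation back into an ordinary integral once the supremum is known to
  be measurable for the completion.\<close>

lemma integral_completion_le_outer:
  assumes X: "X \<in> borel_measurable (completion M)" "\<And>\<omega>. \<omega> \<in> space M \<Longrightarrow> \<bar>X \<omega>\<bar> \<le> L"
    and "outer_le M X c"
  shows "integrable (completion M) X \<and> (\<integral>\<omega>. X \<omega> \<partial>completion M) \<le> c"
proof -
  interpret C: prob_space "completion M" by (rule prob_space_completion)
  obtain g K where g: "g \<in> borel_measurable M" "\<And>\<omega>. \<omega> \<in> space M \<Longrightarrow> \<bar>g \<omega>\<bar> \<le> K"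
    "\<And>\<omega>. \<omega> \<in> space M \<Longrightarrow> X \<omega> \<le> g \<omega>" "(\<integral>\<omega>. g \<omega> \<partial>M) \<le> c"
    using assms(3) by (rule outer_leE) blast
  have iX: "integrable (completion M) X" by (rule C.integrable_bounded[OF X(1)]) (use X in auto)
  have "integrable (completion M) g"
    using integrable_bounded[OF g(1,2)] g(1) by (simp add: integrable_completion)
  then have "(\<integral>\<omega>. X \<omega> \<partial>completion M) \<le> (\<integral>\<omega>. g \<omega> \<partial>completion M)"
    using iX g(3) by (intro integral_mono) auto
  also have "\<dots> \<le> c" using g by (simp add: integral_completion)
  finally show ?thesis using iX by simp
qed

end

section \<open>Infinite sequences of independent observations\<close>

text \<open>Sequences indexed by all natural numbers let every injection act as a law-preserving
  relabelling, and let a block of fresh copies be the next coordinates.\<close>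

locale iid_sequence =
  fixes P :: "'z measure"
  assumes prob_space_P: "prob_space P"
begin

abbreviation PP :: "(nat \<Rightarrow> 'z) measure" where "PP \<equiv> Pi\<^sub>M UNIV (\<lambda>_. P)"

sublocale P: prob_space P by (rule prob_space_P)

sublocale seq: sequence_space P
  by (intro sequence_space.intro product_prob_space.intro product_sigma_finite.intro
      product_prob_space_axioms.intro) (auto intro: P.sigma_finite_measure_axioms P.prob_space_axioms)

lemma space_PP: "\<omega> \<in> space PP \<longleftrightarrow> (\<forall>i. \<omega> i \<in> space P)"
  by (simp add: space_PiM PiE_iff)

lemma measurable_reindex: "(\<lambda>\<omega> n. \<omega> (\<pi> n)) \<in> measurable PP PP"
  by (rule measurable_PiM_single') (auto simp: space_PP[unfolded space_PiM] space_PiM)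

lemma distr_reindex:
  assumes "inj \<pi>"
  shows "distr PP PP (\<lambda>\<omega> n. \<omega> (\<pi> n)) = PP"
  using distr_PiM_reindex[of UNIV "\<lambda>_. P" \<pi> UNIV] assms prob_space_P by (simp add: restrict_def)

lemma integral_reindex:
  fixes g :: "(nat \<Rightarrow> 'z) \<Rightarrow> real"
  assumes "inj \<pi>" "g \<in> borel_measurable PP"
  shows "(\<integral>\<omega>. g (\<lambda>n. \<omega> (\<pi> n)) \<partial>PP) = (\<integral>\<omega>. g \<omega> \<partial>PP)"
  using integral_distr[OF measurable_reindex assms(2), of \<pi>] distr_reindex[OF assms(1)] by simp

lemma outer_le_reindex:
  assumes "inj \<pi>" "outer_le PP X c"
  shows "outer_le PP (\<lambda>\<omega>. X (\<lambda>n. \<omega> (\<pi> n))) c"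
proof -
  obtain g K where g: "g \<in> borel_measurable PP" "\<And>\<omega>. \<omega> \<in> space PP \<Longrightarrow> \<bar>g \<omega>\<bar> \<le> K"
    "\<And>\<omega>. \<omega> \<in> space PP \<Longrightarrow> X \<omega> \<le> g \<omega>" "(\<integral>\<omega>. g \<omega> \<partial>PP) \<le> c"
    using assms(2) by (rule outer_leE) blast
  show ?thesis
  proof (rule outer_leI[where g = "\<lambda>\<omega>. g (\<lambda>n. \<omega> (\<pi> n))" and K = K])
    show "(\<lambda>\<omega>. g (\<lambda>n. \<omega> (\<pi> n))) \<in> borel_measurable PP"
      by (rule measurable_compose[OF measurable_reindex g(1)])
    show "(\<integral>\<omega>. g (\<lambda>n. \<omega> (\<pi> n)) \<partial>PP) \<le> c"
      using g(4) integral_reindex[OF assms(1) g(1)] by simp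
  qed (use g in \<open>auto simp: space_PP\<close>)
qed

lemma measurable_comb_section:
  "\<omega> \<in> space PP \<Longrightarrow> (\<lambda>\<omega>'. comb_seq d \<omega> \<omega>') \<in> measurable PP PP"
  by (rule measurable_comb_seq') auto

lemma comb_seq_space: "\<omega> \<in> space PP \<Longrightarrow> \<omega>' \<in> space PP \<Longrightarrow> comb_seq d \<omega> \<omega>' \<in> space PP"
  by (auto simp: space_PP comb_seq_def)

text \<open>\<open>comb_seq d \<omega> \<omega>'\<close> keeps the first \<open>d\<close>
  coordinates of \<open>\<omega>\<close> and continues with \<open>\<omega>'\<close> from its
  beginning. Integrating over \<open>\<omega>'\<close> is thus conditional expectation given the
  first \<open>d\<close> observations.\<close>

lemma integral_comb_seq:
  fixes g :: "(nat \<Rightarrow> 'z) \<Rightarrow> real"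
  assumes g: "g \<in> borel_measurable PP" "\<And>\<omega>. \<omega> \<in> space PP \<Longrightarrow> \<bar>g \<omega>\<bar> \<le> K"
  shows "(\<lambda>\<omega>. \<integral>\<omega>'. g (comb_seq d \<omega> \<omega>') \<partial>PP) \<in> borel_measurable PP"
    and "(\<integral>\<omega>. \<integral>\<omega>'. g (comb_seq d \<omega> \<omega>') \<partial>PP \<partial>PP) = (\<integral>\<omega>. g \<omega> \<partial>PP)"
proof -
  interpret pair: pair_prob_space PP PP ..
  have m: "(\<lambda>(\<omega>, \<omega>'). g (comb_seq d \<omega> \<omega>')) \<in> borel_measurable (PP \<Otimes>\<^sub>M PP)"
    using measurable_compose[OF measurable_comb_seq g(1), of d] by (simp add: case_prod_beta')
  then show "(\<lambda>\<omega>. \<integral>\<omega>'. g (comb_seq d \<omega> \<omega>') \<partial>PP) \<in> borel_measurable PP"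
    by (intro seq.P.borel_measurable_lebesgue_integral) simp
  have int: "integrable (PP \<Otimes>\<^sub>M PP) (\<lambda>(\<omega>, \<omega>'). g (comb_seq d \<omega> \<omega>'))"
    by (rule pair.P.integrable_bounded[OF m, of K])
      (use g(2) comb_seq_space in \<open>auto simp: space_pair_measure\<close>)
  have "(\<integral>\<omega>. g \<omega> \<partial>PP) = (\<integral>\<omega>. g \<omega> \<partial>distr (PP \<Otimes>\<^sub>M PP) PP (\<lambda>(\<omega>, \<omega>'). comb_seq d \<omega> \<omega>'))"
    by (simp add: seq.PiM_comb_seq)
  also have "\<dots> = (\<integral>x. g ((\<lambda>(\<omega>, \<omega>'). comb_seq d \<omega> \<omega>') x) \<partial>(PP \<Otimes>\<^sub>M PP))"
    by (rule integral_distr[OF measurable_comb_seq g(1)])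
  also have "\<dots> = (\<integral>x. (\<lambda>(\<omega>, \<omega>'). g (comb_seq d \<omega> \<omega>')) x \<partial>(PP \<Otimes>\<^sub>M PP))"
    by (intro Bochner_Integration.integral_cong) (auto simp: case_prod_beta')
  also have "\<dots> = (\<integral>\<omega>. \<integral>\<omega>'. g (comb_seq d \<omega> \<omega>') \<partial>PP \<partial>PP)"
    using pair.integral_fst'[OF int] by simp
  finally show "(\<integral>\<omega>. \<integral>\<omega>'. g (comb_seq d \<omega> \<omega>') \<partial>PP \<partial>PP) = (\<integral>\<omega>. g \<omega> \<partial>PP)" by simp
qed

lemma abs_integral_le_bound:
  fixes g :: "(nat \<Rightarrow> 'z) \<Rightarrow> real"
  assumes "g \<in> borel_measurable PP" "\<And>\<omega>. \<omega> \<in> space PP \<Longrightarrow> \<bar>g \<omega>\<bar> \<le> K"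
  shows "\<bar>\<integral>\<omega>. g \<omega> \<partial>PP\<bar> \<le> K"
proof -
  have "\<bar>\<integral>\<omega>. g \<omega> \<partial>PP\<bar> \<le> (\<integral>\<omega>. \<bar>g \<omega>\<bar> \<partial>PP)" by (rule integral_abs_bound)
  also have "\<dots> \<le> (\<integral>\<omega>. K \<partial>PP)"
    using seq.P.integrable_bounded[OF assms] assms(2) by (intro integral_mono) auto
  finally show ?thesis by (simp add: seq.P.prob_space)
qed

text \<open>Conditional Jensen for suprema. One majorant serves all \<open>\<theta>\<close>, and its
  conditional expectation given the first \<open>d\<close> coordinates dominates every
  \<open>x \<theta>\<close> without increasing the integral.\<close>

lemma outer_le_ghost:
  assumes Y: "outer_le PP Y c" and T: "T \<noteq> {}"
    and F: "\<And>\<theta>. \<theta> \<in> T \<Longrightarrow> F \<theta> \<in> borel_measurable PP"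
      "\<And>\<theta> \<omega>. \<theta> \<in> T \<Longrightarrow> \<omega> \<in> space PP \<Longrightarrow> \<bar>F \<theta> \<omega>\<bar> \<le> L"
      "\<And>\<theta> \<omega>. \<theta> \<in> T \<Longrightarrow> \<omega> \<in> space PP \<Longrightarrow> F \<theta> \<omega> \<le> Y \<omega>"
    and x: "\<And>\<theta> \<omega>. \<theta> \<in> T \<Longrightarrow> \<omega> \<in> space PP \<Longrightarrow> x \<theta> \<omega> \<le> (\<integral>\<omega>'. F \<theta> (comb_seq d \<omega> \<omega>') \<partial>PP)"
  shows "outer_le PP (\<lambda>\<omega>. SUP \<theta>\<in>T. x \<theta> \<omega>) c"
proof -
  obtain g K where g: "g \<in> borel_measurable PP" "\<And>\<omega>. \<omega> \<in> space PP \<Longrightarrow> \<bar>g \<omega>\<bar> \<le> K"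
    "\<And>\<omega>. \<omega> \<in> space PP \<Longrightarrow> Y \<omega> \<le> g \<omega>" "(\<integral>\<omega>. g \<omega> \<partial>PP) \<le> c"
    using Y by (rule outer_leE) blast
  have gm: "(\<lambda>\<omega>'. g (comb_seq d \<omega> \<omega>')) \<in> borel_measurable PP" if "\<omega> \<in> space PP" for \<omega>
    by (rule measurable_compose[OF measurable_comb_section[OF that] g(1)])
  show ?thesis
  proof (rule outer_leI[where g = "\<lambda>\<omega>. \<integral>\<omega>'. g (comb_seq d \<omega> \<omega>') \<partial>PP" and K = K])
    show "(\<lambda>\<omega>. \<integral>\<omega>'. g (comb_seq d \<omega> \<omega>') \<partial>PP) \<in> borel_measurable PP"
      by (rule integral_comb_seq(1)[OF g(1,2)])
    show "(\<integral>\<omega>. \<integral>\<omega>'. g (comb_seq d \<omega> \<omega>') \<partial>PP \<partial>PP) \<le> c"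
      using integral_comb_seq(2)[OF g(1,2), of d] g(4) by simp
    fix \<omega> assume \<omega>: "\<omega> \<in> space PP"
    show "\<bar>\<integral>\<omega>'. g (comb_seq d \<omega> \<omega>') \<partial>PP\<bar> \<le> K"
      by (rule abs_integral_le_bound[OF gm[OF \<omega>]]) (use g(2) comb_seq_space[OF \<omega>] in auto)
    show "(SUP \<theta>\<in>T. x \<theta> \<omega>) \<le> (\<integral>\<omega>'. g (comb_seq d \<omega> \<omega>') \<partial>PP)"
    proof (rule cSUP_least[OF T])
      fix \<theta> assume \<theta>: "\<theta> \<in> T"
      have Fm: "(\<lambda>\<omega>'. F \<theta> (comb_seq d \<omega> \<omega>')) \<in> borel_measurable PP"
        by (rule measurable_compose[OF measurable_comb_section[OF \<omega>] F(1)[OF \<theta>]])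
      have "x \<theta> \<omega> \<le> (\<integral>\<omega>'. F \<theta> (comb_seq d \<omega> \<omega>') \<partial>PP)" by (rule x[OF \<theta> \<omega>])
      also have "\<dots> \<le> (\<integral>\<omega>'. g (comb_seq d \<omega> \<omega>') \<partial>PP)"
      proof (rule integral_mono)
        show "integrable PP (\<lambda>\<omega>'. F \<theta> (comb_seq d \<omega> \<omega>'))"
          by (rule seq.P.integrable_bounded[OF Fm, of L]) (use F(2)[OF \<theta>] comb_seq_space[OF \<omega>] in auto)
        show "integrable PP (\<lambda>\<omega>'. g (comb_seq d \<omega> \<omega>'))"
          by (rule seq.P.integrable_bounded[OF gm[OF \<omega>], of K]) (use g(2) comb_seq_space[OF \<omega>] in auto)
        show "F \<theta> (comb_seq d \<omega> \<omega>') \<le> g (comb_seq d \<omega> \<omega>')" if "\<omega>' \<in> space PP" for \<omega>'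
          using F(3)[OF \<theta> comb_seq_space[OF \<omega> that]] g(3)[OF comb_seq_space[OF \<omega> that]] by (rule order_trans)
      qed
      finally show "x \<theta> \<omega> \<le> (\<integral>\<omega>'. g (comb_seq d \<omega> \<omega>') \<partial>PP)" .
    qed
  qed
qed

text \<open>
  Measurability of \<open>X\<close> for the completed measure is essential here: upper expectations are only
  subadditive.
\<close>

lemma outer_le_symmetrize:
  fixes X :: "(nat \<Rightarrow> 'z) \<Rightarrow> real"
  assumes X: "X \<in> borel_measurable (completion PP)" "\<And>\<omega>. \<omega> \<in> space PP \<Longrightarrow> \<bar>X \<omega>\<bar> \<le> L"
    and A: "finite A" "A \<noteq> {}" and inj: "\<And>a. a \<in> A \<Longrightarrow> inj (\<pi> a)"
    and avg: "outer_le PP (\<lambda>\<omega>. (\<Sum>a\<in>A. X (\<lambda>n. \<omega> (\<pi> a n))) / real (card A)) c"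
  shows "outer_le PP X c"
proof -
  obtain g K where g: "g \<in> borel_measurable PP" "\<And>\<omega>. \<omega> \<in> space PP \<Longrightarrow> \<bar>g \<omega>\<bar> \<le> K"
    "\<And>\<omega>. \<omega> \<in> space PP \<Longrightarrow> (\<Sum>a\<in>A. X (\<lambda>n. \<omega> (\<pi> a n))) / real (card A) \<le> g \<omega>" "(\<integral>\<omega>. g \<omega> \<partial>PP) \<le> c"
    using avg by (rule outer_leE) blast
  obtain X' where X': "X' \<in> borel_measurable PP" "AE \<omega> in PP. X \<omega> = X' \<omega>"
    using completion_ex_borel_measurable_real[OF X(1)] by blast
  obtain N where N: "{\<omega> \<in> space PP. X \<omega> \<noteq> X' \<omega>} \<subseteq> N" "N \<in> null_sets PP"
    using AE_E[OF X'(2)] by (metis (mono_tags, lifting) null_setsI)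
  have L: "0 \<le> L"
    using X(2) seq.P.not_empty by (metis abs_ge_zero all_not_in_conv order_trans)
  \<comment> \<open>The Borel version \<open>X'\<close> need not dominate \<open>X\<close> on the
    exceptional null set. Raising it to the bound \<open>L\<close> there gives a Borel majorant
    everywhere that still equals \<open>X\<close> off a null set.\<close>
  define Y where "Y \<omega> = (if \<omega> \<in> N then L else X' \<omega>)" for \<omega>
  have Ym: "Y \<in> borel_measurable PP"
    unfolding Y_def using N(2) X'(1) by (intro measurable_If_set) auto
  have YX: "Y \<omega> = X \<omega>" if "\<omega> \<in> space PP" "\<omega> \<notin> N" for \<omega>
    using that N(1) by (auto simp: Y_def)
  have Yb: "\<bar>Y \<omega>\<bar> \<le> L" if "\<omega> \<in> space PP" for \<omega>
  proof (cases "\<omega> \<in> N")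
    case True then show ?thesis using L by (simp add: Y_def)
  next
    case False then show ?thesis using YX[OF that] X(2)[OF that] by simp
  qed
  have XY: "X \<omega> \<le> Y \<omega>" if "\<omega> \<in> space PP" for \<omega>
  proof (cases "\<omega> \<in> N")
    case True then show ?thesis using X(2)[OF that] by (simp add: Y_def)
  next
    case False then show ?thesis using YX[OF that] by simp
  qed
  \<comment> \<open>Relabelling preserves the law, so the preimage of the null set is null again. As
    \<open>A\<close> is finite, all relabelled values agree simultaneously almost everywhere, and
    the majorant of the average can be compared with the average of \<open>Y\<close>.\<close>
  have AEY: "AE \<omega> in PP. Y (\<lambda>n. \<omega> (\<pi> a n)) = X (\<lambda>n. \<omega> (\<pi> a n))" if "a \<in> A" for a
  proof -
    have "AE \<omega> in PP. \<omega> \<notin> N" using N(2) by (rule AE_not_in)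
    then have "AE \<omega> in distr PP PP (\<lambda>\<omega> n. \<omega> (\<pi> a n)). \<omega> \<notin> N"
      unfolding distr_reindex[OF inj[OF that]] .
    then have "AE \<omega> in PP. (\<lambda>n. \<omega> (\<pi> a n)) \<notin> N"
      by (rule AE_distrD[OF measurable_reindex])
    then show ?thesis
    proof (rule AE_mp, intro AE_I2 impI)
      fix \<omega> assume "\<omega> \<in> space PP" "(\<lambda>n. \<omega> (\<pi> a n)) \<notin> N"
      then show "Y (\<lambda>n. \<omega> (\<pi> a n)) = X (\<lambda>n. \<omega> (\<pi> a n))" by (intro YX) (auto simp: space_PP)
    qed
  qed
  have Yr: "(\<lambda>\<omega>. Y (\<lambda>n. \<omega> (\<pi> a n))) \<in> borel_measurable PP" for a
    by (rule measurable_compose[OF measurable_reindex Ym])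
  have Yi: "integrable PP (\<lambda>\<omega>. Y (\<lambda>n. \<omega> (\<pi> a n)))" for a
    by (rule seq.P.integrable_bounded[OF Yr]) (auto simp: space_PP intro!: Yb)
  have cA: "0 < real (card A)" using A by (simp add: card_gt_0_iff)
  have "(\<integral>\<omega>. Y \<omega> \<partial>PP) = (\<Sum>a\<in>A. \<integral>\<omega>. Y \<omega> \<partial>PP) / real (card A)" using cA by simp
  also have "\<dots> = (\<Sum>a\<in>A. \<integral>\<omega>. Y (\<lambda>n. \<omega> (\<pi> a n)) \<partial>PP) / real (card A)"
    by (intro arg_cong2[where f = "(/)"] sum.cong integral_reindex[symmetric] inj Ym refl)
  also have "\<dots> = (\<integral>\<omega>. (\<Sum>a\<in>A. Y (\<lambda>n. \<omega> (\<pi> a n))) / real (card A) \<partial>PP)"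
    using Yi by simp
  also have "\<dots> \<le> (\<integral>\<omega>. g \<omega> \<partial>PP)"
  proof (rule integral_mono_AE)
    show "integrable PP (\<lambda>\<omega>. (\<Sum>a\<in>A. Y (\<lambda>n. \<omega> (\<pi> a n))) / real (card A))" using Yi by simp
    show "integrable PP g" by (rule seq.P.integrable_bounded[OF g(1,2)])
    have "AE \<omega> in PP. \<forall>a\<in>A. Y (\<lambda>n. \<omega> (\<pi> a n)) = X (\<lambda>n. \<omega> (\<pi> a n))"
      using AEY A(1) by (simp add: AE_finite_all)
    then show "AE \<omega> in PP. (\<Sum>a\<in>A. Y (\<lambda>n. \<omega> (\<pi> a n))) / real (card A) \<le> g \<omega>"
    proof (rule AE_mp, intro AE_I2 impI)
      fix \<omega> assume \<omega>: "\<omega> \<in> space PP" "\<forall>a\<in>A. Y (\<lambda>n. \<omega> (\<pi> a n)) = X (\<lambda>n. \<omega> (\<pi> a n))"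
      then have "(\<Sum>a\<in>A. Y (\<lambda>n. \<omega> (\<pi> a n))) = (\<Sum>a\<in>A. X (\<lambda>n. \<omega> (\<pi> a n)))" by (intro sum.cong) auto
      then show "(\<Sum>a\<in>A. Y (\<lambda>n. \<omega> (\<pi> a n))) / real (card A) \<le> g \<omega>" using g(3)[OF \<omega>(1)] by simp
    qed
  qed
  also have "\<dots> \<le> c" by (rule g(4))
  finally show ?thesis by (intro outer_leI[OF Ym Yb XY])
qed

lemma integral_component:
  fixes g :: "'z \<Rightarrow> real"
  assumes "g \<in> borel_measurable P"
  shows "(\<integral>\<omega>. g (\<omega> i) \<partial>PP) = (\<integral>x. g x \<partial>P)"
  using integral_distr[of "\<lambda>\<omega>. \<omega> i" PP P g] assms distr_PiM_component[of UNIV "\<lambda>_. P" i] prob_space_P by simp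

lemma integral_two_components:
  fixes g :: "'z \<Rightarrow> 'z \<Rightarrow> real"
  assumes g: "(\<lambda>(x, y). g x y) \<in> borel_measurable (P \<Otimes>\<^sub>M P)"
      "\<And>x y. x \<in> space P \<Longrightarrow> y \<in> space P \<Longrightarrow> \<bar>g x y\<bar> \<le> K"
    and ij: "i \<noteq> j"
  shows "(\<integral>\<omega>. g (\<omega> i) (\<omega> j) \<partial>PP) = (\<integral>x. \<integral>y. g x y \<partial>P \<partial>P)"
    and "(\<integral>\<omega>. g (\<omega> i) (\<omega> j) \<partial>PP) = (\<integral>(x, y). g x y \<partial>(P \<Otimes>\<^sub>M P))"
proof -
  interpret pair: pair_prob_space P P ..
  have gx: "(\<lambda>y. g x y) \<in> borel_measurable P" if "x \<in> space P" for x
    using measurable_compose[OF measurable_Pair1'[OF that] g(1)] by simp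
  have gi: "(\<lambda>x. \<integral>y. g x y \<partial>P) \<in> borel_measurable P"
    by (rule P.borel_measurable_lebesgue_integral[OF g(1)])
  define G where "G \<omega> = g (\<omega> 0) (\<omega> 1)" for \<omega> :: "nat \<Rightarrow> 'z"
  have Gm: "G \<in> borel_measurable PP"
    unfolding G_def using measurable_compose[OF _ g(1), of "\<lambda>\<omega>. (\<omega> 0, \<omega> 1)" PP] by simp
  \<comment> \<open>An injection moving coordinates 0 and 1 to \<open>i\<close> and
    \<open>j\<close>; every other index \<open>n\<close> goes to \<open>n + i + j\<close>, which
    exceeds both. It reduces the claim to the first two coordinates.\<close>
  define \<pi> where "\<pi> n = (if n = 0 then i else if n = 1 then j else n + i + j)" for n :: nat
  have "inj \<pi>" using ij by (auto simp: inj_def \<pi>_def split: if_splits)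
  then have "(\<integral>\<omega>. G (\<lambda>n. \<omega> (\<pi> n)) \<partial>PP) = (\<integral>\<omega>. G \<omega> \<partial>PP)" by (rule integral_reindex[OF _ Gm])
  then have "(\<integral>\<omega>. g (\<omega> i) (\<omega> j) \<partial>PP) = (\<integral>\<omega>. G \<omega> \<partial>PP)" by (simp add: G_def \<pi>_def)
  also have "\<dots> = (\<integral>\<omega>. \<integral>\<omega>'. G (comb_seq 1 \<omega> \<omega>') \<partial>PP \<partial>PP)"
    by (rule integral_comb_seq(2)[OF Gm, symmetric, where K = K]) (auto simp: G_def space_PP intro: g(2))
  also have "\<dots> = (\<integral>\<omega>. \<integral>y. g (\<omega> 0) y \<partial>P \<partial>PP)"
  proof (rule Bochner_Integration.integral_cong[OF refl])
    fix \<omega> assume "\<omega> \<in> space PP"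
    then have "\<omega> 0 \<in> space P" by (simp add: space_PP)
    then show "(\<integral>\<omega>'. G (comb_seq 1 \<omega> \<omega>') \<partial>PP) = (\<integral>y. g (\<omega> 0) y \<partial>P)"
      using integral_component[OF gx, of "\<omega> 0" 0] by (simp add: G_def comb_seq_def)
  qed
  also have "\<dots> = (\<integral>x. \<integral>y. g x y \<partial>P \<partial>P)" by (rule integral_component[OF gi])
  finally show 1: "(\<integral>\<omega>. g (\<omega> i) (\<omega> j) \<partial>PP) = (\<integral>x. \<integral>y. g x y \<partial>P \<partial>P)" .
  have "integrable (P \<Otimes>\<^sub>M P) (\<lambda>(x, y). g x y)"
    by (rule pair.P.integrable_bounded[OF g(1), of K]) (use g(2) in \<open>auto simp: space_pair_measure\<close>)
  then show "(\<integral>\<omega>. g (\<omega> i) (\<omega> j) \<partial>PP) = (\<integral>(x, y). g x y \<partial>(P \<Otimes>\<^sub>M P))"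
    unfolding 1 using pair.integral_fst'[of "\<lambda>(x, y). g x y"] by simp
qed

end

section \<open>Degenerate processes indexed by a VC class\<close>

text \<open>Exchanges the selected observations with their copies \<open>d\<close> places further
  on; for \<open>A \<subseteq> {..<d}\<close> this is an involution.\<close>

definition swap_above :: "nat \<Rightarrow> nat set \<Rightarrow> nat \<Rightarrow> nat" where
  "swap_above d A k = (if k \<in> A then k + d else if d \<le> k \<and> k - d \<in> A then k - d else k)"

lemma inj_swap_above:
  assumes "A \<subseteq> {..<d}"
  shows "inj (swap_above d A)"
proof (rule inj_on_inverseI)
  fix k show "swap_above d A (swap_above d A k) = k"
    using assms by (auto simp: swap_above_def)
qed

lemma rmean_rmean_eq_average:
  assumes "finite A" "finite B"
  shows "rmean A (\<lambda>S'. rmean B (F S')) = (\<Sum>x\<in>Pow A \<times> Pow B. F (fst x) (snd x)) / real (card (Pow A \<times> Pow B))"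
proof -
  have "rmean A (\<lambda>S'. rmean B (F S')) = (\<Sum>S'\<in>Pow A. \<Sum>S\<in>Pow B. F S' S) / (2 ^ card A * 2 ^ card B)"
    by (simp add: rmean_def sum_divide_distrib[symmetric])
  also have "(\<Sum>S'\<in>Pow A. \<Sum>S\<in>Pow B. F S' S) = (\<Sum>x\<in>Pow A \<times> Pow B. F (fst x) (snd x))"
    by (simp add: sum.cartesian_product case_prod_beta')
  finally show ?thesis using assms by (simp add: card_cartesian_product card_Pow)
qed

lemma rmean_eq_average: "finite A \<Longrightarrow> rmean A F = (\<Sum>S\<in>Pow A. F S) / real (card (Pow A))"
  by (simp add: rmean_def card_Pow)

text \<open>\<open>T\<close> is the ball over which the supremum is taken and \<open>f\<close> is
  jointly measurable on the whole parameter space. Dimension 0 is treated apart in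
  \<open>sup_U_process_eq_0\<close>; here \<open>1 \<le> \<nu>\<close> lets additive constants be
  absorbed into multiples of \<open>\<nu>\<close>.\<close>

locale vc_kernel = iid_sequence P for P :: "'z measure" +
  fixes p :: nat and T :: "vec set" and f :: "'z \<Rightarrow> 'z \<Rightarrow> vec \<Rightarrow> real" and B :: real and \<nu> :: nat
  assumes T: "T \<in> sets (euclid p)" "T \<noteq> {}"
    and f_meas: "(\<lambda>(x, y, \<theta>). f x y \<theta>) \<in> borel_measurable (P \<Otimes>\<^sub>M P \<Otimes>\<^sub>M euclid p)"
    and f_bd: "\<And>x y \<theta>. x \<in> space P \<Longrightarrow> y \<in> space P \<Longrightarrow> \<theta> \<in> T \<Longrightarrow> \<bar>f x y \<theta>\<bar> \<le> B"
    and B: "0 < B"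
    and vc: "vc_le ((\<lambda>\<theta>. subgraph (space P \<times> space P) (\<lambda>(x, y). f x y \<theta>)) ` T) \<nu>"
    and \<nu>: "1 \<le> \<nu>"
begin

lemma T_space: "\<theta> \<in> T \<Longrightarrow> \<theta> \<in> space (euclid p)"
  using sets.sets_into_space[OF T(1)] by blast

text \<open>The mixed second difference. It annihilates functions of a single argument, so it is the
  same for \<open>f\<close> and for the degenerate kernel (\<open>qd_hker\<close>), and it changes
  sign when \<open>i\<close> and \<open>i'\<close>, or \<open>j\<close> and \<open>j'\<close>, are
  exchanged.\<close>

definition qd :: "(nat \<Rightarrow> 'z) \<Rightarrow> vec \<Rightarrow> nat \<Rightarrow> nat \<Rightarrow> nat \<Rightarrow> nat \<Rightarrow> real" where
  "qd \<omega> \<theta> i i' j j' = f (\<omega> i) (\<omega> j) \<theta> - f (\<omega> i') (\<omega> j) \<theta> - f (\<omega> i) (\<omega> j') \<theta> + f (\<omega> i') (\<omega> j') \<theta>"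

text \<open>
  The two halves of the sample are \<open>\<omega> i\<close> and \<open>\<omega> (b + j)\<close> with \<open>i, j < b\<close>; their independent copies are
  \<open>\<omega> (2 * b + i)\<close> and \<open>\<omega> (3 * b + j)\<close>.
\<close>

definition H :: "nat \<Rightarrow> (nat \<Rightarrow> 'z) \<Rightarrow> vec \<Rightarrow> nat \<Rightarrow> nat \<Rightarrow> real" where
  "H b \<omega> \<theta> i j = qd \<omega> \<theta> i (2 * b + i) (b + j) (3 * b + j)"

definition hker :: "vec \<Rightarrow> 'z \<Rightarrow> 'z \<Rightarrow> real" where
  "hker \<theta> x y = f x y \<theta> - (\<integral>w. f x w \<theta> \<partial>P) - (\<integral>w. f w y \<theta> \<partial>P) + (\<integral>v. \<integral>w. f v w \<theta> \<partial>P \<partial>P)"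

lemma f_comp_measurable:
  "(\<lambda>(\<omega>, \<theta>). f (\<omega> i) (\<omega> j) \<theta>) \<in> borel_measurable (PP \<Otimes>\<^sub>M euclid p)"
proof -
  have "(\<lambda>x. (fst x i, fst x j, snd x)) \<in> measurable (PP \<Otimes>\<^sub>M euclid p) (P \<Otimes>\<^sub>M P \<Otimes>\<^sub>M euclid p)"
    by measurable
  from measurable_compose[OF this f_meas] show ?thesis by (simp add: case_prod_beta')
qed

lemma qd_measurable: "(\<lambda>(\<omega>, \<theta>). qd \<omega> \<theta> i i' j j') \<in> borel_measurable (PP \<Otimes>\<^sub>M euclid p)"
  using f_comp_measurable[of i j] f_comp_measurable[of i' j] f_comp_measurable[of i j'] f_comp_measurable[of i' j']
  unfolding qd_def by (simp add: case_prod_beta')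

lemma section_measurable:
  assumes "(\<lambda>(\<omega>, \<theta>). g \<omega> \<theta>) \<in> borel_measurable (PP \<Otimes>\<^sub>M euclid p)" "\<theta> \<in> T"
  shows "(\<lambda>\<omega>. g \<omega> \<theta> :: real) \<in> borel_measurable PP"
  using measurable_compose[OF measurable_Pair2'[OF T_space[OF assms(2)]] assms(1)] by simp

lemma qd_bd: "\<omega> \<in> space PP \<Longrightarrow> \<theta> \<in> T \<Longrightarrow> \<bar>qd \<omega> \<theta> i i' j j'\<bar> \<le> 4 * B"
  using f_bd[of "\<omega> i" "\<omega> j" \<theta>] f_bd[of "\<omega> i'" "\<omega> j" \<theta>] f_bd[of "\<omega> i" "\<omega> j'" \<theta>] f_bd[of "\<omega> i'" "\<omega> j'" \<theta>]
  unfolding qd_def space_PP by fastforce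

lemma qd_diff_le:
  "\<bar>qd \<omega> \<theta> i i' j j' - qd \<omega> s i i' j j'\<bar> \<le> (\<Sum>cd\<in>UNIV.
     \<bar>f (\<omega> (if fst cd then i' else i)) (\<omega> (if snd cd then j' else j)) \<theta> -
      f (\<omega> (if fst cd then i' else i)) (\<omega> (if snd cd then j' else j)) s\<bar>)"
  unfolding UNIV_Times_UNIV[symmetric] UNIV_bool qd_def by simp

lemma qd_square_diff_le:
  assumes "\<omega> \<in> space PP" "\<theta> \<in> T" "s \<in> T"
  shows "\<bar>(qd \<omega> \<theta> i i' j j')\<^sup>2 - (qd \<omega> s i i' j j')\<^sup>2\<bar> \<le> 8 * B * \<bar>qd \<omega> \<theta> i i' j j' - qd \<omega> s i i' j j'\<bar>"
proof -
  let ?a = "qd \<omega> \<theta> i i' j j'" and ?b = "qd \<omega> s i i' j j'"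
  have "\<bar>?a\<^sup>2 - ?b\<^sup>2\<bar> = \<bar>?a + ?b\<bar> * \<bar>?a - ?b\<bar>"
    unfolding abs_mult[symmetric] by (simp add: power2_eq_square algebra_simps)
  also have "\<dots> \<le> 8 * B * \<bar>?a - ?b\<bar>"
    using qd_bd[OF assms(1,2), of i i' j j'] qd_bd[OF assms(1,3), of i i' j j']
    by (intro mult_right_mono) auto
  finally show ?thesis .
qed

lemma exists_cover:
  fixes idx :: "'q \<Rightarrow> nat \<times> nat"
  assumes "finite Q" "\<omega> \<in> space PP" "0 < u" "u \<le> 1"
  shows "\<exists>N. finite N \<and> N \<noteq> {} \<and> N \<subseteq> T \<and> ln (real (card N)) \<le> 3 * real \<nu> * ln (4 / u) \<and>
     (\<forall>\<theta>\<in>T. \<exists>s\<in>N. (\<Sum>q\<in>Q. \<bar>f (\<omega> (fst (idx q))) (\<omega> (snd (idx q))) \<theta> - f (\<omega> (fst (idx q))) (\<omega> (snd (idx q))) s\<bar>)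
        \<le> 2 * B * u * real (card Q))"
  using exists_vc_cover[of Q "\<lambda>q. (\<omega> (fst (idx q)), \<omega> (snd (idx q)))" "space P \<times> space P" T B u \<nu>
      "\<lambda>\<theta> (x, y). f x y \<theta>"] assms T B \<nu> f_bd vc
  by (auto simp: space_PP)

subsection \<open>The conditional Rademacher bound\<close>

text \<open>Chaining over nets that are \<open>L^1\<close> nets for \<open>f\<close> at the corners
  of all second differences. The bound is kept linear in \<open>D\<close>, because \<open>D\<close>
  is later replaced by an upper expectation.\<close>

lemma rmean_SUP_H_le:
  assumes \<omega>: "\<omega> \<in> space PP" and b: "1 \<le> b" and \<eta>: "0 < \<eta>" "\<eta> \<le> 1 / 4"
    and D: "\<And>\<theta>. \<theta> \<in> T \<Longrightarrow> (\<Sum>i<b. \<Sum>j<b. (H b \<omega> \<theta> i j)\<^sup>2) \<le> D"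
    and \<rho>_def: "\<rho> = 8 * B * real b * sqrt \<eta>"
  shows "rmean {..<b} (\<lambda>S'. rmean {..<b} (\<lambda>S. SUP \<theta>\<in>T. \<bar>chaos {..<b} {..<b} (H b \<omega> \<theta>) S' S\<bar>))
    \<le> sqrt 2 * (7 * real \<nu> * ln (1 / \<eta>)) * (7 * \<rho> + D / \<rho>)"
proof -
  have \<rho>: "0 < \<rho>" using B b \<eta> by (simp add: \<rho>_def)
  obtain \<theta>1 where "\<theta>1 \<in> T" using T by blast
  have D0: "0 \<le> D" by (rule order_trans[OF _ D[OF \<open>\<theta>1 \<in> T\<close>]]) (intro sum_nonneg, simp)
  \<comment> \<open>For every index pair the two truth values choose between an observation and its
    copy, so \<open>Q\<close> lists the four corners of each second difference.\<close>
  define Q :: "((nat \<times> nat) \<times> (bool \<times> bool)) set" where "Q = ({..<b} \<times> {..<b}) \<times> UNIV"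
  have Q: "finite Q" "card Q = 4 * b\<^sup>2"
    by (auto simp: Q_def card_cartesian_product power2_eq_square)
  define idx where "idx q =
    (if fst (snd q) then 2 * b + fst (fst q) else fst (fst q),
     if snd (snd q) then 3 * b + snd (fst q) else b + snd (fst q))" for q :: "(nat \<times> nat) \<times> (bool \<times> bool)"
  have idx_eq: "idx ((i, j), cd) = (if fst cd then 2 * b + i else i, if snd cd then 3 * b + j else b + j)" for i j cd
    unfolding idx_def by (cases "fst cd"; cases "snd cd") simp_all
  define \<Delta> where "\<Delta> \<theta> s q = \<bar>f (\<omega> (fst (idx q))) (\<omega> (snd (idx q))) \<theta> - f (\<omega> (fst (idx q))) (\<omega> (snd (idx q))) s\<bar>" for \<theta> s q
  \<comment> \<open>The \<open>L^1\<close> radius \<open>2 * B * u k * (4 * b\<^sup>2)\<close>,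
    multiplied by the factor \<open>8 * B\<close> from \<open>dist\<close>, equals
    \<open>(\<rho> / 2 ^ k)\<^sup>2\<close>; quartering \<open>u\<close> therefore halves the
    chaining radius.\<close>
  define u where "u k = \<eta> / 4 ^ k" for k :: nat
  have u: "0 < u k" "u k \<le> 1" for k
  proof -
    show "0 < u k" using \<eta> by (simp add: u_def)
    have "\<eta> \<le> 1 * 4 ^ k" using \<eta> one_le_power[of "4::real" k] by linarith
    then show "u k \<le> 1" by (simp add: u_def field_simps)
  qed
  have "\<forall>k. \<exists>N. finite N \<and> N \<noteq> {} \<and> N \<subseteq> T \<and> ln (real (card N)) \<le> 3 * real \<nu> * ln (4 / u k) \<and>
     (\<forall>\<theta>\<in>T. \<exists>s\<in>N. (\<Sum>q\<in>Q. \<Delta> \<theta> s q)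
        \<le> 2 * B * u k * real (card Q))"
    unfolding \<Delta>_def by (intro allI exists_cover[OF Q(1) \<omega> u])
  from choice[OF this] obtain N where N: "\<And>k. finite (N k)" "\<And>k. N k \<noteq> {}" "\<And>k. N k \<subseteq> T"
    "\<And>k. ln (real (card (N k))) \<le> 3 * real \<nu> * ln (4 / u k)"
    "\<And>k \<theta>. \<theta> \<in> T \<Longrightarrow> \<exists>s\<in>N k. (\<Sum>q\<in>Q. \<Delta> \<theta> s q)
        \<le> 2 * B * u k * real (card Q)"
    by blast
  have dist: "(\<Sum>i<b. \<Sum>j<b. (H b \<omega> \<theta> i j - H b \<omega> s i j)\<^sup>2) \<le> 8 * B *
     (\<Sum>q\<in>Q. \<Delta> \<theta> s q)"
    if "\<theta> \<in> T" "s \<in> T" for \<theta> s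
  proof -
    have "(H b \<omega> \<theta> i j - H b \<omega> s i j)\<^sup>2 \<le> 8 * B * (\<Sum>cd\<in>UNIV.
       \<Delta> \<theta> s ((i, j), cd))"
      for i j
    proof -
      have "\<bar>H b \<omega> \<theta> i j - H b \<omega> s i j\<bar> \<le> 8 * B"
        using qd_bd[OF \<omega> that(1), of i "2 * b + i" "b + j" "3 * b + j"]
          qd_bd[OF \<omega> that(2), of i "2 * b + i" "b + j" "3 * b + j"] unfolding H_def by linarith
      then have "\<bar>H b \<omega> \<theta> i j - H b \<omega> s i j\<bar> * \<bar>H b \<omega> \<theta> i j - H b \<omega> s i j\<bar> \<le> 8 * B * \<bar>H b \<omega> \<theta> i j - H b \<omega> s i j\<bar>"
        by (rule mult_right_mono) simp
      also have "\<dots> \<le> 8 * B * (\<Sum>cd\<in>UNIV.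
         \<Delta> \<theta> s ((i, j), cd))"
        unfolding H_def \<Delta>_def idx_eq fst_conv snd_conv
        using qd_diff_le[of \<omega> \<theta> i "2 * b + i" "b + j" "3 * b + j" s] B
        by (intro mult_left_mono) simp_all
      finally show ?thesis by (simp add: power2_eq_square)
    qed
    then have "(\<Sum>i<b. \<Sum>j<b. (H b \<omega> \<theta> i j - H b \<omega> s i j)\<^sup>2) \<le> (\<Sum>i<b. \<Sum>j<b. 8 * B * (\<Sum>cd\<in>UNIV.
       \<Delta> \<theta> s ((i, j), cd)))"
      by (intro sum_mono)
    also have "\<dots> = 8 * B * (\<Sum>i<b. \<Sum>j<b. \<Sum>cd\<in>UNIV.
       \<Delta> \<theta> s ((i, j), cd))"
      by (simp only: sum_distrib_left)
    also have "(\<Sum>i<b. \<Sum>j<b. \<Sum>cd\<in>UNIV.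
       \<Delta> \<theta> s ((i, j), cd))
      = (\<Sum>q\<in>Q. \<Delta> \<theta> s q)"
    proof -
      have "(\<Sum>i<b. \<Sum>j<b. \<Sum>cd\<in>UNIV. G ((i, j), cd)) = (\<Sum>q\<in>Q. G q)"
        for G :: "(nat \<times> nat) \<times> bool \<times> bool \<Rightarrow> real"
      proof -
        have "(\<Sum>i<b. \<Sum>j<b. \<Sum>cd\<in>UNIV. G ((i, j), cd)) = (\<Sum>(i, j)\<in>{..<b} \<times> {..<b}. \<Sum>cd\<in>UNIV. G ((i, j), cd))"
          by (rule sum.cartesian_product)
        also have "\<dots> = (\<Sum>ij\<in>{..<b} \<times> {..<b}. \<Sum>cd\<in>UNIV. G (ij, cd))"
          by (rule sum.cong) auto
        also have "\<dots> = (\<Sum>(ij, cd)\<in>({..<b} \<times> {..<b}) \<times> UNIV. G (ij, cd))"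
          by (rule sum.cartesian_product)
        also have "\<dots> = (\<Sum>q\<in>Q. G q)" unfolding Q_def by (rule sum.cong) auto
        finally show ?thesis .
      qed
      then show ?thesis .
    qed
    finally show ?thesis .
  qed
  have cov: "\<exists>s\<in>N k. (\<Sum>i<b. \<Sum>j<b. (H b \<omega> \<theta> i j - H b \<omega> s i j)\<^sup>2) \<le> (\<rho> / 2 ^ k)\<^sup>2" if \<theta>T: "\<theta> \<in> T" for k \<theta>
  proof -
    obtain s where s: "s \<in> N k" "(\<Sum>q\<in>Q. \<Delta> \<theta> s q)
        \<le> 2 * B * u k * real (card Q)" using N(5)[OF \<theta>T] by blast
    have "s \<in> T" using s(1) N(3) by blast
    have "(\<Sum>i<b. \<Sum>j<b. (H b \<omega> \<theta> i j - H b \<omega> s i j)\<^sup>2) \<le> 8 * B * (2 * B * u k * real (card Q))"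
      using dist[OF \<theta>T \<open>s \<in> T\<close>] s(2) B by (meson mult_left_mono order_trans less_imp_le mult_nonneg_nonneg zero_le_numeral)
    also have "\<dots> = (\<rho> / 2 ^ k)\<^sup>2"
    proof -
      have "((2::real) ^ k)\<^sup>2 = 4 ^ k" by (simp add: power2_eq_square power_mult_distrib[symmetric])
      then show ?thesis
        using \<eta> by (simp add: \<rho>_def Q(2) u_def power_mult_distrib power_divide power2_eq_square[of B])
    qed
    finally show ?thesis using s(1) by blast
  qed
  have ln4: "ln 4 \<le> ln (1 / \<eta>)" "0 < ln (4::real)" using \<eta> by (auto simp: field_simps)
  \<comment> \<open>The factor 7 is 1 + 3 + 3: the initial \<open>ln 4\<close> and the two summands
    of \<open>ln (4 / u k)\<close> are each bounded by multiples of
    \<open>(k + 1) * ln (1 / \<eta>)\<close>, which uses \<open>\<eta> \<le> 1 / 4\<close>.\<close>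
  have card: "ln (4 * real (card (N k))) \<le> 7 * real \<nu> * ln (1 / \<eta>) * (real k + 1)" for k
  proof -
    have "0 < real (card (N k))" using N(1,2) by (simp add: card_gt_0_iff)
    then have "ln (4 * real (card (N k))) = ln 4 + ln (real (card (N k)))" by (simp add: ln_mult)
    also have "\<dots> \<le> ln 4 + 3 * real \<nu> * ln (4 / u k)" using N(4) by simp
    also have "ln (4 / u k) = (real k + 1) * ln 4 + ln (1 / \<eta>)"
    proof -
      have eq: "4 / u k = 4 ^ (k + 1) * (1 / \<eta>)" by (simp add: u_def)
      have "ln (4 / u k) = ln (4 ^ (k + 1)) + ln (1 / \<eta>)"
        unfolding eq using \<eta> by (intro ln_mult_pos) auto
      also have "ln ((4::real) ^ (k + 1)) = (real k + 1) * ln 4" unfolding ln_realpow by simp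
      finally show ?thesis .
    qed
    also have "ln 4 + 3 * real \<nu> * ((real k + 1) * ln 4 + ln (1 / \<eta>)) \<le>
       real \<nu> * (real k + 1) * ln (1 / \<eta>) + 3 * real \<nu> * ((real k + 1) * ln (1 / \<eta>) + (real k + 1) * ln (1 / \<eta>))"
    proof (intro add_mono mult_left_mono)
      have "1 * 1 \<le> real \<nu> * (real k + 1)" using \<nu> by (intro mult_mono) auto
      then have "1 * ln 4 \<le> (real \<nu> * (real k + 1)) * ln (1 / \<eta>)" using ln4 by (intro mult_mono) auto
      then show "ln 4 \<le> real \<nu> * (real k + 1) * ln (1 / \<eta>)" by simp
      have "0 \<le> ln (1 / \<eta>)" using ln4 by linarith
      then have "0 \<le> real k * ln (1 / \<eta>)" by (rule mult_nonneg_nonneg[OF of_nat_0_le_iff])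
      then show "ln (1 / \<eta>) \<le> (real k + 1) * ln (1 / \<eta>)" unfolding distrib_right by simp
      show "ln 4 \<le> ln (1 / \<eta>)" by (rule ln4(1))
    qed auto
    also have "\<dots> = 7 * real \<nu> * ln (1 / \<eta>) * (real k + 1)" by (simp add: algebra_simps)
    finally show ?thesis .
  qed
  have "rmean {..<b} (\<lambda>S'. rmean {..<b} (\<lambda>S. SUP \<theta>\<in>T. \<bar>chaos {..<b} {..<b} (H b \<omega> \<theta>) S' S\<bar>))
    \<le> sqrt 2 * (7 * real \<nu> * ln (1 / \<eta>)) * ((\<rho> + D / \<rho>) + 6 * \<rho>)"
  proof (rule rmean_SUP_chaos_le[where N = N])
    \<comment> \<open>The radius \<open>\<rho> + D / \<rho>\<close> exceeds the square root of
      \<open>D\<close> by expanding its square, is positive even if \<open>D\<close> vanishes, and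
      is affine in \<open>D\<close>.\<close>
    show "0 < \<rho> + D / \<rho>" using \<rho> D0 by (simp add: add_pos_nonneg)
    have "0 \<le> \<rho>\<^sup>2 + (D / \<rho>)\<^sup>2" by simp
    then have "D \<le> (\<rho> + D / \<rho>)\<^sup>2" using \<rho> D0 by (simp add: power2_sum)
    then show "(\<Sum>i<b. \<Sum>j<b. (H b \<omega> \<theta> i j)\<^sup>2) \<le> (\<rho> + D / \<rho>)\<^sup>2" if "\<theta> \<in> T" for \<theta>
      using D[OF that] by simp
  qed (use T N(1-3) cov card \<rho> in simp_all)
  then show ?thesis by (simp add: algebra_simps)
qed

end

lemma abs_SUP_le:
  fixes g :: "'a \<Rightarrow> real"
  assumes "T \<noteq> {}" "\<And>\<theta>. \<theta> \<in> T \<Longrightarrow> \<bar>g \<theta>\<bar> \<le> L"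
  shows "\<bar>SUP \<theta>\<in>T. g \<theta>\<bar> \<le> L"
proof -
  obtain \<theta> where \<theta>: "\<theta> \<in> T" using assms(1) by blast
  have bdd: "bdd_above (g ` T)" by (rule bdd_aboveI2[of _ _ L]) (use assms(2) in \<open>fastforce simp: abs_le_iff\<close>)
  have "(SUP \<theta>\<in>T. g \<theta>) \<le> L" using assms by (intro cSUP_least) (auto simp: abs_le_iff)
  moreover have "- L \<le> g \<theta>" using assms(2)[OF \<theta>] by auto
  then have "- L \<le> (SUP \<theta>\<in>T. g \<theta>)" using cSUP_upper[OF \<theta> bdd] by linarith
  ultimately show ?thesis by (simp add: abs_le_iff)
qed

lemma bdd_above_absI:
  fixes g :: "'a \<Rightarrow> real"
  assumes "\<And>\<theta>. \<theta> \<in> T \<Longrightarrow> \<bar>g \<theta>\<bar> \<le> L"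
  shows "bdd_above (g ` T)"
  by (rule bdd_aboveI2[of _ _ L]) (use assms in \<open>fastforce simp: abs_le_iff\<close>)

context vc_kernel
begin

section \<open>Measurability and size of the degenerate kernel\<close>

lemma f_section_measurable:
  assumes "\<theta> \<in> T"
  shows "(\<lambda>(x, y). f x y \<theta>) \<in> borel_measurable (P \<Otimes>\<^sub>M P)"
proof -
  have "(\<lambda>x. (fst x, snd x, \<theta>)) \<in> measurable (P \<Otimes>\<^sub>M P) (P \<Otimes>\<^sub>M P \<Otimes>\<^sub>M euclid p)"
    using T_space[OF assms] by measurable
  from measurable_compose[OF this f_meas] show ?thesis by (simp add: case_prod_beta')
qed

lemma f_section_swap_measurable:
  assumes "\<theta> \<in> T"
  shows "(\<lambda>(y, x). f x y \<theta>) \<in> borel_measurable (P \<Otimes>\<^sub>M P)"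
  using measurable_compose[OF measurable_pair_swap'[of P P] f_section_measurable[OF assms]]
  by (simp add: case_prod_beta')

lemma f_sections_measurable:
  assumes "\<theta> \<in> T" "x \<in> space P"
  shows "(\<lambda>w. f x w \<theta>) \<in> borel_measurable P" "(\<lambda>w. f w x \<theta>) \<in> borel_measurable P"
  using measurable_compose[OF measurable_Pair1'[OF assms(2)] f_section_measurable[OF assms(1)]]
    measurable_compose[OF measurable_Pair1'[OF assms(2)] f_section_swap_measurable[OF assms(1)]]
  by simp_all

lemma P_abs_integral_le:
  assumes "g \<in> borel_measurable P" "\<And>x. x \<in> space P \<Longrightarrow> \<bar>g x\<bar> \<le> K"
  shows "\<bar>\<integral>x. g x \<partial>P\<bar> \<le> (K :: real)"
proof -
  have "\<bar>\<integral>x. g x \<partial>P\<bar> \<le> (\<integral>x. \<bar>g x\<bar> \<partial>P)" by (rule integral_abs_bound)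
  also have "\<dots> \<le> (\<integral>x. K \<partial>P)"
    using P.integrable_bounded[OF assms] assms(2) by (intro integral_mono) auto
  finally show ?thesis by (simp add: P.prob_space)
qed

lemma hker_measurable:
  assumes "\<theta> \<in> T"
  shows "(\<lambda>(x, y). hker \<theta> x y) \<in> borel_measurable (P \<Otimes>\<^sub>M P)"
proof -
  have 1: "(\<lambda>x. \<integral>w. f x w \<theta> \<partial>P) \<in> borel_measurable P"
    by (rule P.borel_measurable_lebesgue_integral[OF f_section_measurable[OF assms]])
  have 2: "(\<lambda>y. \<integral>w. f w y \<theta> \<partial>P) \<in> borel_measurable P"
    by (rule P.borel_measurable_lebesgue_integral[OF f_section_swap_measurable[OF assms]])
  show ?thesis
    using f_section_measurable[OF assms] measurable_compose[OF measurable_fst 1, of P]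
      measurable_compose[OF measurable_snd 2, of P]
    unfolding hker_def by (simp add: case_prod_beta')
qed

lemma hker_bd:
  assumes "\<theta> \<in> T" "x \<in> space P" "y \<in> space P"
  shows "\<bar>hker \<theta> x y\<bar> \<le> 4 * B"
proof -
  have 1: "\<bar>\<integral>w. f x w \<theta> \<partial>P\<bar> \<le> B" if "x \<in> space P" for x
    by (rule P_abs_integral_le[OF f_sections_measurable(1)[OF assms(1) that]]) (use f_bd that assms in blast)
  have 2: "\<bar>\<integral>w. f w y \<theta> \<partial>P\<bar> \<le> B"
    by (rule P_abs_integral_le[OF f_sections_measurable(2)[OF assms(1,3)]]) (use f_bd assms in blast)
  have 3: "\<bar>\<integral>v. \<integral>w. f v w \<theta> \<partial>P \<partial>P\<bar> \<le> B"
    by (rule P_abs_integral_le[OF P.borel_measurable_lebesgue_integral[OF f_section_measurable[OF assms(1)]] 1])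
  show ?thesis using 1[OF assms(2)] 2 3 f_bd[OF assms(2,3,1)] unfolding hker_def by linarith
qed

lemma qd_hker:
  "qd \<omega> \<theta> i i' j j' = hker \<theta> (\<omega> i) (\<omega> j) - hker \<theta> (\<omega> i') (\<omega> j) - hker \<theta> (\<omega> i) (\<omega> j') + hker \<theta> (\<omega> i') (\<omega> j')"
  by (simp add: qd_def hker_def)

lemma qd_section_measurable:
  "\<theta> \<in> T \<Longrightarrow> (\<lambda>\<omega>. qd \<omega> \<theta> i i' j j') \<in> borel_measurable PP"
  by (rule section_measurable[OF qd_measurable])

lemma qd_square_le: "\<omega> \<in> space PP \<Longrightarrow> \<theta> \<in> T \<Longrightarrow> (qd \<omega> \<theta> i i' j j')\<^sup>2 \<le> 16 * B\<^sup>2"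
  using power_mono[OF qd_bd abs_ge_zero, of \<omega> \<theta> i i' j j' 2] by (simp add: power_mult_distrib)

lemma integral_qd_square_le:
  assumes \<theta>: "\<theta> \<in> T" and e: "(\<integral>(x, y). (hker \<theta> x y)\<^sup>2 \<partial>(P \<Otimes>\<^sub>M P)) \<le> e"
    and ne: "i \<noteq> j" "i' \<noteq> j" "i \<noteq> j'" "i' \<noteq> j'"
  shows "(\<integral>\<omega>. (qd \<omega> \<theta> i i' j j')\<^sup>2 \<partial>PP) \<le> 16 * e"
proof -
  have hm: "(\<lambda>(x, y). (hker \<theta> x y)\<^sup>2) \<in> borel_measurable (P \<Otimes>\<^sub>M P)"
    using hker_measurable[OF \<theta>] by (simp add: case_prod_beta')
  have hb: "\<bar>(hker \<theta> x y)\<^sup>2\<bar> \<le> 16 * B\<^sup>2" if "x \<in> space P" "y \<in> space P" for x y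
    using power_mono[OF hker_bd[OF \<theta> that] abs_ge_zero, of 2] by (simp add: power_mult_distrib)
  have int: "(\<integral>\<omega>. (hker \<theta> (\<omega> k) (\<omega> l))\<^sup>2 \<partial>PP) \<le> e" if "k \<noteq> l" for k l
    using integral_two_components(2)[OF hm hb that] e by simp
  have ib: "integrable PP (\<lambda>\<omega>. (hker \<theta> (\<omega> k) (\<omega> l))\<^sup>2)" for k l
  proof (rule seq.P.integrable_bounded)
    show "(\<lambda>\<omega>. (hker \<theta> (\<omega> k) (\<omega> l))\<^sup>2) \<in> borel_measurable PP"
      using measurable_compose[OF _ hm, of "\<lambda>\<omega>. (\<omega> k, \<omega> l)" PP] by simp
    show "\<bar>(hker \<theta> (\<omega> k) (\<omega> l))\<^sup>2\<bar> \<le> 16 * B\<^sup>2" if "\<omega> \<in> space PP" for \<omega>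
      using that by (intro hb) (auto simp: space_PP)
  qed
  have sq: "(a - b - c + d)\<^sup>2 \<le> 4 * (a\<^sup>2 + b\<^sup>2 + c\<^sup>2 + d\<^sup>2)" for a b c d :: real
  proof -
    have "4 * (a\<^sup>2 + b\<^sup>2 + c\<^sup>2 + d\<^sup>2) - (a - b - c + d)\<^sup>2
        = (a + b)\<^sup>2 + (a + c)\<^sup>2 + (a - d)\<^sup>2 + (b - c)\<^sup>2 + (b + d)\<^sup>2 + (c + d)\<^sup>2"
      by (simp add: power2_eq_square algebra_simps)
    also have "0 \<le> \<dots>" by simp
    finally show ?thesis by simp
  qed
  have "(\<integral>\<omega>. (qd \<omega> \<theta> i i' j j')\<^sup>2 \<partial>PP) \<le> (\<integral>\<omega>. 4 * ((hker \<theta> (\<omega> i) (\<omega> j))\<^sup>2 + (hker \<theta> (\<omega> i') (\<omega> j))\<^sup>2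
      + (hker \<theta> (\<omega> i) (\<omega> j'))\<^sup>2 + (hker \<theta> (\<omega> i') (\<omega> j'))\<^sup>2) \<partial>PP)"
  proof (rule integral_mono)
    show "integrable PP (\<lambda>\<omega>. (qd \<omega> \<theta> i i' j j')\<^sup>2)"
      by (rule seq.P.integrable_bounded[where K = "16 * B\<^sup>2"])
        (use qd_section_measurable[OF \<theta>] qd_square_le[OF _ \<theta>] in auto)
    show "(qd \<omega> \<theta> i i' j j')\<^sup>2 \<le> 4 * ((hker \<theta> (\<omega> i) (\<omega> j))\<^sup>2 + (hker \<theta> (\<omega> i') (\<omega> j))\<^sup>2
      + (hker \<theta> (\<omega> i) (\<omega> j'))\<^sup>2 + (hker \<theta> (\<omega> i') (\<omega> j'))\<^sup>2)" for \<omega>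
      unfolding qd_hker by (rule sq)
  qed (use ib in auto)
  also have "\<dots> = 4 * ((\<integral>\<omega>. (hker \<theta> (\<omega> i) (\<omega> j))\<^sup>2 \<partial>PP) + (\<integral>\<omega>. (hker \<theta> (\<omega> i') (\<omega> j))\<^sup>2 \<partial>PP)
      + (\<integral>\<omega>. (hker \<theta> (\<omega> i) (\<omega> j'))\<^sup>2 \<partial>PP) + (\<integral>\<omega>. (hker \<theta> (\<omega> i') (\<omega> j'))\<^sup>2 \<partial>PP))"
    using ib by simp
  also have "\<dots> \<le> 16 * e" using int[OF ne(1)] int[OF ne(2)] int[OF ne(3)] int[OF ne(4)] by simp
  finally show ?thesis .
qed

subsection \<open>The second moment on the diagonal blocks\<close>

text \<open>Diagonal entries of \<open>H\<close>, shifted by \<open>s\<close>: offset 0 is the block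
  of observations and copies, offset \<open>4 * b\<close> an independent duplicate of that block.
  Entries with different \<open>i\<close> involve disjoint coordinates.\<close>

definition Hd :: "nat \<Rightarrow> nat \<Rightarrow> (nat \<Rightarrow> 'z) \<Rightarrow> vec \<Rightarrow> nat \<Rightarrow> real" where
  "Hd s b \<omega> \<theta> i = qd \<omega> \<theta> (s + i) (s + (2 * b + i)) (s + (b + i)) (s + (3 * b + i))"

definition one_sided :: "nat \<Rightarrow> (nat \<Rightarrow> 'z) \<Rightarrow> vec \<Rightarrow> real" where
  "one_sided b \<omega> \<theta> = (\<Sum>i<b. (Hd 0 b \<omega> \<theta> i)\<^sup>2 - 2 * (Hd (4 * b) b \<omega> \<theta> i)\<^sup>2)"

text \<open>All four coordinates belonging to an index \<open>i\<close> have the same residue modulo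
  \<open>b\<close>. Swapping a union of residue classes therefore exchanges complete entries with
  their duplicates and never splits one.\<close>

definition blocks :: "nat \<Rightarrow> nat set \<Rightarrow> nat set" where
  "blocks b S = {k. k < 4 * b \<and> k mod b \<in> S}"

lemma swap_blocks:
  assumes "i < b" "c < 4"
  shows "swap_above (4 * b) (blocks b S) (c * b + i) = (if i \<in> S then 4 * b + (c * b + i) else c * b + i)"
    and "swap_above (4 * b) (blocks b S) (4 * b + (c * b + i)) = (if i \<in> S then c * b + i else 4 * b + (c * b + i))"
proof -
  have "c * b + i < (c + 1) * b" using assms by (simp add: algebra_simps)
  also have "\<dots> \<le> 4 * b" using assms by (intro mult_right_mono) auto
  finally have lt: "c * b + i < 4 * b" .
  have md: "(c * b + i) mod b = i" using assms by simp
  show "swap_above (4 * b) (blocks b S) (c * b + i) = (if i \<in> S then 4 * b + (c * b + i) else c * b + i)"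
    using lt md by (simp add: swap_above_def blocks_def)
  show "swap_above (4 * b) (blocks b S) (4 * b + (c * b + i)) = (if i \<in> S then c * b + i else 4 * b + (c * b + i))"
    using lt md by (simp add: swap_above_def blocks_def)
qed

lemma Hd_swap:
  assumes "i < b"
  shows "Hd 0 b (\<lambda>n. \<omega> (swap_above (4 * b) (blocks b S) n)) \<theta> i = (if i \<in> S then Hd (4 * b) b \<omega> \<theta> i else Hd 0 b \<omega> \<theta> i)"
    and "Hd (4 * b) b (\<lambda>n. \<omega> (swap_above (4 * b) (blocks b S) n)) \<theta> i = (if i \<in> S then Hd 0 b \<omega> \<theta> i else Hd (4 * b) b \<omega> \<theta> i)"
  using swap_blocks[OF assms, of 0 S] swap_blocks[OF assms, of 1 S] swap_blocks[OF assms, of 2 S] swap_blocks[OF assms, of 3 S]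
  by (simp_all add: Hd_def qd_def)

lemma one_sided_swap:
  "one_sided b (\<lambda>n. \<omega> (swap_above (4 * b) (blocks b S) n)) \<theta> =
    (\<Sum>i<b. if i \<in> S then (Hd (4 * b) b \<omega> \<theta> i)\<^sup>2 - 2 * (Hd 0 b \<omega> \<theta> i)\<^sup>2 else (Hd 0 b \<omega> \<theta> i)\<^sup>2 - 2 * (Hd (4 * b) b \<omega> \<theta> i)\<^sup>2)"
  unfolding one_sided_def by (intro sum.cong refl) (simp add: Hd_swap)

text \<open>A single net is enough because an error of order \<open>b * u\<close> with
  \<open>u = sqrt (\<nu> / b)\<close> is permitted. The discretisation costs
  \<open>256 * B\<^sup>2 * u * b\<close>; the entropy term
  \<open>108 * B\<^sup>2 * \<nu> * ln (4 / u)\<close> is at most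
  \<open>432 * B\<^sup>2 * u * b\<close>, since \<open>\<nu> = b * u\<^sup>2\<close> and the
  logarithm is below \<open>4 / u\<close>. Together they give 688.\<close>

lemma rmean_SUP_one_sided_le:
  assumes \<omega>: "\<omega> \<in> space PP" and b: "1 \<le> b" "\<nu> \<le> b"
  shows "rmean {..<b} (\<lambda>S. SUP \<theta>\<in>T. one_sided b (\<lambda>n. \<omega> (swap_above (4 * b) (blocks b S) n)) \<theta>)
    \<le> 688 * B\<^sup>2 * real b * sqrt (real \<nu> / real b)"
proof -
  define u where "u = sqrt (real \<nu> / real b)"
  have u: "0 < u" "u \<le> 1" "real \<nu> = real b * u\<^sup>2" using b \<nu> by (auto simp: u_def)
  define Q :: "((nat \<times> bool) \<times> (bool \<times> bool)) set" where "Q = ({..<b} \<times> UNIV) \<times> UNIV"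
  have Q: "finite Q" "card Q = 8 * b" by (auto simp: Q_def card_cartesian_product)
  define idx where "idx q =
    ((if snd (fst q) then 4 * b else 0) + (if fst (snd q) then 2 * b + fst (fst q) else fst (fst q)),
     (if snd (fst q) then 4 * b else 0) + (if snd (snd q) then 3 * b + fst (fst q) else b + fst (fst q)))"
    for q :: "(nat \<times> bool) \<times> (bool \<times> bool)"
  define \<Delta> where "\<Delta> \<theta> s q = \<bar>f (\<omega> (fst (idx q))) (\<omega> (snd (idx q))) \<theta> - f (\<omega> (fst (idx q))) (\<omega> (snd (idx q))) s\<bar>" for \<theta> s q
  obtain N where N: "finite N" "N \<noteq> {}" "N \<subseteq> T" "ln (real (card N)) \<le> 3 * real \<nu> * ln (4 / u)"
    "\<And>\<theta>. \<theta> \<in> T \<Longrightarrow> \<exists>s\<in>N. (\<Sum>q\<in>Q. \<Delta> \<theta> s q) \<le> 2 * B * u * real (card Q)"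
    using exists_cover[OF Q(1) \<omega> u(1,2), of idx] unfolding \<Delta>_def by blast
  define Y where "Y \<theta> S = (\<Sum>i<b. if i \<in> S then (Hd (4 * b) b \<omega> \<theta> i)\<^sup>2 - 2 * (Hd 0 b \<omega> \<theta> i)\<^sup>2
      else (Hd 0 b \<omega> \<theta> i)\<^sup>2 - 2 * (Hd (4 * b) b \<omega> \<theta> i)\<^sup>2)" for \<theta> S
  have Hd_diff: "\<bar>(Hd (if e then 4 * b else 0) b \<omega> \<theta> i)\<^sup>2 - (Hd (if e then 4 * b else 0) b \<omega> s i)\<^sup>2\<bar>
      \<le> 8 * B * (\<Sum>cd\<in>UNIV. \<Delta> \<theta> s ((i, e), cd))" if "\<theta> \<in> T" "s \<in> T" for \<theta> s i e
  proof -
    let ?s = "if e then 4 * b else 0"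
    have "(\<Sum>cd\<in>UNIV. \<bar>f (\<omega> (if fst cd then ?s + (2 * b + i) else ?s + i)) (\<omega> (if snd cd then ?s + (3 * b + i) else ?s + (b + i))) \<theta> -
      f (\<omega> (if fst cd then ?s + (2 * b + i) else ?s + i)) (\<omega> (if snd cd then ?s + (3 * b + i) else ?s + (b + i))) s\<bar>)
      = (\<Sum>cd\<in>UNIV. \<Delta> \<theta> s ((i, e), cd))"
    proof (rule sum.cong[OF refl])
      fix cd :: "bool \<times> bool"
      show "\<bar>f (\<omega> (if fst cd then ?s + (2 * b + i) else ?s + i)) (\<omega> (if snd cd then ?s + (3 * b + i) else ?s + (b + i))) \<theta> -
        f (\<omega> (if fst cd then ?s + (2 * b + i) else ?s + i)) (\<omega> (if snd cd then ?s + (3 * b + i) else ?s + (b + i))) s\<bar> = \<Delta> \<theta> s ((i, e), cd)"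
        unfolding \<Delta>_def idx_def by (cases "fst cd"; cases "snd cd") simp_all
    qed
    then have "\<bar>Hd ?s b \<omega> \<theta> i - Hd ?s b \<omega> s i\<bar> \<le> (\<Sum>cd\<in>UNIV. \<Delta> \<theta> s ((i, e), cd))"
      using qd_diff_le[of \<omega> \<theta> "?s + i" "?s + (2 * b + i)" "?s + (b + i)" "?s + (3 * b + i)" s]
      unfolding Hd_def by (simp only:)
    then have "8 * B * \<bar>Hd ?s b \<omega> \<theta> i - Hd ?s b \<omega> s i\<bar> \<le> 8 * B * (\<Sum>cd\<in>UNIV. \<Delta> \<theta> s ((i, e), cd))"
      using B by (intro mult_left_mono) auto
    then show ?thesis
      using qd_square_diff_le[OF \<omega> that, of "?s + i" "?s + (2 * b + i)" "?s + (b + i)" "?s + (3 * b + i)"]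
      unfolding Hd_def by linarith
  qed
  have Ydiff: "Y \<theta> S \<le> Y s S + 16 * B * (\<Sum>q\<in>Q. \<Delta> \<theta> s q)" if "\<theta> \<in> T" "s \<in> T" for \<theta> s S
  proof -
    have split: "(\<Sum>q\<in>Q. \<Delta> \<theta> s q) = (\<Sum>i<b. (\<Sum>cd\<in>UNIV. \<Delta> \<theta> s ((i, True), cd)) + (\<Sum>cd\<in>UNIV. \<Delta> \<theta> s ((i, False), cd)))"
    proof -
      have "(\<Sum>i<b. (\<Sum>cd\<in>UNIV. \<Delta> \<theta> s ((i, True), cd)) + (\<Sum>cd\<in>UNIV. \<Delta> \<theta> s ((i, False), cd)))
        = (\<Sum>i<b. \<Sum>e\<in>UNIV. \<Sum>cd\<in>UNIV. \<Delta> \<theta> s ((i, e), cd))"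
        by (simp add: UNIV_bool add.commute)
      also have "\<dots> = (\<Sum>(i, e)\<in>{..<b} \<times> UNIV. \<Sum>cd\<in>UNIV. \<Delta> \<theta> s ((i, e), cd))" by (rule sum.cartesian_product)
      also have "\<dots> = (\<Sum>ie\<in>{..<b} \<times> UNIV. \<Sum>cd\<in>UNIV. \<Delta> \<theta> s (ie, cd))" by (rule sum.cong) auto
      also have "\<dots> = (\<Sum>(ie, cd)\<in>({..<b} \<times> UNIV) \<times> UNIV. \<Delta> \<theta> s (ie, cd))" by (rule sum.cartesian_product)
      also have "\<dots> = (\<Sum>q\<in>Q. \<Delta> \<theta> s q)" unfolding Q_def by (rule sum.cong) auto
      finally show ?thesis by simp
    qed
    have "Y \<theta> S - Y s S \<le> (\<Sum>i<b. 16 * B * ((\<Sum>cd\<in>UNIV. \<Delta> \<theta> s ((i, True), cd)) + (\<Sum>cd\<in>UNIV. \<Delta> \<theta> s ((i, False), cd))))"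
      unfolding Y_def sum_subtractf[symmetric]
    proof (rule sum_mono)
      fix i
      define dT where "dT = (\<Sum>cd\<in>UNIV. \<Delta> \<theta> s ((i, True), cd))"
      define dF where "dF = (\<Sum>cd\<in>UNIV. \<Delta> \<theta> s ((i, False), cd))"
      define BT where "BT = B * dT"
      define BF where "BF = B * dF"
      have 1: "\<bar>(Hd (4 * b) b \<omega> \<theta> i)\<^sup>2 - (Hd (4 * b) b \<omega> s i)\<^sup>2\<bar> \<le> 8 * BT"
        using Hd_diff[OF that, of True i] by (simp add: dT_def BT_def)
      have 2: "\<bar>(Hd 0 b \<omega> \<theta> i)\<^sup>2 - (Hd 0 b \<omega> s i)\<^sup>2\<bar> \<le> 8 * BF"
        using Hd_diff[OF that, of False i] by (simp add: dF_def BF_def)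
      have 3: "16 * B * (dT + dF) = 16 * BT + 16 * BF" by (simp add: BT_def BF_def algebra_simps)
      have 4: "0 \<le> BT" "0 \<le> BF" using 1 2 by linarith+
      show "(if i \<in> S then (Hd (4 * b) b \<omega> \<theta> i)\<^sup>2 - 2 * (Hd 0 b \<omega> \<theta> i)\<^sup>2
          else (Hd 0 b \<omega> \<theta> i)\<^sup>2 - 2 * (Hd (4 * b) b \<omega> \<theta> i)\<^sup>2) -
         (if i \<in> S then (Hd (4 * b) b \<omega> s i)\<^sup>2 - 2 * (Hd 0 b \<omega> s i)\<^sup>2
          else (Hd 0 b \<omega> s i)\<^sup>2 - 2 * (Hd (4 * b) b \<omega> s i)\<^sup>2)
        \<le> 16 * B * ((\<Sum>cd\<in>UNIV. \<Delta> \<theta> s ((i, True), cd)) + (\<Sum>cd\<in>UNIV. \<Delta> \<theta> s ((i, False), cd)))" (is "?l \<le> _")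
        unfolding dT_def[symmetric] dF_def[symmetric] 3
      proof (cases "i \<in> S")
        case True
        show "?l \<le> 16 * BT + 16 * BF" unfolding if_P[OF True] using 1 2 4 by linarith
      next
        case False
        show "?l \<le> 16 * BT + 16 * BF" unfolding if_not_P[OF False] using 1 2 4 by linarith
      qed
    qed
    then show ?thesis unfolding split by (simp add: sum_distrib_left)
  qed
  have sup: "(SUP \<theta>\<in>T. Y \<theta> S) \<le> (MAX s\<in>N. Y s S) + 256 * B\<^sup>2 * u * real b" for S
  proof (rule cSUP_least[OF T(2)])
    fix \<theta> assume \<theta>: "\<theta> \<in> T"
    obtain s where s: "s \<in> N" "(\<Sum>q\<in>Q. \<Delta> \<theta> s q) \<le> 2 * B * u * real (card Q)" using N(5)[OF \<theta>] by blast
    have "s \<in> T" using s(1) N(3) by blast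
    have "Y \<theta> S \<le> Y s S + 16 * B * (\<Sum>q\<in>Q. \<Delta> \<theta> s q)" by (rule Ydiff[OF \<theta> \<open>s \<in> T\<close>])
    also have "16 * B * (\<Sum>q\<in>Q. \<Delta> \<theta> s q) \<le> 16 * B * (2 * B * u * real (card Q))"
      using s(2) B by (intro mult_left_mono) auto
    also have "\<dots> = 256 * B\<^sup>2 * u * real b" by (simp add: Q(2) power2_eq_square)
    also have "Y s S \<le> (MAX s\<in>N. Y s S)" using N(1) s(1) by (intro Max_ge) auto
    finally show "Y \<theta> S \<le> (MAX s\<in>N. Y s S) + 256 * B\<^sup>2 * u * real b" by simp
  qed
  have "rmean {..<b} (\<lambda>S. SUP \<theta>\<in>T. one_sided b (\<lambda>n. \<omega> (swap_above (4 * b) (blocks b S) n)) \<theta>)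
     = rmean {..<b} (\<lambda>S. SUP \<theta>\<in>T. Y \<theta> S)"
    unfolding one_sided_swap Y_def ..
  also have "\<dots> \<le> rmean {..<b} (\<lambda>S. (MAX s\<in>N. Y s S) + 256 * B\<^sup>2 * u * real b)"
    by (intro rmean_mono sup)
  also have "\<dots> = rmean {..<b} (\<lambda>S. MAX s\<in>N. Y s S) + 256 * B\<^sup>2 * u * real b"
    by (simp add: rmean_add rmean_const)
  also have "rmean {..<b} (\<lambda>S. MAX s\<in>N. Y s S) \<le> 9 / 4 * (16 * B\<^sup>2) * ln (real (card N))"
    unfolding Y_def
  proof (rule rmean_Max_one_sided_le[OF _ N(1,2)])
    fix s i assume "s \<in> N"
    then have "s \<in> T" using N(3) by blast
    then show "0 \<le> (Hd 0 b \<omega> s i)\<^sup>2 \<and> (Hd 0 b \<omega> s i)\<^sup>2 \<le> 16 * B\<^sup>2 \<and> 0 \<le> (Hd (4 * b) b \<omega> s i)\<^sup>2 \<and> (Hd (4 * b) b \<omega> s i)\<^sup>2 \<le> 16 * B\<^sup>2"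
      unfolding Hd_def using qd_square_le[OF \<omega>] by simp
  qed (use B in auto)
  also have "9 / 4 * (16 * B\<^sup>2) * ln (real (card N)) \<le> 9 / 4 * (16 * B\<^sup>2) * (3 * real \<nu> * ln (4 / u))"
    using N(4) by (intro mult_left_mono) auto
  also have "real \<nu> * ln (4 / u) \<le> 4 * real b * u"
  proof -
    have "ln (4 / u) \<le> 4 / u" using u by (intro order.strict_implies_order ln_less_self) auto
    then have "real b * u\<^sup>2 * ln (4 / u) \<le> real b * u\<^sup>2 * (4 / u)" by (intro mult_left_mono) auto
    then show ?thesis using u(1) by (simp add: u(3) power2_eq_square)
  qed
  then have "9 / 4 * (16 * B\<^sup>2) * (3 * real \<nu> * ln (4 / u)) \<le> 108 * B\<^sup>2 * (4 * real b * u)"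
  proof -
    have "108 * B\<^sup>2 * (real \<nu> * ln (4 / u)) \<le> 108 * B\<^sup>2 * (4 * real b * u)"
      using \<open>real \<nu> * ln (4 / u) \<le> 4 * real b * u\<close> by (intro mult_left_mono) auto
    then show ?thesis by (simp add: mult.assoc)
  qed
  finally show ?thesis by (simp add: u_def algebra_simps)
qed

lemma Hd_measurable: "(\<lambda>(\<omega>, \<theta>). Hd s b \<omega> \<theta> i) \<in> borel_measurable (PP \<Otimes>\<^sub>M euclid p)"
  unfolding Hd_def by (rule qd_measurable)

lemma Hd_square_le: "\<omega> \<in> space PP \<Longrightarrow> \<theta> \<in> T \<Longrightarrow> (Hd s b \<omega> \<theta> i)\<^sup>2 \<le> 16 * B\<^sup>2"
  unfolding Hd_def by (rule qd_square_le)

lemma one_sided_measurable: "(\<lambda>(\<omega>, \<theta>). one_sided b \<omega> \<theta>) \<in> borel_measurable (PP \<Otimes>\<^sub>M euclid p)"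
  unfolding one_sided_def using Hd_measurable by (simp add: case_prod_beta')

lemma one_sided_bd:
  assumes "\<omega> \<in> space PP" "\<theta> \<in> T"
  shows "\<bar>one_sided b \<omega> \<theta>\<bar> \<le> real b * (48 * B\<^sup>2)"
proof -
  have "\<bar>one_sided b \<omega> \<theta>\<bar> \<le> (\<Sum>i<b. \<bar>(Hd 0 b \<omega> \<theta> i)\<^sup>2 - 2 * (Hd (4 * b) b \<omega> \<theta> i)\<^sup>2\<bar>)"
    unfolding one_sided_def by (rule sum_abs)
  also have "\<dots> \<le> (\<Sum>i<b. 48 * B\<^sup>2)"
  proof (rule sum_mono)
    fix i
    show "\<bar>(Hd 0 b \<omega> \<theta> i)\<^sup>2 - 2 * (Hd (4 * b) b \<omega> \<theta> i)\<^sup>2\<bar> \<le> 48 * B\<^sup>2"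
      using Hd_square_le[OF assms, of 0 b i] Hd_square_le[OF assms, of "4 * b" b i]
        zero_le_power2[of "Hd 0 b \<omega> \<theta> i"] zero_le_power2[of "Hd (4 * b) b \<omega> \<theta> i"] by linarith
  qed
  finally show ?thesis by simp
qed

text \<open>The average over exchanges is bounded by a constant for every sequence, so a constant
  majorant is available, and symmetrisation removes the exchanges.\<close>

lemma outer_le_SUP_one_sided:
  assumes b: "1 \<le> b" "\<nu> \<le> b"
  shows "outer_le PP (\<lambda>\<omega>. SUP \<theta>\<in>T. one_sided b \<omega> \<theta>) (688 * B\<^sup>2 * real b * sqrt (real \<nu> / real b))"
proof (rule outer_le_symmetrize[where A = "Pow {..<b}" and \<pi> = "\<lambda>S. swap_above (4 * b) (blocks b S)" and L = "real b * (48 * B\<^sup>2)"])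
  show "(\<lambda>\<omega>. SUP \<theta>\<in>T. one_sided b \<omega> \<theta>) \<in> borel_measurable (completion PP)"
    by (rule borel_measurable_SUP_param[OF seq.P.finite_measure_axioms T one_sided_measurable])
      (rule bdd_above_absI, rule one_sided_bd)
  show "\<bar>SUP \<theta>\<in>T. one_sided b \<omega> \<theta>\<bar> \<le> real b * (48 * B\<^sup>2)" if "\<omega> \<in> space PP" for \<omega>
    by (rule abs_SUP_le[OF T(2) one_sided_bd[OF that]])
  show "inj (swap_above (4 * b) (blocks b S))" for S
    by (rule inj_swap_above) (auto simp: blocks_def)
  show "outer_le PP (\<lambda>\<omega>. (\<Sum>S\<in>Pow {..<b}. SUP \<theta>\<in>T. one_sided b (\<lambda>n. \<omega> (swap_above (4 * b) (blocks b S) n)) \<theta>) / real (card (Pow {..<b})))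
     (688 * B\<^sup>2 * real b * sqrt (real \<nu> / real b))"
    by (rule outer_le_mono[OF seq.P.outer_le_const _ order.refl])
      (use rmean_SUP_one_sided_le[OF _ b] in \<open>simp_all add: rmean_eq_average\<close>)
qed auto

text \<open>Integrating out the duplicate block turns the one-sided process into the diagonal sum
  minus twice its mean. That mean is at most \<open>16 * b * e\<close>, so adding
  \<open>32 * b * e\<close> compensates for the subtraction.\<close>

lemma outer_le_SUP_diagonal:
  assumes b: "1 \<le> b" "\<nu> \<le> b"
    and e: "\<And>\<theta>. \<theta> \<in> T \<Longrightarrow> (\<integral>(x, y). (hker \<theta> x y)\<^sup>2 \<partial>(P \<Otimes>\<^sub>M P)) \<le> e"
  shows "outer_le PP (\<lambda>\<omega>. SUP \<theta>\<in>T. \<Sum>i<b. (H b \<omega> \<theta> i i)\<^sup>2) (real b * (688 * B\<^sup>2 * sqrt (real \<nu> / real b) + 32 * e))"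
proof (rule outer_le_ghost[where d = "4 * b" and F = "\<lambda>\<theta> \<omega>. one_sided b \<omega> \<theta> + 32 * real b * e"
      and Y = "\<lambda>\<omega>. (SUP \<theta>\<in>T. one_sided b \<omega> \<theta>) + 32 * real b * e" and L = "real b * (48 * B\<^sup>2) + \<bar>32 * real b * e\<bar>"])
  show "outer_le PP (\<lambda>\<omega>. (SUP \<theta>\<in>T. one_sided b \<omega> \<theta>) + 32 * real b * e) (real b * (688 * B\<^sup>2 * sqrt (real \<nu> / real b) + 32 * e))"
    by (rule outer_le_mono[OF seq.P.outer_le_add[OF outer_le_SUP_one_sided[OF b] seq.P.outer_le_const]])
      (auto simp: algebra_simps)
  show "T \<noteq> {}" by (rule T(2))
  fix \<theta> assume \<theta>: "\<theta> \<in> T"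
  have om: "(\<lambda>\<omega>. one_sided b \<omega> \<theta>) \<in> borel_measurable PP"
    by (rule section_measurable[OF one_sided_measurable \<theta>])
  then show "(\<lambda>\<omega>. one_sided b \<omega> \<theta> + 32 * real b * e) \<in> borel_measurable PP" by simp
  fix \<omega> assume \<omega>: "\<omega> \<in> space PP"
  show "\<bar>one_sided b \<omega> \<theta> + 32 * real b * e\<bar> \<le> real b * (48 * B\<^sup>2) + \<bar>32 * real b * e\<bar>"
    using one_sided_bd[OF \<omega> \<theta>, of b] by linarith
  show "one_sided b \<omega> \<theta> + 32 * real b * e \<le> (SUP \<theta>\<in>T. one_sided b \<omega> \<theta>) + 32 * real b * e"
    using cSUP_upper[OF \<theta> bdd_above_absI[OF one_sided_bd[OF \<omega>, of _ b]]] by simp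
  have Hm: "(\<lambda>\<omega>'. (Hd 0 b \<omega>' \<theta> i)\<^sup>2) \<in> borel_measurable PP" for i
    using section_measurable[OF Hd_measurable \<theta>] by simp
  have Hi: "integrable PP (\<lambda>\<omega>'. (Hd 0 b \<omega>' \<theta> i)\<^sup>2)" for i
    by (rule seq.P.integrable_bounded[where K = "16 * B\<^sup>2"]) (use Hm Hd_square_le[OF _ \<theta>] in auto)
  have comb: "one_sided b (comb_seq (4 * b) \<omega> \<omega>') \<theta> = (\<Sum>i<b. (H b \<omega> \<theta> i i)\<^sup>2) - 2 * (\<Sum>i<b. (Hd 0 b \<omega>' \<theta> i)\<^sup>2)" for \<omega>'
    unfolding one_sided_def sum_subtractf sum_distrib_left[symmetric]
    by (intro arg_cong2[where f = "(-)"] arg_cong2[where f = "(*)"] sum.cong refl)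
      (auto simp: Hd_def H_def qd_def comb_seq_def)
  have "(\<integral>\<omega>'. one_sided b (comb_seq (4 * b) \<omega> \<omega>') \<theta> + 32 * real b * e \<partial>PP)
     = (\<integral>\<omega>'. ((\<Sum>i<b. (H b \<omega> \<theta> i i)\<^sup>2) + 32 * real b * e) - 2 * (\<Sum>i<b. (Hd 0 b \<omega>' \<theta> i)\<^sup>2) \<partial>PP)"
    unfolding comb by (simp add: algebra_simps)
  also have "\<dots> = ((\<Sum>i<b. (H b \<omega> \<theta> i i)\<^sup>2) + 32 * real b * e) - 2 * (\<Sum>i<b. \<integral>\<omega>'. (Hd 0 b \<omega>' \<theta> i)\<^sup>2 \<partial>PP)"
    using Hi by (simp add: seq.P.prob_space)
  finally have eq: "(\<integral>\<omega>'. one_sided b (comb_seq (4 * b) \<omega> \<omega>') \<theta> + 32 * real b * e \<partial>PP)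
     = ((\<Sum>i<b. (H b \<omega> \<theta> i i)\<^sup>2) + 32 * real b * e) - 2 * (\<Sum>i<b. \<integral>\<omega>'. (Hd 0 b \<omega>' \<theta> i)\<^sup>2 \<partial>PP)" .
  have "(\<Sum>i<b. \<integral>\<omega>'. (Hd 0 b \<omega>' \<theta> i)\<^sup>2 \<partial>PP) \<le> (\<Sum>i<b. 16 * e)"
    unfolding Hd_def by (intro sum_mono integral_qd_square_le[OF \<theta> e[OF \<theta>]]) auto
  then have "(\<Sum>i<b. \<integral>\<omega>'. (Hd 0 b \<omega>' \<theta> i)\<^sup>2 \<partial>PP) \<le> 16 * real b * e" by simp
  then show "(\<Sum>i<b. (H b \<omega> \<theta> i i)\<^sup>2) \<le> (\<integral>\<omega>'. one_sided b (comb_seq (4 * b) \<omega> \<omega>') \<theta> + 32 * real b * e \<partial>PP)"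
    unfolding eq by linarith
qed

end

section \<open>Cyclic diagonals of the index square\<close>

text \<open>Addition modulo \<open>b\<close> for arguments below \<open>b\<close>. The pairs of
  \<open>i\<close> with its rotation by \<open>s\<close>, for the \<open>b\<close> values of
  \<open>s\<close>, partition the index square into cyclic diagonals.\<close>

definition rotate_below :: "nat \<Rightarrow> nat \<Rightarrow> nat \<Rightarrow> nat" where
  "rotate_below b s i = (if i + s < b then i + s else i + s - b)"

lemma sum_rotate_below:
  assumes "i < b"
  shows "(\<Sum>s<b. g (rotate_below b s i)) = (\<Sum>j<b. g j)"
  by (rule sum.reindex_bij_witness[where i = "\<lambda>j. if i \<le> j then j - i else j + b - i" and j = "\<lambda>s. rotate_below b s i"])
    (use assms in \<open>auto simp: rotate_below_def\<close>)

text \<open>Rotates the second half and its copies in step while fixing the first half and its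
  copies, so that the main diagonal of the relabelled sequence is the \<open>s\<close>-th cyclic
  diagonal of the original one.\<close>

definition rotate_blocks :: "nat \<Rightarrow> nat \<Rightarrow> nat \<Rightarrow> nat" where
  "rotate_blocks b s k = (if b \<le> k \<and> k < 2 * b then b + rotate_below b s (k - b)
     else if 3 * b \<le> k \<and> k < 4 * b then 3 * b + rotate_below b s (k - 3 * b) else k)"

lemma inj_rotate_blocks:
  assumes "s < b"
  shows "inj (rotate_blocks b s)"
proof -
  have lt: "rotate_below b s i < b" if "i < b" for i using that assms by (auto simp: rotate_below_def)
  have inj: "i = j" if "rotate_below b s i = rotate_below b s j" "i < b" "j < b" for i j
    using that assms by (auto simp: rotate_below_def split: if_splits)
  have lt1: "rotate_below b s (k - b) < b" if "b \<le> k" "k < 2 * b" for k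
    by (rule lt) (use that in linarith)
  have lt3: "rotate_below b s (k - 3 * b) < b" if "3 * b \<le> k" "k < 4 * b" for k
    by (rule lt) (use that in linarith)
  have 1: "rotate_blocks b s k \<in> {b..<2 * b} \<longleftrightarrow> k \<in> {b..<2 * b}" for k
    using lt1[of k] lt3[of k] by (auto simp: rotate_blocks_def)
  have 3: "rotate_blocks b s k \<in> {3 * b..<4 * b} \<longleftrightarrow> k \<in> {3 * b..<4 * b}" for k
    using lt1[of k] lt3[of k] by (auto simp: rotate_blocks_def)
  show ?thesis
  proof (rule injI)
    fix x y assume eq: "rotate_blocks b s x = rotate_blocks b s y"
    consider "x \<in> {b..<2 * b}" "y \<in> {b..<2 * b}" | "x \<in> {3 * b..<4 * b}" "y \<in> {3 * b..<4 * b}"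
      | "x \<notin> {b..<2 * b}" "y \<notin> {b..<2 * b}" "x \<notin> {3 * b..<4 * b}" "y \<notin> {3 * b..<4 * b}"
      using eq 1[of x] 1[of y] 3[of x] 3[of y] by metis
    then show "x = y"
    proof cases
      case 1
      then have "rotate_below b s (x - b) = rotate_below b s (y - b)" using eq by (simp add: rotate_blocks_def)
      then have "x - b = y - b" by (rule inj) (use 1 in auto)
      then show ?thesis using 1 by auto
    next
      case 2
      then have "rotate_below b s (x - 3 * b) = rotate_below b s (y - 3 * b)" using eq by (simp add: rotate_blocks_def)
      then have "x - 3 * b = y - 3 * b" by (rule inj) (use 2 in auto)
      then show ?thesis using 2 by auto
    next
      case 3
      then show ?thesis using eq by (auto simp: rotate_blocks_def)
    qed
  qed
qed

context vc_kernel
begin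

lemma H_square_le: "\<omega> \<in> space PP \<Longrightarrow> \<theta> \<in> T \<Longrightarrow> (H b \<omega> \<theta> i j)\<^sup>2 \<le> 16 * B\<^sup>2"
  unfolding H_def by (rule qd_square_le)

lemma H_bd: "\<omega> \<in> space PP \<Longrightarrow> \<theta> \<in> T \<Longrightarrow> \<bar>H b \<omega> \<theta> i j\<bar> \<le> 4 * B"
  unfolding H_def by (rule qd_bd)

lemma sum_H_square_bd:
  assumes "\<omega> \<in> space PP" "\<theta> \<in> T"
  shows "\<bar>\<Sum>i<b. (H b \<omega> \<theta> i (j i))\<^sup>2\<bar> \<le> real b * (16 * B\<^sup>2)"
proof -
  have "(\<Sum>i<b. (H b \<omega> \<theta> i (j i))\<^sup>2) \<le> (\<Sum>i<b. 16 * B\<^sup>2)" by (intro sum_mono H_square_le assms)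
  moreover have "0 \<le> (\<Sum>i<b. (H b \<omega> \<theta> i (j i))\<^sup>2)" by (intro sum_nonneg) simp
  ultimately show ?thesis by simp
qed

text \<open>The supremum of a sum over diagonals is at most the sum of their suprema. By relabelling
  each has the upper expectation of the main diagonal, which accounts for the additional factor
  \<open>b\<close>.\<close>

lemma outer_le_SUP_square:
  assumes b: "1 \<le> b" "\<nu> \<le> b"
    and e: "\<And>\<theta>. \<theta> \<in> T \<Longrightarrow> (\<integral>(x, y). (hker \<theta> x y)\<^sup>2 \<partial>(P \<Otimes>\<^sub>M P)) \<le> e"
  shows "outer_le PP (\<lambda>\<omega>. SUP \<theta>\<in>T. \<Sum>i<b. \<Sum>j<b. (H b \<omega> \<theta> i j)\<^sup>2)
    ((real b)\<^sup>2 * (688 * B\<^sup>2 * sqrt (real \<nu> / real b) + 32 * e))"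
proof -
  let ?r = "real b * (688 * B\<^sup>2 * sqrt (real \<nu> / real b) + 32 * e)"
  have "outer_le PP (\<lambda>\<omega>. \<Sum>s<b. SUP \<theta>\<in>T. \<Sum>i<b. (H b (\<lambda>n. \<omega> (rotate_blocks b s n)) \<theta> i i)\<^sup>2) (\<Sum>s<b. ?r)"
    by (intro seq.P.outer_le_sum outer_le_reindex[OF inj_rotate_blocks outer_le_SUP_diagonal[OF b e]]) auto
  then show ?thesis
  proof (rule outer_le_mono)
    fix \<omega> assume \<omega>: "\<omega> \<in> space PP"
    have Hrot: "H b (\<lambda>n. \<omega> (rotate_blocks b s n)) \<theta> i i = H b \<omega> \<theta> i (rotate_below b s i)" if "i < b" "s < b" for s \<theta> i
      using that by (simp add: H_def qd_def rotate_blocks_def)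
    show "(SUP \<theta>\<in>T. \<Sum>i<b. \<Sum>j<b. (H b \<omega> \<theta> i j)\<^sup>2)
      \<le> (\<Sum>s<b. SUP \<theta>\<in>T. \<Sum>i<b. (H b (\<lambda>n. \<omega> (rotate_blocks b s n)) \<theta> i i)\<^sup>2)"
    proof (rule cSUP_least[OF T(2)])
      fix \<theta> assume \<theta>: "\<theta> \<in> T"
      have "(\<Sum>i<b. \<Sum>j<b. (H b \<omega> \<theta> i j)\<^sup>2) = (\<Sum>i<b. \<Sum>s<b. (H b \<omega> \<theta> i (rotate_below b s i))\<^sup>2)"
        by (intro sum.cong refl sum_rotate_below[symmetric]) auto
      also have "\<dots> = (\<Sum>s<b. \<Sum>i<b. (H b \<omega> \<theta> i (rotate_below b s i))\<^sup>2)" by (rule sum.swap)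
      also have "\<dots> \<le> (\<Sum>s<b. SUP \<theta>\<in>T. \<Sum>i<b. (H b \<omega> \<theta> i (rotate_below b s i))\<^sup>2)"
        by (intro sum_mono cSUP_upper[OF \<theta>] bdd_above_absI[OF sum_H_square_bd[OF \<omega>]])
      also have "\<dots> = (\<Sum>s<b. SUP \<theta>\<in>T. \<Sum>i<b. (H b (\<lambda>n. \<omega> (rotate_blocks b s n)) \<theta> i i)\<^sup>2)"
      proof (rule sum.cong[OF refl], rule SUP_cong[OF refl], rule sum.cong[OF refl])
        fix s \<theta> i assume "s \<in> {..<b}" "i \<in> {..<b}"
        then show "(H b \<omega> \<theta> i (rotate_below b s i))\<^sup>2 = (H b (\<lambda>n. \<omega> (rotate_blocks b s n)) \<theta> i i)\<^sup>2"
          using Hrot by simp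
      qed
      finally show "(\<Sum>i<b. \<Sum>j<b. (H b \<omega> \<theta> i j)\<^sup>2)
        \<le> (\<Sum>s<b. SUP \<theta>\<in>T. \<Sum>i<b. (H b (\<lambda>n. \<omega> (rotate_blocks b s n)) \<theta> i i)\<^sup>2)" .
    qed
  qed (simp add: power2_eq_square)
qed

subsection \<open>Symmetrization of the degenerate process\<close>

text \<open>\<open>S\<close> moves rows to their copies and the translate of \<open>S'\<close> moves
  columns, both over the distance \<open>2 * b\<close>. The second difference is antisymmetric in
  each argument separately, hence the product of two signs.\<close>

lemma H_swap:
  assumes "S \<subseteq> {..<b}" "S' \<subseteq> {..<b}" "i < b" "j < b"
  shows "H b (\<lambda>n. \<omega> (swap_above (2 * b) (S \<union> (+) b ` S') n)) \<theta> i j = rsign S i * rsign S' j * H b \<omega> \<theta> i j"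
proof -
  let ?A = "S \<union> (+) b ` S'"
  have lt: "x < b" if "x \<in> S \<or> x \<in> S'" for x using that assms by auto
  have A1: "i \<in> ?A \<longleftrightarrow> i \<in> S" using assms by auto
  have A2: "b + j \<in> ?A \<longleftrightarrow> j \<in> S'" using assms by auto
  have A3: "2 * b + i \<notin> ?A" "3 * b + j \<notin> ?A" using lt assms by fastforce+
  have 1: "swap_above (2 * b) ?A i = (if i \<in> S then 2 * b + i else i)"
    using assms A1 by (simp add: swap_above_def)
  have 2: "swap_above (2 * b) ?A (b + j) = (if j \<in> S' then 3 * b + j else b + j)"
    using assms A2 by (simp add: swap_above_def)
  have 3: "swap_above (2 * b) ?A (2 * b + i) = (if i \<in> S then i else 2 * b + i)"
    using A1 A3 by (simp add: swap_above_def)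
  have eq: "3 * b + j - 2 * b = b + j" by simp
  have 4: "swap_above (2 * b) ?A (3 * b + j) = (if j \<in> S' then b + j else 3 * b + j)"
    using A2 A3 unfolding swap_above_def eq by simp
  show ?thesis unfolding H_def qd_def 1 2 3 4 rsign_def by auto
qed

definition Wsum :: "nat \<Rightarrow> (nat \<Rightarrow> 'z) \<Rightarrow> vec \<Rightarrow> real" where
  "Wsum b \<omega> \<theta> = \<bar>\<Sum>i<b. \<Sum>j<b. H b \<omega> \<theta> i j\<bar>"

lemma Wsum_measurable: "(\<lambda>(\<omega>, \<theta>). Wsum b \<omega> \<theta>) \<in> borel_measurable (PP \<Otimes>\<^sub>M euclid p)"
  unfolding Wsum_def H_def using qd_measurable by (simp add: case_prod_beta')

lemma Wsum_bd:
  assumes "\<omega> \<in> space PP" "\<theta> \<in> T"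
  shows "\<bar>Wsum b \<omega> \<theta>\<bar> \<le> (real b)\<^sup>2 * (4 * B)"
proof -
  have "\<bar>\<Sum>i<b. \<Sum>j<b. H b \<omega> \<theta> i j\<bar> \<le> (\<Sum>i<b. \<Sum>j<b. \<bar>H b \<omega> \<theta> i j\<bar>)"
    by (rule order_trans[OF sum_abs]) (intro sum_mono sum_abs)
  also have "\<dots> \<le> (\<Sum>i<b. \<Sum>j<b. 4 * B)" by (intro sum_mono H_bd assms)
  finally show ?thesis by (simp add: Wsum_def power2_eq_square)
qed

text \<open>The conditional chaos bound is affine in the empirical second moment, so an upper
  expectation of the latter can be inserted before the exchanges are undone by symmetrisation. Both
  terms then have order \<open>b * sqrt \<eta>\<close>, which is the reason for the choice of
  \<open>\<rho>\<close>.\<close>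

lemma outer_le_SUP_Wsum:
  assumes b: "1 \<le> b" "\<nu> \<le> b" and \<eta>: "0 < \<eta>" "\<eta> \<le> 1 / 4"
    and e: "\<And>\<theta>. \<theta> \<in> T \<Longrightarrow> (\<integral>(x, y). (hker \<theta> x y)\<^sup>2 \<partial>(P \<Otimes>\<^sub>M P)) \<le> \<eta>"
    and \<nu>b: "sqrt (real \<nu> / real b) \<le> 2 * \<eta>"
  shows "outer_le PP (\<lambda>\<omega>. SUP \<theta>\<in>T. Wsum b \<omega> \<theta>)
    (sqrt 2 * 7 * (228 * B + 4 / B) * real b * real \<nu> * ln (1 / \<eta>) * sqrt \<eta>)"
proof -
  define \<rho> where "\<rho> = 8 * B * real b * sqrt \<eta>"
  have \<rho>: "0 < \<rho>" using B b \<eta> by (simp add: \<rho>_def)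
  define l where "l = ln (1 / \<eta>)"
  have l: "0 \<le> l" using \<eta> by (simp add: l_def)
  define a where "a = sqrt 2 * (7 * real \<nu> * l)"
  have a: "0 \<le> a" using l by (simp add: a_def)
  define D where "D \<omega> = (SUP \<theta>\<in>T. \<Sum>i<b. \<Sum>j<b. (H b \<omega> \<theta> i j)\<^sup>2)" for \<omega>
  let ?swap = "\<lambda>x n. swap_above (2 * b) (snd x \<union> (+) b ` fst x) n"
  define dD where "dD = (real b)\<^sup>2 * (688 * B\<^sup>2 * sqrt (real \<nu> / real b) + 32 * \<eta>)"
  have dD: "dD \<le> (real b)\<^sup>2 * ((1376 * B\<^sup>2 + 32) * \<eta>)"
  proof -
    have "688 * B\<^sup>2 * sqrt (real \<nu> / real b) \<le> 688 * B\<^sup>2 * (2 * \<eta>)" using \<nu>b by (intro mult_left_mono) auto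
    then show ?thesis unfolding dD_def by (intro mult_left_mono) (auto simp: algebra_simps)
  qed
  have "outer_le PP (\<lambda>\<omega>. a * (7 * \<rho> + 1 / \<rho> * D \<omega>)) (a * (7 * \<rho> + 1 / \<rho> * dD))"
    unfolding D_def dD_def using \<rho> a
    by (intro seq.P.outer_le_cmult seq.P.outer_le_add seq.P.outer_le_const outer_le_SUP_square[OF b e]) auto
  then have avg: "outer_le PP (\<lambda>\<omega>. (\<Sum>x\<in>Pow {..<b} \<times> Pow {..<b}. SUP \<theta>\<in>T. Wsum b (\<lambda>n. \<omega> (?swap x n)) \<theta>)
      / real (card (Pow {..<b} \<times> Pow {..<b}))) (a * (7 * \<rho> + 1 / \<rho> * dD))"
  proof (rule outer_le_mono)
    fix \<omega> assume \<omega>: "\<omega> \<in> space PP"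
    have D: "(\<Sum>i<b. \<Sum>j<b. (H b \<omega> \<theta> i j)\<^sup>2) \<le> D \<omega>" if "\<theta> \<in> T" for \<theta>
      unfolding D_def
    proof (rule cSUP_upper[OF that], rule bdd_above_absI)
      fix \<theta> assume "\<theta> \<in> T"
      then have "\<bar>\<Sum>i<b. \<Sum>j<b. (H b \<omega> \<theta> i j)\<^sup>2\<bar> \<le> (\<Sum>i<b. \<Sum>j<b. \<bar>(H b \<omega> \<theta> i j)\<^sup>2\<bar>)"
        by (intro order_trans[OF sum_abs] sum_mono sum_abs)
      also have "\<dots> \<le> (\<Sum>i<b. \<Sum>j<b. 16 * B\<^sup>2)"
        using H_square_le[OF \<omega> \<open>\<theta> \<in> T\<close>] by (intro sum_mono) simp
      finally show "\<bar>\<Sum>i<b. \<Sum>j<b. (H b \<omega> \<theta> i j)\<^sup>2\<bar> \<le> (\<Sum>i<b. \<Sum>j<b. 16 * B\<^sup>2)" .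
    qed
    have sw: "Wsum b (\<lambda>n. \<omega> (?swap (S', S) n)) \<theta> = \<bar>chaos {..<b} {..<b} (H b \<omega> \<theta>) S' S\<bar>"
      if "S' \<subseteq> {..<b}" "S \<subseteq> {..<b}" for S' S \<theta>
    proof -
      have "(\<Sum>i<b. \<Sum>j<b. H b (\<lambda>n. \<omega> (?swap (S', S) n)) \<theta> i j) = chaos {..<b} {..<b} (H b \<omega> \<theta>) S' S"
        unfolding chaos_def fst_conv snd_conv
        by (intro sum.cong refl H_swap that) auto
      then show ?thesis by (simp add: Wsum_def)
    qed
    have "(\<Sum>x\<in>Pow {..<b} \<times> Pow {..<b}. SUP \<theta>\<in>T. Wsum b (\<lambda>n. \<omega> (?swap x n)) \<theta>)
      / real (card (Pow {..<b} \<times> Pow {..<b})) = (\<Sum>x\<in>Pow {..<b} \<times> Pow {..<b}. SUP \<theta>\<in>T. \<bar>chaos {..<b} {..<b} (H b \<omega> \<theta>) (fst x) (snd x)\<bar>)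
      / real (card (Pow {..<b} \<times> Pow {..<b}))"
    proof (intro arg_cong2[where f = "(/)"] sum.cong refl SUP_cong)
      fix x \<theta> assume "x \<in> Pow {..<b} \<times> Pow {..<b}"
      then show "Wsum b (\<lambda>n. \<omega> (?swap x n)) \<theta> = \<bar>chaos {..<b} {..<b} (H b \<omega> \<theta>) (fst x) (snd x)\<bar>"
        using sw[of "fst x" "snd x" \<theta>] by auto
    qed
    also have "\<dots> = rmean {..<b} (\<lambda>S'. rmean {..<b} (\<lambda>S. SUP \<theta>\<in>T. \<bar>chaos {..<b} {..<b} (H b \<omega> \<theta>) S' S\<bar>))"
      by (rule rmean_rmean_eq_average[symmetric]) auto
    also have "\<dots> \<le> a * (7 * \<rho> + D \<omega> / \<rho>)"
      unfolding a_def l_def by (rule rmean_SUP_H_le[OF \<omega> b(1) \<eta> D \<rho>_def])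
    finally show "(\<Sum>x\<in>Pow {..<b} \<times> Pow {..<b}. SUP \<theta>\<in>T. Wsum b (\<lambda>n. \<omega> (?swap x n)) \<theta>)
      / real (card (Pow {..<b} \<times> Pow {..<b})) \<le> a * (7 * \<rho> + 1 / \<rho> * D \<omega>)" by simp
  qed simp
  have "outer_le PP (\<lambda>\<omega>. SUP \<theta>\<in>T. Wsum b \<omega> \<theta>) (a * (7 * \<rho> + 1 / \<rho> * dD))"
  proof (rule outer_le_symmetrize[OF _ _ _ _ _ avg])
    show "(\<lambda>\<omega>. SUP \<theta>\<in>T. Wsum b \<omega> \<theta>) \<in> borel_measurable (completion PP)"
      by (rule borel_measurable_SUP_param[OF seq.P.finite_measure_axioms T Wsum_measurable])
        (rule bdd_above_absI, rule Wsum_bd)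
    show "\<bar>SUP \<theta>\<in>T. Wsum b \<omega> \<theta>\<bar> \<le> (real b)\<^sup>2 * (4 * B)" if "\<omega> \<in> space PP" for \<omega>
      by (rule abs_SUP_le[OF T(2) Wsum_bd[OF that]])
    show "inj (?swap x)" if "x \<in> Pow {..<b} \<times> Pow {..<b}" for x
      by (rule inj_swap_above) (use that in force)
  qed auto
  then show ?thesis
  proof (rule outer_le_mono)
    \<comment> \<open>The coefficient \<open>1376 * B\<^sup>2 + 32\<close> is
      \<open>2 * 688 * B\<^sup>2 + 32\<close>; division by \<open>8 * B\<close> leaves
      \<open>172 * B + 4 / B\<close>, and \<open>7 * \<rho>\<close> adds
      \<open>56 * B\<close>.\<close>
    have "1 / \<rho> * dD \<le> 1 / \<rho> * ((real b)\<^sup>2 * ((1376 * B\<^sup>2 + 32) * \<eta>))"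
      using dD \<rho> by (intro mult_left_mono) auto
    also have "\<dots> = real b * sqrt \<eta> * (172 * B + 4 / B)"
    proof -
      have alg: "1 / (8 * B * c * q) * (c\<^sup>2 * ((1376 * B\<^sup>2 + 32) * (q * q))) = c * q * (172 * B + 4 / B)"
        if "0 < c" "0 < q" for c q :: real
        using that B by (simp add: field_simps power2_eq_square)
      show ?thesis
        using alg[of "real b" "sqrt \<eta>"] b \<eta> unfolding \<rho>_def by simp
    qed
    finally have "7 * \<rho> + 1 / \<rho> * dD \<le> real b * sqrt \<eta> * (228 * B + 4 / B)"
      by (simp add: \<rho>_def algebra_simps)
    then have "a * (7 * \<rho> + 1 / \<rho> * dD) \<le> a * (real b * sqrt \<eta> * (228 * B + 4 / B))"
      using a by (rule mult_left_mono)
    also have "\<dots> = sqrt 2 * 7 * (228 * B + 4 / B) * real b * real \<nu> * l * sqrt \<eta>"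
      by (simp add: a_def)
    finally show "a * (7 * \<rho> + 1 / \<rho> * dD) \<le> sqrt 2 * 7 * (228 * B + 4 / B) * real b * real \<nu> * ln (1 / \<eta>) * sqrt \<eta>"
      by (simp add: l_def)
  qed simp
qed

definition Vsum :: "nat \<Rightarrow> (nat \<Rightarrow> 'z) \<Rightarrow> vec \<Rightarrow> real" where
  "Vsum b \<omega> \<theta> = \<bar>\<Sum>i<b. \<Sum>j<b. hker \<theta> (\<omega> i) (\<omega> (b + j))\<bar>"

text \<open>Keeping \<open>2 * b\<close> coordinates fixes both halves and redraws their copies,
  which sit at positions \<open>i\<close> and \<open>b + j\<close> of the fresh sequence. Averaging
  the second difference over the copies is exactly the projection that defines the degenerate
  kernel.\<close>

lemma integral_H_comb_seq:
  assumes \<omega>: "\<omega> \<in> space PP" and \<theta>: "\<theta> \<in> T" and ij: "i < b" "j < b"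
  shows "(\<integral>\<omega>'. H b (comb_seq (2 * b) \<omega> \<omega>') \<theta> i j \<partial>PP) = hker \<theta> (\<omega> i) (\<omega> (b + j))"
proof -
  have sp: "\<omega> k \<in> space P" for k using \<omega> by (simp add: space_PP)
  have eq: "3 * b + j - 2 * b = b + j" by simp
  have H: "H b (comb_seq (2 * b) \<omega> \<omega>') \<theta> i j = f (\<omega> i) (\<omega> (b + j)) \<theta> - f (\<omega>' i) (\<omega> (b + j)) \<theta>
      - f (\<omega> i) (\<omega>' (b + j)) \<theta> + f (\<omega>' i) (\<omega>' (b + j)) \<theta>" for \<omega>'
    using ij unfolding H_def qd_def comb_seq_def eq by simp
  have m1: "(\<lambda>\<omega>'. f (\<omega>' i) (\<omega> (b + j)) \<theta>) \<in> borel_measurable PP"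
    using measurable_compose[OF _ f_sections_measurable(2)[OF \<theta> sp], of "\<lambda>\<omega>'. \<omega>' i" PP] by simp
  have m2: "(\<lambda>\<omega>'. f (\<omega> i) (\<omega>' (b + j)) \<theta>) \<in> borel_measurable PP"
    using measurable_compose[OF _ f_sections_measurable(1)[OF \<theta> sp], of "\<lambda>\<omega>'. \<omega>' (b + j)" PP] by simp
  have m3: "(\<lambda>\<omega>'. f (\<omega>' i) (\<omega>' (b + j)) \<theta>) \<in> borel_measurable PP"
    by (rule section_measurable[OF f_comp_measurable \<theta>])
  have i1: "integrable PP (\<lambda>\<omega>'. f (\<omega>' i) (\<omega> (b + j)) \<theta>)"
    by (rule seq.P.integrable_bounded[OF m1, where K = B]) (use f_bd sp \<theta> in \<open>auto simp: space_PP\<close>)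
  have i2: "integrable PP (\<lambda>\<omega>'. f (\<omega> i) (\<omega>' (b + j)) \<theta>)"
    by (rule seq.P.integrable_bounded[OF m2, where K = B]) (use f_bd sp \<theta> in \<open>auto simp: space_PP\<close>)
  have i3: "integrable PP (\<lambda>\<omega>'. f (\<omega>' i) (\<omega>' (b + j)) \<theta>)"
    by (rule seq.P.integrable_bounded[OF m3, where K = B]) (use f_bd sp \<theta> in \<open>auto simp: space_PP\<close>)
  have "(\<integral>\<omega>'. H b (comb_seq (2 * b) \<omega> \<omega>') \<theta> i j \<partial>PP) = f (\<omega> i) (\<omega> (b + j)) \<theta>
     - (\<integral>\<omega>'. f (\<omega>' i) (\<omega> (b + j)) \<theta> \<partial>PP) - (\<integral>\<omega>'. f (\<omega> i) (\<omega>' (b + j)) \<theta> \<partial>PP)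
     + (\<integral>\<omega>'. f (\<omega>' i) (\<omega>' (b + j)) \<theta> \<partial>PP)"
    unfolding H using i1 i2 i3 by (simp add: seq.P.prob_space)
  also have "(\<integral>\<omega>'. f (\<omega>' i) (\<omega> (b + j)) \<theta> \<partial>PP) = (\<integral>w. f w (\<omega> (b + j)) \<theta> \<partial>P)"
    by (rule integral_component[OF f_sections_measurable(2)[OF \<theta> sp]])
  also have "(\<integral>\<omega>'. f (\<omega> i) (\<omega>' (b + j)) \<theta> \<partial>PP) = (\<integral>w. f (\<omega> i) w \<theta> \<partial>P)"
    by (rule integral_component[OF f_sections_measurable(1)[OF \<theta> sp]])
  also have "(\<integral>\<omega>'. f (\<omega>' i) (\<omega>' (b + j)) \<theta> \<partial>PP) = (\<integral>v. \<integral>w. f v w \<theta> \<partial>P \<partial>P)"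
    by (rule integral_two_components(1)[OF f_section_measurable[OF \<theta>], of B]) (use f_bd \<theta> ij in auto)
  finally show ?thesis unfolding hker_def by linarith
qed

lemma outer_le_SUP_Vsum:
  assumes "1 \<le> b" "\<nu> \<le> b" and "0 < \<eta>" "\<eta> \<le> 1 / 4"
    and "\<And>\<theta>. \<theta> \<in> T \<Longrightarrow> (\<integral>(x, y). (hker \<theta> x y)\<^sup>2 \<partial>(P \<Otimes>\<^sub>M P)) \<le> \<eta>"
    and "sqrt (real \<nu> / real b) \<le> 2 * \<eta>"
  shows "outer_le PP (\<lambda>\<omega>. SUP \<theta>\<in>T. Vsum b \<omega> \<theta>)
    (sqrt 2 * 7 * (228 * B + 4 / B) * real b * real \<nu> * ln (1 / \<eta>) * sqrt \<eta>)"
proof (rule outer_le_ghost[OF outer_le_SUP_Wsum[OF assms] T(2), where d = "2 * b" and F = "\<lambda>\<theta> \<omega>. Wsum b \<omega> \<theta>" and L = "(real b)\<^sup>2 * (4 * B)"])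
  fix \<theta> assume \<theta>: "\<theta> \<in> T"
  show "(\<lambda>\<omega>. Wsum b \<omega> \<theta>) \<in> borel_measurable PP" by (rule section_measurable[OF Wsum_measurable \<theta>])
  fix \<omega> assume \<omega>: "\<omega> \<in> space PP"
  show "\<bar>Wsum b \<omega> \<theta>\<bar> \<le> (real b)\<^sup>2 * (4 * B)" by (rule Wsum_bd[OF \<omega> \<theta>])
  show "Wsum b \<omega> \<theta> \<le> (SUP \<theta>\<in>T. Wsum b \<omega> \<theta>)"
    by (rule cSUP_upper[OF \<theta> bdd_above_absI[OF Wsum_bd[OF \<omega>]]])
  have Hm: "(\<lambda>\<omega>'. H b (comb_seq (2 * b) \<omega> \<omega>') \<theta> i j) \<in> borel_measurable PP" for i j
    unfolding H_def by (rule measurable_compose[OF measurable_comb_section[OF \<omega>] qd_section_measurable[OF \<theta>]])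
  have Hi: "integrable PP (\<lambda>\<omega>'. H b (comb_seq (2 * b) \<omega> \<omega>') \<theta> i j)" for i j
    by (rule seq.P.integrable_bounded[OF Hm, where K = "4 * B"]) (rule H_bd[OF comb_seq_space[OF \<omega>] \<theta>])
  have "(\<Sum>i<b. \<Sum>j<b. hker \<theta> (\<omega> i) (\<omega> (b + j))) = (\<Sum>i<b. \<Sum>j<b. \<integral>\<omega>'. H b (comb_seq (2 * b) \<omega> \<omega>') \<theta> i j \<partial>PP)"
    by (intro sum.cong refl integral_H_comb_seq[OF \<omega> \<theta>, symmetric]) auto
  also have "\<dots> = (\<integral>\<omega>'. (\<Sum>i<b. \<Sum>j<b. H b (comb_seq (2 * b) \<omega> \<omega>') \<theta> i j) \<partial>PP)"
    using Hi by simp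
  finally have "Vsum b \<omega> \<theta> = \<bar>\<integral>\<omega>'. (\<Sum>i<b. \<Sum>j<b. H b (comb_seq (2 * b) \<omega> \<omega>') \<theta> i j) \<partial>PP\<bar>"
    by (simp add: Vsum_def)
  also have "\<dots> \<le> (\<integral>\<omega>'. Wsum b (comb_seq (2 * b) \<omega> \<omega>') \<theta> \<partial>PP)"
    unfolding Wsum_def by (rule integral_abs_bound)
  finally show "Vsum b \<omega> \<theta> \<le> (\<integral>\<omega>'. Wsum b (comb_seq (2 * b) \<omega> \<omega>') \<theta> \<partial>PP)" .
qed

end

section \<open>From blocks to U-statistics\<close>

text \<open>Double transitivity: after \<open>i\<close> is moved to \<open>k\<close>, the current
  position \<open>j'\<close> of \<open>j\<close> differs from \<open>k\<close>, so moving it to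
  \<open>l\<close> does not disturb the first assignment.\<close>

lemma exists_permutes_pair:
  assumes "i \<in> A" "j \<in> A" "i \<noteq> j" "k \<in> A" "l \<in> A" "k \<noteq> l"
  shows "\<exists>\<tau>. \<tau> permutes A \<and> \<tau> i = k \<and> \<tau> j = l"
proof -
  define j' where "j' = Transposition.transpose i k j"
  have j': "j' \<in> A" "j' \<noteq> k" using assms by (auto simp: j'_def Transposition.transpose_def)
  have "Transposition.transpose j' l \<circ> Transposition.transpose i k permutes A"
    using assms j' by (intro permutes_compose permutes_swap_id) auto
  moreover have "(Transposition.transpose j' l \<circ> Transposition.transpose i k) i = k" using j' assms by (simp add: Transposition.transpose_def)
  moreover have "(Transposition.transpose j' l \<circ> Transposition.transpose i k) j = l" by (simp add: j'_def[symmetric])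
  ultimately show ?thesis by blast
qed

text \<open>By double transitivity the permutation average of \<open>G\<close> is the same for all
  off-diagonal pairs. Summing it over all such pairs and interchanging the sums leaves, for each
  permutation, the full off-diagonal sum.\<close>

lemma sum_off_diagonal_eq_sum_permutations:
  fixes G :: "nat \<Rightarrow> nat \<Rightarrow> real"
  assumes ij: "i0 \<in> {1..n}" "j0 \<in> {1..n}" "i0 \<noteq> j0"
  shows "1 / (real n * (real n - 1)) * (\<Sum>(i, j)\<in>{(i, j). i \<in> {1..n} \<and> j \<in> {1..n} \<and> i \<noteq> j}. G i j)
    = (\<Sum>\<pi> | \<pi> permutes {1..n}. G (\<pi> i0) (\<pi> j0)) / fact n"
proof -
  let ?A = "{1..n}" and ?P = "{\<pi>. \<pi> permutes {1..n}}"
  let ?O = "{(i, j). i \<in> {1..n} \<and> j \<in> {1..n} \<and> i \<noteq> j}"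
  have n: "2 \<le> n" using ij by auto
  have finP: "finite ?P" by (rule finite_permutations) simp
  have cardP: "card ?P = fact n" using card_permutations[of ?A n] by simp
  have "?O = Sigma ?A (\<lambda>i. ?A - {i})" by auto
  then have "card ?O = (\<Sum>i\<in>?A. card (?A - {i}))" by simp
  also have "\<dots> = n * (n - 1)" by simp
  finally have cardO: "real (card ?O) = real n * (real n - 1)" using n by (simp add: of_nat_diff)
  have const: "(\<Sum>\<pi>\<in>?P. G (\<pi> i) (\<pi> j)) = (\<Sum>\<pi>\<in>?P. G (\<pi> i0) (\<pi> j0))" if O: "(i, j) \<in> ?O" for i j
  proof -
    obtain \<tau> where \<tau>: "\<tau> permutes ?A" "\<tau> i0 = i" "\<tau> j0 = j"
      using exists_permutes_pair[OF ij, of i j] O by auto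
    have "(\<Sum>\<pi>\<in>?P. G (\<pi> i0) (\<pi> j0)) = (\<Sum>\<pi>\<in>?P. G ((\<pi> \<circ> inv \<tau> \<circ> \<tau>) i0) ((\<pi> \<circ> inv \<tau> \<circ> \<tau>) j0))"
      using permutes_inv_o[OF \<tau>(1)] by (simp add: comp_assoc)
    also have "\<dots> = (\<Sum>\<pi>\<in>?P. G ((\<pi> \<circ> inv \<tau>) i) ((\<pi> \<circ> inv \<tau>) j))" using \<tau> by simp
    also have "\<dots> = (\<Sum>\<pi>\<in>?P. G (\<pi> i) (\<pi> j))"
      by (rule sum_permutations_compose_right[OF permutes_inv[OF \<tau>(1)], symmetric])
    finally show ?thesis by simp
  qed
  have inv: "(\<Sum>(i, j)\<in>?O. G (\<pi> i) (\<pi> j)) = (\<Sum>(i, j)\<in>?O. G i j)" if "\<pi> \<in> ?P" for \<pi>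
  proof -
    have p: "\<pi> permutes ?A" using that by simp
    show ?thesis
      by (rule sum.reindex_bij_witness[where i = "\<lambda>(i, j). (inv \<pi> i, inv \<pi> j)" and j = "\<lambda>(i, j). (\<pi> i, \<pi> j)"])
        (use permutes_inverses[OF p] permutes_in_image[OF p] permutes_in_image[OF permutes_inv[OF p]]
          permutes_inj[OF p] permutes_inj[OF permutes_inv[OF p]] in \<open>auto dest: injD\<close>)
  qed
  have "real n * (real n - 1) * (\<Sum>\<pi>\<in>?P. G (\<pi> i0) (\<pi> j0)) = (\<Sum>(i, j)\<in>?O. \<Sum>\<pi>\<in>?P. G (\<pi> i0) (\<pi> j0))"
    unfolding cardO[symmetric] by (simp add: case_prod_beta')
  also have "\<dots> = (\<Sum>(i, j)\<in>?O. \<Sum>\<pi>\<in>?P. G (\<pi> i) (\<pi> j))"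
    by (rule sum.cong) (use const in auto)
  also have "\<dots> = (\<Sum>x\<in>?O. \<Sum>\<pi>\<in>?P. G (\<pi> (fst x)) (\<pi> (snd x)))" by (simp add: case_prod_beta')
  also have "\<dots> = (\<Sum>\<pi>\<in>?P. \<Sum>x\<in>?O. G (\<pi> (fst x)) (\<pi> (snd x)))" by (rule sum.swap)
  also have "\<dots> = (\<Sum>\<pi>\<in>?P. \<Sum>(i, j)\<in>?O. G i j)"
    by (rule sum.cong) (use inv in \<open>auto simp: case_prod_beta'\<close>)
  also have "\<dots> = fact n * (\<Sum>(i, j)\<in>?O. G i j)" using cardP by simp
  finally have "real n * (real n - 1) * (\<Sum>\<pi>\<in>?P. G (\<pi> i0) (\<pi> j0)) = fact n * (\<Sum>(i, j)\<in>?O. G i j)" .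
  moreover have "real n * (real n - 1) \<noteq> 0" using n by simp
  ultimately show ?thesis by (simp add: field_simps)
qed

text \<open>Hoeffding's representation with bilinear block sums. A pair with one index from each
  half is always off the diagonal, so each of the \<open>b\<^sup>2\<close> pairs reproduces the
  U-statistic. The successors translate from blocks starting at 0 to a sample starting at 1.\<close>

lemma U_stat_eq_permutation_average:
  fixes g :: "'b \<Rightarrow> 'b \<Rightarrow> real"
  assumes b: "1 \<le> b" "2 * b \<le> n"
  shows "U_stat n z g = (\<Sum>\<pi> | \<pi> permutes {1..n}. \<Sum>i<b. \<Sum>j<b. g (z (\<pi> (Suc i))) (z (\<pi> (Suc (b + j))))) / (fact n * (real b)\<^sup>2)"
proof -
  let ?P = "{\<pi>. \<pi> permutes {1..n}}"
  have U: "U_stat n z g = (\<Sum>\<pi>\<in>?P. g (z (\<pi> (Suc i))) (z (\<pi> (Suc (b + j))))) / fact n" if "i < b" "j < b" for i j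
    unfolding U_stat_def by (rule sum_off_diagonal_eq_sum_permutations) (use that b in auto)
  have "(\<Sum>i<b. \<Sum>j<b. U_stat n z g) = (\<Sum>i<b. \<Sum>j<b. (\<Sum>\<pi>\<in>?P. g (z (\<pi> (Suc i))) (z (\<pi> (Suc (b + j))))) / fact n)"
    by (intro sum.cong refl U) auto
  also have "\<dots> = (\<Sum>i<b. \<Sum>j<b. \<Sum>\<pi>\<in>?P. g (z (\<pi> (Suc i))) (z (\<pi> (Suc (b + j))))) / fact n"
    by (simp add: sum_divide_distrib)
  also have "(\<Sum>i<b. \<Sum>j<b. \<Sum>\<pi>\<in>?P. g (z (\<pi> (Suc i))) (z (\<pi> (Suc (b + j))))) = (\<Sum>\<pi>\<in>?P. \<Sum>i<b. \<Sum>j<b. g (z (\<pi> (Suc i))) (z (\<pi> (Suc (b + j)))))"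
    by (subst sum.swap[of _ "{..<b}" ?P]) (subst sum.swap[of _ "{..<b}" ?P], rule refl)
  finally have "(real b)\<^sup>2 * U_stat n z g = (\<Sum>\<pi>\<in>?P. \<Sum>i<b. \<Sum>j<b. g (z (\<pi> (Suc i))) (z (\<pi> (Suc (b + j))))) / fact n"
    by (simp add: power2_eq_square)
  then show ?thesis using b by (simp add: field_simps)
qed

context vc_kernel
begin

lemma Vsum_bd:
  assumes "\<omega> \<in> space PP" "\<theta> \<in> T"
  shows "\<bar>Vsum b \<omega> \<theta>\<bar> \<le> (real b)\<^sup>2 * (4 * B)"
proof -
  have "\<bar>\<Sum>i<b. \<Sum>j<b. hker \<theta> (\<omega> i) (\<omega> (b + j))\<bar> \<le> (\<Sum>i<b. \<Sum>j<b. \<bar>hker \<theta> (\<omega> i) (\<omega> (b + j))\<bar>)"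
    by (rule order_trans[OF sum_abs]) (intro sum_mono sum_abs)
  also have "\<dots> \<le> (\<Sum>i<b. \<Sum>j<b. 4 * B)"
    using assms by (intro sum_mono hker_bd) (auto simp: space_PP)
  finally show ?thesis by (simp add: Vsum_def power2_eq_square)
qed

lemma outer_le_SUP_U_stat:
  assumes n: "2 \<le> n" and \<eta>: "0 < \<eta>" "\<eta> \<le> 1 / 4" "sqrt (real \<nu> / real n) \<le> \<eta>"
    and e: "\<And>\<theta>. \<theta> \<in> T \<Longrightarrow> (\<integral>(x, y). (hker \<theta> x y)\<^sup>2 \<partial>(P \<Otimes>\<^sub>M P)) \<le> \<eta>"
  shows "outer_le PP (\<lambda>\<omega>. SUP \<theta>\<in>T. \<bar>U_stat n (\<lambda>i. \<omega> (i - 1)) (hker \<theta>)\<bar>)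
    (sqrt 2 * 21 * (228 * B + 4 / B) * ln (1 / \<eta>) * sqrt \<eta> * real \<nu> / real n)"
proof -
  \<comment> \<open>For \<open>n \<ge> 2\<close> one has \<open>n \<le> 3 * b\<close>, with equality
    at \<open>n = 3\<close>. This turns the constant 7 into 21 and gives
    \<open>sqrt (\<nu> / b) \<le> 2 * \<eta>\<close>, which also forces
    \<open>\<nu> \<le> b\<close>.\<close>
  define b where "b = n div 2"
  have b: "1 \<le> b" "2 * b \<le> n" "n \<le> 3 * b" using n unfolding b_def by presburger+
  have nb: "1 / real b \<le> 3 / real n" using b n by (simp add: field_simps)
  have \<nu>b: "sqrt (real \<nu> / real b) \<le> 2 * \<eta>"
  proof -
    have "real \<nu> / real b = real \<nu> * (1 / real b)" by simp
    also have "\<dots> \<le> real \<nu> * (3 / real n)" using nb by (rule mult_left_mono) simp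
    also have "\<dots> = 3 * (real \<nu> / real n)" by simp
    also have "\<dots> \<le> 4 * (real \<nu> / real n)" by (rule mult_right_mono) auto
    finally have "sqrt (real \<nu> / real b) \<le> sqrt (4 * (real \<nu> / real n))" by (rule real_sqrt_le_mono)
    also have "\<dots> = 2 * sqrt (real \<nu> / real n)" unfolding real_sqrt_mult by simp
    finally show ?thesis using \<eta> by simp
  qed
  have "\<nu> \<le> b"
  proof -
    have "sqrt (real \<nu> / real b) \<le> 1" using \<nu>b \<eta>(2) by linarith
    then have "real \<nu> / real b \<le> 1" by (simp only: real_sqrt_le_1_iff)
    then show ?thesis using b by (simp add: field_simps)
  qed
  note V = outer_le_SUP_Vsum[OF b(1) \<open>\<nu> \<le> b\<close> \<eta>(1,2) e \<nu>b]
  let ?P = "{\<pi>. \<pi> permutes {1..n}}"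
  define c where "c = sqrt 2 * 7 * (228 * B + 4 / B) * real b * real \<nu> * ln (1 / \<eta>) * sqrt \<eta>"
  have finP: "finite ?P" by (rule finite_permutations) simp
  have cardP: "card ?P = fact n" using card_permutations[of "{1..n}" n] by simp
  define k where "k = 1 / (fact n * (real b)\<^sup>2)"
  have k: "0 \<le> k" by (simp add: k_def)
  \<comment> \<open>A permutation of \<open>{1..n}\<close> fixes 0 and all larger numbers, so
    positive arguments have positive values and truncated subtraction of 1 loses nothing. The
    shifted map is thus injective on all naturals.\<close>
  have inj: "inj (\<lambda>i. \<pi> (Suc i) - 1)" if "\<pi> \<in> ?P" for \<pi>
  proof (rule injI)
    fix x y assume eq: "\<pi> (Suc x) - 1 = \<pi> (Suc y) - 1"
    have p: "\<pi> permutes {1..n}" using that by simp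
    have "1 \<le> \<pi> (Suc i)" for i
      using permutes_in_image[OF p, of "Suc i"] permutes_not_in[OF p, of "Suc i"] by (cases "Suc i \<in> {1..n}") auto
    then have "\<pi> (Suc x) = \<pi> (Suc y)" using eq by (metis diff_add_inverse2 le_add_diff_inverse2 add.commute)
    then show "x = y" using permutes_inj[OF p] by (simp add: inj_eq)
  qed
  have "outer_le PP (\<lambda>\<omega>. \<Sum>\<pi>\<in>?P. k * (SUP \<theta>\<in>T. Vsum b (\<lambda>i. \<omega> (\<pi> (Suc i) - 1)) \<theta>)) (\<Sum>\<pi>\<in>?P. k * c)"
    unfolding c_def
    by (intro seq.P.outer_le_sum[OF finP] seq.P.outer_le_cmult[OF _ k] outer_le_reindex[OF inj V])
  then show ?thesis
  proof (rule outer_le_mono)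
    fix \<omega> assume \<omega>: "\<omega> \<in> space PP"
    show "(SUP \<theta>\<in>T. \<bar>U_stat n (\<lambda>i. \<omega> (i - 1)) (hker \<theta>)\<bar>) \<le> (\<Sum>\<pi>\<in>?P. k * (SUP \<theta>\<in>T. Vsum b (\<lambda>i. \<omega> (\<pi> (Suc i) - 1)) \<theta>))"
    proof (rule cSUP_least[OF T(2)])
      fix \<theta> assume \<theta>: "\<theta> \<in> T"
      have eq: "U_stat n (\<lambda>i. \<omega> (i - 1)) (hker \<theta>) = (\<Sum>\<pi>\<in>?P. k * (\<Sum>i<b. \<Sum>j<b. hker \<theta> (\<omega> (\<pi> (Suc i) - 1)) (\<omega> (\<pi> (Suc (b + j)) - 1))))"
        unfolding U_stat_eq_permutation_average[OF b(1,2)] k_def sum_distrib_left[symmetric] by simp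
      have "\<bar>U_stat n (\<lambda>i. \<omega> (i - 1)) (hker \<theta>)\<bar> \<le> (\<Sum>\<pi>\<in>?P. \<bar>k * (\<Sum>i<b. \<Sum>j<b. hker \<theta> (\<omega> (\<pi> (Suc i) - 1)) (\<omega> (\<pi> (Suc (b + j)) - 1)))\<bar>)"
        unfolding eq by (rule sum_abs)
      also have "\<dots> = (\<Sum>\<pi>\<in>?P. k * Vsum b (\<lambda>i. \<omega> (\<pi> (Suc i) - 1)) \<theta>)"
        unfolding Vsum_def abs_mult abs_of_nonneg[OF k] by (rule refl)
      also have "\<dots> \<le> (\<Sum>\<pi>\<in>?P. k * (SUP \<theta>\<in>T. Vsum b (\<lambda>i. \<omega> (\<pi> (Suc i) - 1)) \<theta>))"
      proof (intro sum_mono mult_left_mono[OF _ k] cSUP_upper[OF \<theta>] bdd_above_absI)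
        fix \<pi> \<theta> assume "\<theta> \<in> T"
        then show "\<bar>Vsum b (\<lambda>i. \<omega> (\<pi> (Suc i) - 1)) \<theta>\<bar> \<le> (real b)\<^sup>2 * (4 * B)"
          using \<omega> by (intro Vsum_bd) (auto simp: space_PP)
      qed
      finally show "\<bar>U_stat n (\<lambda>i. \<omega> (i - 1)) (hker \<theta>)\<bar> \<le> (\<Sum>\<pi>\<in>?P. k * (SUP \<theta>\<in>T. Vsum b (\<lambda>i. \<omega> (\<pi> (Suc i) - 1)) \<theta>))" .
    qed
  next
    define c0 where "c0 = sqrt 2 * 7 * (228 * B + 4 / B) * real \<nu> * ln (1 / \<eta>) * sqrt \<eta>"
    have "0 \<le> ln (1 / \<eta>)" using \<eta> by simp
    then have c0: "0 \<le> c0" using B \<eta> by (simp add: c0_def)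
    have "(\<Sum>\<pi>\<in>?P. k * c) = real (card ?P) * (k * c)" by (rule sum_constant)
    also have "\<dots> = fact n * (k * c)" unfolding cardP by simp
    also have "\<dots> = c0 * (1 / real b)"
      using b by (simp add: k_def c_def c0_def power2_eq_square)
    also have "\<dots> \<le> c0 * (3 / real n)" using nb c0 by (rule mult_left_mono)
    also have "\<dots> = sqrt 2 * 21 * (228 * B + 4 / B) * ln (1 / \<eta>) * sqrt \<eta> * real \<nu> / real n"
      by (simp add: c0_def)
    finally show "(\<Sum>\<pi>\<in>?P. k * c) \<le> sqrt 2 * 21 * (228 * B + 4 / B) * ln (1 / \<eta>) * sqrt \<eta> * real \<nu> / real n" .
  qed
qed

lemma hker_joint_measurable:
  "(\<lambda>(x, y, \<theta>). hker \<theta> x y) \<in> borel_measurable (P \<Otimes>\<^sub>M P \<Otimes>\<^sub>M euclid p)"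
proof -
  have m1: "(\<lambda>z. (fst (fst z), snd z, snd (fst z))) \<in> measurable ((P \<Otimes>\<^sub>M euclid p) \<Otimes>\<^sub>M P) (P \<Otimes>\<^sub>M P \<Otimes>\<^sub>M euclid p)"
    by measurable
  have 1: "(\<lambda>z. \<integral>w. f (fst z) w (snd z) \<partial>P) \<in> borel_measurable (P \<Otimes>\<^sub>M euclid p)"
    by (rule P.borel_measurable_lebesgue_integral)
      (use measurable_compose[OF m1 f_meas] in \<open>simp add: case_prod_beta'\<close>)
  have m2: "(\<lambda>z. (snd z, fst (fst z), snd (fst z))) \<in> measurable ((P \<Otimes>\<^sub>M euclid p) \<Otimes>\<^sub>M P) (P \<Otimes>\<^sub>M P \<Otimes>\<^sub>M euclid p)"
    by measurable
  have 2: "(\<lambda>z. \<integral>w. f w (fst z) (snd z) \<partial>P) \<in> borel_measurable (P \<Otimes>\<^sub>M euclid p)"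
    by (rule P.borel_measurable_lebesgue_integral)
      (use measurable_compose[OF m2 f_meas] in \<open>simp add: case_prod_beta'\<close>)
  have 3: "(\<lambda>\<theta>. \<integral>v. \<integral>w. f v w \<theta> \<partial>P \<partial>P) \<in> borel_measurable (euclid p)"
  proof (rule P.borel_measurable_lebesgue_integral)
    have "(\<lambda>z. (snd z, fst z)) \<in> measurable (euclid p \<Otimes>\<^sub>M P) (P \<Otimes>\<^sub>M euclid p)" by measurable
    from measurable_compose[OF this 1]
    show "(\<lambda>(\<theta>, v). \<integral>w. f v w \<theta> \<partial>P) \<in> borel_measurable (euclid p \<Otimes>\<^sub>M P)"
      by (simp add: case_prod_beta')
  qed
  have p1: "(\<lambda>z. (fst z, snd (snd z))) \<in> measurable (P \<Otimes>\<^sub>M P \<Otimes>\<^sub>M euclid p) (P \<Otimes>\<^sub>M euclid p)" by measurable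
  have p2: "(\<lambda>z. snd (snd z)) \<in> measurable (P \<Otimes>\<^sub>M P \<Otimes>\<^sub>M euclid p) (euclid p)" by measurable
  show ?thesis
    using f_meas measurable_compose[OF p1 1] measurable_compose[OF measurable_snd 2, of P] measurable_compose[OF p2 3]
    unfolding hker_def by (simp add: case_prod_beta')
qed

end

section \<open>Transfer from sequences to a finite sample\<close>

context iid_sequence
begin

text \<open>
  A majorant may depend on the whole sequence; averaging it over the coordinates beyond the first
  \<open>n\<close> makes it a function of a sample of size \<open>n\<close>.
\<close>

lemma integral_sample_average:
  fixes g :: "(nat \<Rightarrow> 'z) \<Rightarrow> real"
  assumes D: "distr M (Pi\<^sub>M {..<n} (\<lambda>_. P)) (\<lambda>\<omega>. \<lambda>i\<in>{..<n}. X i \<omega>) = Pi\<^sub>M {..<n} (\<lambda>_. P)"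
    and X: "\<And>i. i < n \<Longrightarrow> X i \<in> measurable M P"
    and g: "g \<in> borel_measurable PP" "\<And>\<omega>. \<omega> \<in> space PP \<Longrightarrow> \<bar>g \<omega>\<bar> \<le> K"
  shows "(\<lambda>\<omega>. \<integral>\<omega>'. g (comb_seq n (\<lambda>i. X i \<omega>) \<omega>') \<partial>PP) \<in> borel_measurable M"
    and "(\<integral>\<omega>. \<integral>\<omega>'. g (comb_seq n (\<lambda>i. X i \<omega>) \<omega>') \<partial>PP \<partial>M) = (\<integral>\<omega>. g \<omega> \<partial>PP)"
proof -
  let ?J = "Pi\<^sub>M {..<n} (\<lambda>_. P)"
  let ?\<Phi> = "\<lambda>\<omega>. \<lambda>i\<in>{..<n}. X i \<omega>"
  define g3 where "g3 x = (\<integral>\<omega>'. g (comb_seq n x \<omega>') \<partial>PP)" for x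
  have comb: "(\<lambda>(x, \<omega>'). comb_seq n x \<omega>') \<in> measurable (?J \<Otimes>\<^sub>M PP) PP"
  proof (rule measurable_PiM_single')
    show "(\<lambda>z. (case z of (x, \<omega>') \<Rightarrow> comb_seq n x \<omega>') j) \<in> measurable (?J \<Otimes>\<^sub>M PP) P" for j
    proof (cases "j < n")
      case True
      then have "(\<lambda>z. fst z j) \<in> measurable (?J \<Otimes>\<^sub>M PP) P" by simp
      then show ?thesis using True by (simp add: case_prod_beta' comb_seq_def)
    next
      case False
      then show ?thesis by (simp add: case_prod_beta' comb_seq_def)
    qed
    show "(\<lambda>(x, \<omega>'). comb_seq n x \<omega>') \<in> space (?J \<Otimes>\<^sub>M PP) \<rightarrow> (\<Pi>\<^sub>E i\<in>UNIV. space P)"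
      by (auto simp: space_pair_measure space_PiM comb_seq_def PiE_iff)
  qed
  have g3m: "g3 \<in> borel_measurable ?J"
    unfolding g3_def
    by (rule seq.P.borel_measurable_lebesgue_integral)
      (use measurable_compose[OF comb g(1)] in \<open>simp add: case_prod_beta'\<close>)
  have restr: "comb_seq n (restrict x {..<n}) \<omega>' = comb_seq n x \<omega>'" for x \<omega>'
    by (auto simp: comb_seq_def)
  have \<Phi>: "?\<Phi> \<in> measurable M ?J" using X by (intro measurable_restrict) auto
  have g3\<Phi>: "g3 (?\<Phi> \<omega>) = (\<integral>\<omega>'. g (comb_seq n (\<lambda>i. X i \<omega>) \<omega>') \<partial>PP)" for \<omega>
    unfolding g3_def using restr[of "\<lambda>i. X i \<omega>"] by simp
  show "(\<lambda>\<omega>. \<integral>\<omega>'. g (comb_seq n (\<lambda>i. X i \<omega>) \<omega>') \<partial>PP) \<in> borel_measurable M"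
    using measurable_compose[OF \<Phi> g3m] unfolding g3\<Phi> .
  have R: "(\<lambda>\<omega>. restrict \<omega> {..<n}) \<in> measurable PP ?J" by (intro measurable_restrict) auto
  have "distr PP ?J (\<lambda>\<omega>. restrict \<omega> {..<n}) = ?J"
    using distr_PiM_reindex[of UNIV "\<lambda>_. P" "\<lambda>i. i" "{..<n}"] prob_space_P by simp
  then have "(\<integral>\<omega>. g3 \<omega> \<partial>?J) = (\<integral>\<omega>. g3 (restrict \<omega> {..<n}) \<partial>PP)"
    using integral_distr[OF R g3m] by simp
  also have "\<dots> = (\<integral>\<omega>. g \<omega> \<partial>PP)"
    unfolding g3_def restr by (rule integral_comb_seq(2)[OF g])
  finally have "(\<integral>\<omega>. g \<omega> \<partial>PP) = (\<integral>\<omega>. g3 \<omega> \<partial>?J)" by simp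
  also have "\<dots> = (\<integral>\<omega>. g3 (?\<Phi> \<omega>) \<partial>M)" using integral_distr[OF \<Phi> g3m] D by simp
  finally show "(\<integral>\<omega>. \<integral>\<omega>'. g (comb_seq n (\<lambda>i. X i \<omega>) \<omega>') \<partial>PP \<partial>M) = (\<integral>\<omega>. g \<omega> \<partial>PP)"
    unfolding g3\<Phi> by simp
qed

lemma comb_seq_sample_space:
  assumes "\<And>i. i < n \<Longrightarrow> X i \<in> measurable M P" "\<omega> \<in> space M" "\<omega>' \<in> space PP"
  shows "comb_seq n (\<lambda>i. X i \<omega>) \<omega>' \<in> space PP"
  unfolding space_PP comb_seq_def using measurable_space[OF assms(1) assms(2)] assms(3) by (auto simp: space_PP)

lemma outer_le_transfer:
  assumes D: "distr M (Pi\<^sub>M {..<n} (\<lambda>_. P)) (\<lambda>\<omega>. \<lambda>i\<in>{..<n}. X i \<omega>) = Pi\<^sub>M {..<n} (\<lambda>_. P)"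
    and X: "\<And>i. i < n \<Longrightarrow> X i \<in> measurable M P"
    and dep: "\<And>\<omega> \<omega>'. (\<And>i. i < n \<Longrightarrow> \<omega> i = \<omega>' i) \<Longrightarrow> Y \<omega> = Y \<omega>'"
    and Y: "outer_le PP Y c"
  shows "outer_le M (\<lambda>\<omega>. Y (\<lambda>i. X i \<omega>)) c"
proof -
  obtain g K where g: "g \<in> borel_measurable PP" "\<And>\<omega>. \<omega> \<in> space PP \<Longrightarrow> \<bar>g \<omega>\<bar> \<le> K"
    "\<And>\<omega>. \<omega> \<in> space PP \<Longrightarrow> Y \<omega> \<le> g \<omega>" "(\<integral>\<omega>. g \<omega> \<partial>PP) \<le> c"
    using Y by (rule outer_leE) blast
  note av = integral_sample_average[where X = X, OF D X g(1,2)]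
  show ?thesis
  proof (rule outer_leI[where g = "\<lambda>\<omega>. \<integral>\<omega>'. g (comb_seq n (\<lambda>i. X i \<omega>) \<omega>') \<partial>PP" and K = K])
    show "(\<lambda>\<omega>. \<integral>\<omega>'. g (comb_seq n (\<lambda>i. X i \<omega>) \<omega>') \<partial>PP) \<in> borel_measurable M" by (rule av(1))
    show "(\<integral>\<omega>. \<integral>\<omega>'. g (comb_seq n (\<lambda>i. X i \<omega>) \<omega>') \<partial>PP \<partial>M) \<le> c" using av(2) g(4) by simp
    fix \<omega> assume \<omega>: "\<omega> \<in> space M"
    have sp: "comb_seq n (\<lambda>i. X i \<omega>) \<omega>' \<in> space PP" if "\<omega>' \<in> space PP" for \<omega>'
      by (rule comb_seq_sample_space[OF X \<omega> that])
    have "(\<lambda>\<omega>'. comb_seq n (\<lambda>i. X i \<omega>) \<omega>') \<in> measurable PP PP"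
    proof (rule measurable_PiM_single')
      show "(\<lambda>\<omega>'. comb_seq n (\<lambda>i. X i \<omega>) \<omega>' j) \<in> measurable PP P" for j
        using measurable_space[OF X \<omega>] by (cases "j < n") (auto simp: comb_seq_def)
    qed (use sp in \<open>auto simp: space_PiM\<close>)
    then have gm: "(\<lambda>\<omega>'. g (comb_seq n (\<lambda>i. X i \<omega>) \<omega>')) \<in> borel_measurable PP"
      by (rule measurable_compose[OF _ g(1)])
    show "\<bar>\<integral>\<omega>'. g (comb_seq n (\<lambda>i. X i \<omega>) \<omega>') \<partial>PP\<bar> \<le> K"
      by (rule abs_integral_le_bound[OF gm]) (use g(2) sp in auto)
    have "Y (\<lambda>i. X i \<omega>) = (\<integral>\<omega>'. Y (\<lambda>i. X i \<omega>) \<partial>PP)" by (simp add: seq.P.prob_space)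
    also have "\<dots> \<le> (\<integral>\<omega>'. g (comb_seq n (\<lambda>i. X i \<omega>) \<omega>') \<partial>PP)"
    proof (rule integral_mono)
      show "integrable PP (\<lambda>\<omega>'. g (comb_seq n (\<lambda>i. X i \<omega>) \<omega>'))"
        by (rule seq.P.integrable_bounded[OF gm, where K = K]) (use g(2) sp in auto)
      fix \<omega>' assume \<omega>': "\<omega>' \<in> space PP"
      have "Y (\<lambda>i. X i \<omega>) = Y (comb_seq n (\<lambda>i. X i \<omega>) \<omega>')" by (rule dep) (simp add: comb_seq_def)
      also have "\<dots> \<le> g (comb_seq n (\<lambda>i. X i \<omega>) \<omega>')" by (rule g(3)[OF sp[OF \<omega>']])
      finally show "Y (\<lambda>i. X i \<omega>) \<le> g (comb_seq n (\<lambda>i. X i \<omega>) \<omega>')" .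
    qed simp
    finally show "Y (\<lambda>i. X i \<omega>) \<le> (\<integral>\<omega>'. g (comb_seq n (\<lambda>i. X i \<omega>) \<omega>') \<partial>PP)" .
  qed
qed

lemma integral_transfer_pair:
  fixes g :: "'z \<Rightarrow> 'z \<Rightarrow> real" and n i j :: nat
  assumes D: "distr M (Pi\<^sub>M {..<n} (\<lambda>_. P)) (\<lambda>\<omega>. \<lambda>i\<in>{..<n}. X i \<omega>) = Pi\<^sub>M {..<n} (\<lambda>_. P)"
    and X: "\<And>i. i < n \<Longrightarrow> X i \<in> measurable M P"
    and g: "(\<lambda>(x, y). g x y) \<in> borel_measurable (P \<Otimes>\<^sub>M P)"
      "\<And>x y. x \<in> space P \<Longrightarrow> y \<in> space P \<Longrightarrow> \<bar>g x y\<bar> \<le> K"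
    and ij: "i \<noteq> j" "i < n" "j < n"
  shows "(\<integral>\<omega>. g (X i \<omega>) (X j \<omega>) \<partial>M) = (\<integral>x. \<integral>y. g x y \<partial>P \<partial>P)"
proof -
  have gm: "(\<lambda>\<omega>. g (\<omega> i) (\<omega> j)) \<in> borel_measurable PP"
    using measurable_compose[OF _ g(1), of "\<lambda>\<omega>. (\<omega> i, \<omega> j)" PP] by simp
  have gb: "\<bar>g (\<omega> i) (\<omega> j)\<bar> \<le> K" if "\<omega> \<in> space PP" for \<omega> using that g(2) by (simp add: space_PP)
  have "(\<integral>\<omega>. g (X i \<omega>) (X j \<omega>) \<partial>M) = (\<integral>\<omega>. \<integral>\<omega>'. g (comb_seq n (\<lambda>i. X i \<omega>) \<omega>' i) (comb_seq n (\<lambda>i. X i \<omega>) \<omega>' j) \<partial>PP \<partial>M)"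
    using ij by (simp add: comb_seq_def seq.P.prob_space)
  also have "\<dots> = (\<integral>\<omega>. g (\<omega> i) (\<omega> j) \<partial>PP)"
    by (rule integral_sample_average(2)[where X = X, OF D X gm gb])
  also have "\<dots> = (\<integral>x. \<integral>y. g x y \<partial>P \<partial>P)" by (rule integral_two_components(1)[OF g ij(1)])
  finally show ?thesis .
qed

end

section \<open>Triangular arrays\<close>

lemma param_ball_sets:
  assumes "\<Theta> \<in> sets (euclid p)"
  shows "param_ball p \<Theta> \<theta>0 r \<in> sets (euclid p)"
proof -
  have comp: "(\<lambda>\<theta>. \<theta> i) \<in> borel_measurable (euclid p)" if "i \<in> {..<p}" for i
    unfolding euclid_def by (rule measurable_component_singleton[OF that])
  have "(\<lambda>\<theta>. \<Sum>i<p. (\<theta> i - \<theta>0 i)\<^sup>2) \<in> borel_measurable (euclid p)"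
    by (intro borel_measurable_sum borel_measurable_power borel_measurable_diff borel_measurable_const comp)
  then have "(\<lambda>\<theta>. L2_set (\<lambda>i. \<theta> i - \<theta>0 i) {..<p}) \<in> borel_measurable (euclid p)"
    unfolding L2_set_def by simp
  then have "{\<theta> \<in> space (euclid p). L2_set (\<lambda>i. \<theta> i - \<theta>0 i) {..<p} \<le> r} \<in> sets (euclid p)"
    by (rule borel_measurable_le[OF _ borel_measurable_const])
  then have "\<Theta> \<inter> {\<theta> \<in> space (euclid p). L2_set (\<lambda>i. \<theta> i - \<theta>0 i) {..<p} \<le> r} \<in> sets (euclid p)"
    using assms by (intro sets.Int)
  also have "\<Theta> \<inter> {\<theta> \<in> space (euclid p). L2_set (\<lambda>i. \<theta> i - \<theta>0 i) {..<p} \<le> r} = param_ball p \<Theta> \<theta>0 r"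
    using sets.sets_into_space[OF assms] by (auto simp: param_ball_def)
  finally show ?thesis .
qed

text \<open>Measurability is assumed only over \<open>restrict_space (euclid p) \<Theta>\<close>.
  Extension by 0 off the Borel set \<open>\<Theta>\<close> gives a function on the full product, as
  required by the projection argument.\<close>

lemma measurable_class_extend:
  assumes "measurable_class m p \<Theta> f"
  shows "(\<lambda>(x, y, \<theta>). if \<theta> \<in> \<Theta> then f x y \<theta> else 0) \<in> borel_measurable (euclid m \<Otimes>\<^sub>M euclid m \<Otimes>\<^sub>M euclid p)"
proof -
  let ?N = "euclid m \<Otimes>\<^sub>M euclid m \<Otimes>\<^sub>M euclid p"
  let ?\<Omega> = "{z. snd (snd z) \<in> \<Theta>}"
  have \<Theta>: "\<Theta> \<in> sets (euclid p)" using assms by (simp add: measurable_class_def)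
  have f: "(\<lambda>(z1, z2, \<theta>). f z1 z2 \<theta>) \<in> borel_measurable (euclid m \<Otimes>\<^sub>M euclid m \<Otimes>\<^sub>M restrict_space (euclid p) \<Theta>)"
    using assms by (simp add: measurable_class_def)
  have s: "(\<lambda>z. snd (snd z)) \<in> measurable ?N (euclid p)" by measurable
  have \<Omega>: "?\<Omega> \<inter> space ?N \<in> sets ?N"
    using measurable_sets[OF s \<Theta>] by (simp add: vimage_def)
  have "(\<lambda>z. (fst z, fst (snd z), snd (snd z))) \<in> measurable (restrict_space ?N ?\<Omega>)
      (euclid m \<Otimes>\<^sub>M euclid m \<Otimes>\<^sub>M restrict_space (euclid p) \<Theta>)"
  proof (intro measurable_Pair)
    show "fst \<in> measurable (restrict_space ?N ?\<Omega>) (euclid m)"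
      by (rule measurable_restrict_space1) measurable
    show "(\<lambda>z. fst (snd z)) \<in> measurable (restrict_space ?N ?\<Omega>) (euclid m)"
      by (rule measurable_restrict_space1) measurable
    show "(\<lambda>z. snd (snd z)) \<in> measurable (restrict_space ?N ?\<Omega>) (restrict_space (euclid p) \<Theta>)"
      by (rule measurable_restrict_space2[OF _ measurable_restrict_space1[OF s]])
        (auto simp: space_restrict_space)
  qed
  from measurable_compose[OF this f]
  have "(\<lambda>z. f (fst z) (fst (snd z)) (snd (snd z))) \<in> borel_measurable (restrict_space ?N ?\<Omega>)"
    by (simp add: case_prod_beta')
  then have "(\<lambda>z. if z \<in> ?\<Omega> then f (fst z) (fst (snd z)) (snd (snd z)) else 0) \<in> borel_measurable ?N"
    using measurable_restrict_space_iff[OF \<Omega>, of 0 borel "\<lambda>z. f (fst z) (fst (snd z)) (snd (snd z))"] by simp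
  then show ?thesis by (simp add: case_prod_beta')
qed

text \<open>Independence is rewritten as a product law and the sample \<open>1, \<dots>, n\<close>
  is shifted to coordinates \<open>0, \<dots>, n - 1\<close>. For \<open>n = 0\<close> the predicate
  \<open>iid_sample\<close> leaves \<open>P\<close> unconstrained, hence
  \<open>1 \<le> n\<close>.\<close>

lemma iid_sampleD:
  assumes "iid_sample n m M P Z" "1 \<le> n"
  shows "prob_space M" and "\<And>i. i \<in> {1..n} \<Longrightarrow> Z i \<in> measurable M (euclid m)"
    and "sets P = sets (euclid m)" and "prob_space P"
    and "\<And>i. i < n \<Longrightarrow> Z (Suc i) \<in> measurable M P"
    and "distr M (Pi\<^sub>M {..<n} (\<lambda>_. P)) (\<lambda>\<omega>. \<lambda>i\<in>{..<n}. Z (Suc i) \<omega>) = Pi\<^sub>M {..<n} (\<lambda>_. P)"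
proof -
  show pM: "prob_space M" using assms by (simp add: iid_sample_def)
  interpret M: prob_space M by fact
  have ind: "M.indep_vars (\<lambda>_. euclid m) Z {1..n}" and D: "\<And>i. i \<in> {1..n} \<Longrightarrow> distr M (euclid m) (Z i) = P"
    using assms by (auto simp: iid_sample_def)
  show Zm: "Z i \<in> measurable M (euclid m)" if "i \<in> {1..n}" for i
    using ind that unfolding M.indep_vars_def by blast
  have 1: "1 \<in> {1..n}" using assms by simp
  show sets: "sets P = sets (euclid m)" using D[OF 1] by auto
  show pP: "prob_space P" using M.prob_space_distr[OF Zm[OF 1]] D[OF 1] by simp
  show "Z (Suc i) \<in> measurable M P" if "i < n" for i
    using Zm[of "Suc i"] that measurable_cong_sets[OF refl sets] by auto
  let ?N = "Pi\<^sub>M {1..n} (\<lambda>_. P)" and ?\<Phi> = "\<lambda>\<omega>. \<lambda>i\<in>{1..n}. Z i \<omega>"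
  have "{1..n} \<noteq> {}" using assms by auto
  then have "distr M (\<Pi>\<^sub>M i\<in>{1..n}. euclid m) ?\<Phi> = (\<Pi>\<^sub>M i\<in>{1..n}. distr M (euclid m) (Z i))"
    using ind Zm by (subst (asm) M.indep_vars_iff_distr_eq_PiM') auto
  also have "\<dots> = ?N" by (rule PiM_cong) (use D in auto)
  finally have 1: "distr M (\<Pi>\<^sub>M i\<in>{1..n}. euclid m) ?\<Phi> = ?N" .
  have sN: "sets ?N = sets (\<Pi>\<^sub>M i\<in>{1..n}. euclid m)" by (intro sets_PiM_cong refl sets)
  have 2: "distr M ?N ?\<Phi> = ?N"
    using distr_cong[OF refl sN refl, of M ?\<Phi>] 1 by simp
  have \<Phi>: "?\<Phi> \<in> measurable M ?N"
    using Zm measurable_cong_sets[OF refl sets, of M] by (intro measurable_restrict) auto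
  have S: "(\<lambda>\<omega>. \<lambda>i\<in>{..<n}. \<omega> (Suc i)) \<in> measurable ?N (Pi\<^sub>M {..<n} (\<lambda>_. P))"
    by (intro measurable_restrict measurable_component_singleton) auto
  have "Pi\<^sub>M {..<n} (\<lambda>_. P) = distr ?N (Pi\<^sub>M {..<n} (\<lambda>_. P)) (\<lambda>\<omega>. \<lambda>i\<in>{..<n}. \<omega> (Suc i))"
    using distr_PiM_reindex[of "{1..n}" "\<lambda>_. P" Suc "{..<n}"] pP by auto
  also have "\<dots> = distr (distr M ?N ?\<Phi>) (Pi\<^sub>M {..<n} (\<lambda>_. P)) (\<lambda>\<omega>. \<lambda>i\<in>{..<n}. \<omega> (Suc i))"
    unfolding 2 ..
  also have "\<dots> = distr M (Pi\<^sub>M {..<n} (\<lambda>_. P)) ((\<lambda>\<omega>. \<lambda>i\<in>{..<n}. \<omega> (Suc i)) \<circ> ?\<Phi>)"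
    by (rule distr_distr[OF S \<Phi>])
  also have "(\<lambda>\<omega>. \<lambda>i\<in>{..<n}. \<omega> (Suc i)) \<circ> ?\<Phi> = (\<lambda>\<omega>. \<lambda>i\<in>{..<n}. Z (Suc i) \<omega>)"
    by (auto simp: fun_eq_iff)
  finally show "distr M (Pi\<^sub>M {..<n} (\<lambda>_. P)) (\<lambda>\<omega>. \<lambda>i\<in>{..<n}. Z (Suc i) \<omega>) = Pi\<^sub>M {..<n} (\<lambda>_. P)" ..
qed

lemma U_stat_cong:
  assumes "\<And>i. i \<in> {1..n} \<Longrightarrow> z i = z' i"
  shows "U_stat n z g = U_stat n z' g"
  unfolding U_stat_def by (intro arg_cong2[where f = "(*)"] sum.cong refl) (use assms in auto)

text \<open>A single row is an instance of \<open>vc_kernel\<close> over the ball. The law of the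
  sample identifies \<open>Gamma_obj\<close> with a double integral and hence
  \<open>degenerate_kernel\<close> with \<open>hker\<close>, after which the sequence bound
  transfers to \<open>M\<close>.\<close>

lemma sup_U_process_bound:
  fixes B :: real
  assumes n: "2 \<le> n" and iid: "iid_sample n m M P Z" and mc: "measurable_class m p \<Theta> f"
    and \<theta>0: "\<theta>0 \<in> \<Theta>" and r: "0 \<le> r" and B: "0 < B"
    and fB: "\<And>\<theta> x y. \<theta> \<in> \<Theta> \<Longrightarrow> x \<in> space (euclid m) \<Longrightarrow> y \<in> space (euclid m) \<Longrightarrow> \<bar>f x y \<theta>\<bar> \<le> B"
    and vc: "VC_subgraph_class m \<Theta> f \<nu>" and \<nu>: "1 \<le> \<nu>"
    and \<eta>: "0 < \<eta>" "\<eta> \<le> 1 / 4" "sqrt (real \<nu> / real n) \<le> \<eta>"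
    and sm: "(SUP \<theta>\<in>param_ball p \<Theta> \<theta>0 r. second_moment n M Z P f \<theta>) \<le> \<eta>"
  defines "S \<equiv> sup_U_process n M Z P f (param_ball p \<Theta> \<theta>0 r)"
  shows "S \<in> borel_measurable (completion M) \<and> (\<forall>\<omega>\<in>space M. 0 \<le> S \<omega>) \<and> integrable (completion M) S \<and>
    (\<integral>\<omega>. S \<omega> \<partial>completion M) \<le> sqrt 2 * 21 * (228 * B + 4 / B) * ln (1 / \<eta>) * sqrt \<eta> * real \<nu> / real n"
proof -
  have "1 \<le> n" using n by simp
  note iidD = iid_sampleD[OF iid this]
  define T where "T = param_ball p \<Theta> \<theta>0 r"
  define f0 where "f0 x y \<theta> = (if \<theta> \<in> \<Theta> then f x y \<theta> else 0)" for x y \<theta>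
  have \<Theta>: "\<Theta> \<in> sets (euclid p)" using mc by (simp add: measurable_class_def)
  have spP: "space P = space (euclid m)" by (rule sets_eq_imp_space_eq[OF iidD(3)])
  have T\<Theta>: "T \<subseteq> \<Theta>" by (auto simp: T_def param_ball_def)
  have f0T: "f0 x y \<theta> = f x y \<theta>" if "\<theta> \<in> T" for x y \<theta> using that T\<Theta> by (auto simp: f0_def)
  interpret M: prob_space M by (rule iidD(1))
  interpret K: vc_kernel P p T f0 B \<nu>
  proof (intro vc_kernel.intro iid_sequence.intro vc_kernel_axioms.intro)
    show "prob_space P" by (rule iidD(4))
    show "T \<in> sets (euclid p)" unfolding T_def by (rule param_ball_sets[OF \<Theta>])
    show "T \<noteq> {}" using \<theta>0 r by (auto simp: T_def param_ball_def L2_set_def)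
    have "sets (P \<Otimes>\<^sub>M P \<Otimes>\<^sub>M euclid p) = sets (euclid m \<Otimes>\<^sub>M euclid m \<Otimes>\<^sub>M euclid p)"
      by (intro sets_pair_measure_cong iidD(3) refl)
    then show "(\<lambda>(x, y, \<theta>). f0 x y \<theta>) \<in> borel_measurable (P \<Otimes>\<^sub>M P \<Otimes>\<^sub>M euclid p)"
      using measurable_class_extend[OF mc] measurable_cong_sets[OF _ refl] unfolding f0_def by blast
    show "\<bar>f0 x y \<theta>\<bar> \<le> B" if "x \<in> space P" "y \<in> space P" "\<theta> \<in> T" for x y \<theta>
      using fB[of \<theta> x y] that T\<Theta> f0T by (auto simp: spP)
    show "vc_le ((\<lambda>\<theta>. subgraph (space P \<times> space P) (\<lambda>(x, y). f0 x y \<theta>)) ` T) \<nu>"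
    proof (rule vc_le_mono[OF vc_dim_imp_vc_le])
      show "vc_dim ((\<lambda>\<theta>. subgraph (space (euclid m) \<times> space (euclid m)) (\<lambda>(z1, z2). f z1 z2 \<theta>)) ` \<Theta>) = enat \<nu>"
        using vc by (simp add: VC_subgraph_class_def)
      show "(\<lambda>\<theta>. subgraph (space P \<times> space P) (\<lambda>(x, y). f0 x y \<theta>)) ` T
        \<subseteq> (\<lambda>\<theta>. subgraph (space (euclid m) \<times> space (euclid m)) (\<lambda>(z1, z2). f z1 z2 \<theta>)) ` \<Theta>"
        using T\<Theta> by (auto simp: f0_def spP)
    qed
  qed (use B \<nu> in auto)
  have X: "Z (Suc i) \<in> measurable M P" if "i < n" for i by (rule iidD(5)[OF that])
  have Zm: "Z i \<in> measurable M P" if "i \<in> {1..n}" for i using X[of "i - 1"] that by auto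
  note D = iidD(6)
  let ?O = "{(i, j). i \<in> {1..n} \<and> j \<in> {1..n} \<and> i \<noteq> j}"
  have pair_m: "(\<lambda>\<omega>. g (Z i \<omega>) (Z j \<omega>)) \<in> borel_measurable M"
    if "(\<lambda>(x, y). g x y) \<in> borel_measurable (P \<Otimes>\<^sub>M P)" "i \<in> {1..n}" "j \<in> {1..n}" for g :: "vec \<Rightarrow> vec \<Rightarrow> real" and i j
    using measurable_compose[OF measurable_Pair[OF Zm Zm] that(1)] that by simp
  have Gamma: "Gamma_obj n M Z f \<theta> = (\<integral>x. \<integral>y. f0 x y \<theta> \<partial>P \<partial>P)" if \<theta>: "\<theta> \<in> T" for \<theta>
  proof -
    let ?J = "\<integral>x. \<integral>y. f0 x y \<theta> \<partial>P \<partial>P"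
    have ij: "(\<integral>\<omega>. f0 (Z i \<omega>) (Z j \<omega>) \<theta> \<partial>M) = ?J" if "i \<in> {1..n}" "j \<in> {1..n}" "i \<noteq> j" for i j
    proof -
      have "(\<integral>\<omega>. f0 (Z (Suc (i - 1)) \<omega>) (Z (Suc (j - 1)) \<omega>) \<theta> \<partial>M) = ?J"
        by (rule K.integral_transfer_pair[where X = "\<lambda>i. Z (Suc i)", OF D X K.f_section_measurable[OF \<theta>] K.f_bd[OF _ _ \<theta>]])
          (use that in auto)
      then show ?thesis using that by simp
    qed
    have int: "integrable M (\<lambda>\<omega>. f0 (Z i \<omega>) (Z j \<omega>) \<theta>)" if "i \<in> {1..n}" "j \<in> {1..n}" for i j
      by (rule M.integrable_bounded[OF pair_m[OF K.f_section_measurable[OF \<theta>] that], where K = B])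
        (use K.f_bd[OF _ _ \<theta>] measurable_space[OF Zm] that in blast)
    have "?O = Sigma {1..n} (\<lambda>i. {1..n} - {i})" by auto
    then have "card ?O = (\<Sum>i\<in>{1..n}. card ({1..n} - {i}))" by simp
    also have "\<dots> = n * (n - 1)" by simp
    finally have cardO: "real (card ?O) = real n * (real n - 1)" using n by (simp add: of_nat_diff)
    have "Gamma_obj n M Z f \<theta> = (\<integral>\<omega>. 1 / (real n * (real n - 1)) * (\<Sum>x\<in>?O. f0 (Z (fst x) \<omega>) (Z (snd x) \<omega>) \<theta>) \<partial>M)"
      unfolding Gamma_obj_def U_stat_def f0T[OF \<theta>] by (simp add: case_prod_beta')
    also have "\<dots> = 1 / (real n * (real n - 1)) * (\<integral>\<omega>. (\<Sum>x\<in>?O. f0 (Z (fst x) \<omega>) (Z (snd x) \<omega>) \<theta>) \<partial>M)"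
      by (rule integral_mult_right_zero)
    also have "(\<integral>\<omega>. (\<Sum>x\<in>?O. f0 (Z (fst x) \<omega>) (Z (snd x) \<omega>) \<theta>) \<partial>M) = (\<Sum>x\<in>?O. \<integral>\<omega>. f0 (Z (fst x) \<omega>) (Z (snd x) \<omega>) \<theta> \<partial>M)"
      by (rule Bochner_Integration.integral_sum) (use int in auto)
    also have "\<dots> = (\<Sum>x\<in>?O. ?J)" by (rule sum.cong) (use ij in auto)
    also have "\<dots> = real n * (real n - 1) * ?J" using cardO by simp
    finally show ?thesis using n by simp
  qed
  have dk: "degenerate_kernel n M Z P f \<theta> = K.hker \<theta>" if "\<theta> \<in> T" for \<theta>
    by (intro ext) (simp add: degenerate_kernel_def K.hker_def Gamma[OF that] f0T[OF that])
  have sm_eq: "second_moment n M Z P f \<theta> = (\<integral>(x, y). (K.hker \<theta> x y)\<^sup>2 \<partial>(P \<Otimes>\<^sub>M P))" if "\<theta> \<in> T" for \<theta>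
    unfolding second_moment_def dk[OF that] ..
  interpret PPair: pair_prob_space P P ..
  have e: "(\<integral>(x, y). (K.hker \<theta> x y)\<^sup>2 \<partial>(P \<Otimes>\<^sub>M P)) \<le> \<eta>" if "\<theta> \<in> T" for \<theta>
  proof -
    \<comment> \<open>A real supremum bounds its members only if the set is bounded above.
      Boundedness of the kernel supplies this, so the assumption on the supremum controls each
      second moment.\<close>
    have "bdd_above ((\<lambda>\<theta>. second_moment n M Z P f \<theta>) ` T)"
    proof (rule bdd_aboveI2)
      fix \<theta> assume \<theta>: "\<theta> \<in> T"
      have hm: "(\<lambda>(x, y). (K.hker \<theta> x y)\<^sup>2) \<in> borel_measurable (P \<Otimes>\<^sub>M P)"
        using K.hker_measurable[OF \<theta>] by (simp add: case_prod_beta')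
      have hb: "(K.hker \<theta> x y)\<^sup>2 \<le> 16 * B\<^sup>2" if "x \<in> space P" "y \<in> space P" for x y
        using power_mono[OF K.hker_bd[OF \<theta> that] abs_ge_zero, of 2] by (simp add: power_mult_distrib)
      have "(\<integral>(x, y). (K.hker \<theta> x y)\<^sup>2 \<partial>(P \<Otimes>\<^sub>M P)) \<le> (\<integral>z. 16 * B\<^sup>2 \<partial>(P \<Otimes>\<^sub>M P))"
      proof (rule integral_mono)
        show "integrable (P \<Otimes>\<^sub>M P) (\<lambda>(x, y). (K.hker \<theta> x y)\<^sup>2)"
          by (rule PPair.P.integrable_bounded[OF hm, where K = "16 * B\<^sup>2"]) (use hb in \<open>auto simp: space_pair_measure\<close>)
      qed (use hb in \<open>auto simp: space_pair_measure\<close>)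
      then show "second_moment n M Z P f \<theta> \<le> 16 * B\<^sup>2" unfolding sm_eq[OF \<theta>] by (simp add: PPair.P.prob_space)
    qed
    then have "second_moment n M Z P f \<theta> \<le> (SUP \<theta>\<in>T. second_moment n M Z P f \<theta>)"
      using that by (rule cSUP_upper[rotated])
    then show ?thesis using sm sm_eq[OF that] unfolding T_def by simp
  qed
  have out: "outer_le M (\<lambda>\<omega>. SUP \<theta>\<in>T. \<bar>U_stat n (\<lambda>i. Z (Suc (i - 1)) \<omega>) (K.hker \<theta>)\<bar>)
    (sqrt 2 * 21 * (228 * B + 4 / B) * ln (1 / \<eta>) * sqrt \<eta> * real \<nu> / real n)"
  proof (rule K.outer_le_transfer[where X = "\<lambda>i. Z (Suc i)" and Y = "\<lambda>\<omega>. SUP \<theta>\<in>T. \<bar>U_stat n (\<lambda>i. \<omega> (i - 1)) (K.hker \<theta>)\<bar>", OF D X])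
    show "outer_le K.PP (\<lambda>\<omega>. SUP \<theta>\<in>T. \<bar>U_stat n (\<lambda>i. \<omega> (i - 1)) (K.hker \<theta>)\<bar>)
      (sqrt 2 * 21 * (228 * B + 4 / B) * ln (1 / \<eta>) * sqrt \<eta> * real \<nu> / real n)"
      by (rule K.outer_le_SUP_U_stat[OF n \<eta> e])
    fix \<omega> \<omega>' :: "nat \<Rightarrow> vec" assume "\<And>i. i < n \<Longrightarrow> \<omega> i = \<omega>' i"
    then have "U_stat n (\<lambda>i. \<omega> (i - 1)) (K.hker \<theta>) = U_stat n (\<lambda>i. \<omega>' (i - 1)) (K.hker \<theta>)" for \<theta>
      by (intro U_stat_cong) auto
    then show "(SUP \<theta>\<in>T. \<bar>U_stat n (\<lambda>i. \<omega> (i - 1)) (K.hker \<theta>)\<bar>) = (SUP \<theta>\<in>T. \<bar>U_stat n (\<lambda>i. \<omega>' (i - 1)) (K.hker \<theta>)\<bar>)"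
      by simp
  qed
  have S_eq: "S \<omega> = (SUP \<theta>\<in>T. \<bar>U_stat n (\<lambda>i. Z i \<omega>) (K.hker \<theta>)\<bar>)" for \<omega>
    unfolding S_def sup_U_process_def T_def[symmetric] by (rule SUP_cong) (simp_all add: dk)
  have "U_stat n (\<lambda>i. Z (Suc (i - 1)) \<omega>) g = U_stat n (\<lambda>i. Z i \<omega>) g" for \<omega> and g :: "vec \<Rightarrow> vec \<Rightarrow> real"
    by (rule U_stat_cong) simp
  then have outS: "outer_le M S (sqrt 2 * 21 * (228 * B + 4 / B) * ln (1 / \<eta>) * sqrt \<eta> * real \<nu> / real n)"
    using out S_eq by (simp add: S_eq[abs_def])
  define c where "c = \<bar>1 / (real n * (real n - 1))\<bar> * (\<Sum>x\<in>?O. 4 * B)"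
  have Ub: "\<bar>U_stat n (\<lambda>i. Z i \<omega>) (K.hker \<theta>)\<bar> \<le> c" if "\<omega> \<in> space M" "\<theta> \<in> T" for \<omega> \<theta>
  proof -
    have "\<bar>U_stat n (\<lambda>i. Z i \<omega>) (K.hker \<theta>)\<bar> = \<bar>1 / (real n * (real n - 1))\<bar> * \<bar>\<Sum>x\<in>?O. K.hker \<theta> (Z (fst x) \<omega>) (Z (snd x) \<omega>)\<bar>"
      unfolding U_stat_def abs_mult by (simp add: case_prod_beta')
    also have "\<dots> \<le> \<bar>1 / (real n * (real n - 1))\<bar> * (\<Sum>x\<in>?O. 4 * B)"
    proof (rule mult_left_mono[OF order_trans[OF sum_abs sum_mono]])
      fix x assume "x \<in> ?O"
      then show "\<bar>K.hker \<theta> (Z (fst x) \<omega>) (Z (snd x) \<omega>)\<bar> \<le> 4 * B"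
        using measurable_space[OF Zm] that by (intro K.hker_bd) auto
    qed simp
    finally show ?thesis by (simp add: c_def)
  qed
  have jm: "(\<lambda>(\<omega>, \<theta>). \<bar>U_stat n (\<lambda>i. Z i \<omega>) (K.hker \<theta>)\<bar>) \<in> borel_measurable (M \<Otimes>\<^sub>M euclid p)"
  proof -
    have "(\<lambda>x. K.hker (snd x) (Z i (fst x)) (Z j (fst x))) \<in> borel_measurable (M \<Otimes>\<^sub>M euclid p)"
      if "i \<in> {1..n}" "j \<in> {1..n}" for i j
    proof -
      have "(\<lambda>x. (Z i (fst x), Z j (fst x), snd x)) \<in> measurable (M \<Otimes>\<^sub>M euclid p) (P \<Otimes>\<^sub>M P \<Otimes>\<^sub>M euclid p)"
        using measurable_compose[OF measurable_fst Zm[OF that(1)], of "euclid p"]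
          measurable_compose[OF measurable_fst Zm[OF that(2)], of "euclid p"] by (intro measurable_Pair) auto
      from measurable_compose[OF this K.hker_joint_measurable] show ?thesis by simp
    qed
    then have "(\<lambda>x. \<bar>1 / (real n * (real n - 1)) * (\<Sum>ij\<in>?O. K.hker (snd x) (Z (fst ij) (fst x)) (Z (snd ij) (fst x)))\<bar>)
        \<in> borel_measurable (M \<Otimes>\<^sub>M euclid p)"
      by (intro borel_measurable_abs borel_measurable_times borel_measurable_const borel_measurable_sum) auto
    then show ?thesis unfolding U_stat_def by (simp add: case_prod_beta')
  qed
  have Sm: "S \<in> borel_measurable (completion M)"
    unfolding S_eq[abs_def]
    by (rule borel_measurable_SUP_param[OF M.finite_measure_axioms K.T jm]) (rule bdd_above_absI[of _ _ c], simp add: Ub)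
  have Sb: "\<bar>S \<omega>\<bar> \<le> c" if "\<omega> \<in> space M" for \<omega>
    unfolding S_eq by (rule abs_SUP_le[OF K.T(2)]) (simp add: Ub[OF that])
  have S0: "0 \<le> S \<omega>" if "\<omega> \<in> space M" for \<omega>
  proof -
    obtain \<theta> where \<theta>: "\<theta> \<in> T" using K.T(2) by blast
    have "\<bar>U_stat n (\<lambda>i. Z i \<omega>) (K.hker \<theta>)\<bar> \<le> S \<omega>"
      unfolding S_eq by (rule cSUP_upper[OF \<theta> bdd_above_absI[of _ _ c]]) (simp add: Ub[OF that])
    then show ?thesis by linarith
  qed
  show ?thesis
    using Sm S0 M.integral_completion_le_outer[OF Sm Sb outS] by blast
qed

text \<open>A point in which two subgraphs differ would be a shattered singleton. In dimension 0 all
  subgraphs therefore coincide with that of \<open>\<theta>0\<close>, so every \<open>f\<close> in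
  the class vanishes. This covers rows where \<open>\<eta>\<close> may be 0 and its logarithm is
  meaningless.\<close>

lemma sup_U_process_eq_0:
  assumes iid: "iid_sample n m M P Z" and n: "1 \<le> n"
    and \<theta>0: "\<theta>0 \<in> \<Theta>" and r: "0 \<le> r"
    and f0: "\<And>x y. x \<in> space (euclid m) \<Longrightarrow> y \<in> space (euclid m) \<Longrightarrow> f x y \<theta>0 = 0"
    and vc: "VC_subgraph_class m \<Theta> f 0" and \<omega>: "\<omega> \<in> space M"
  shows "sup_U_process n M Z P f (param_ball p \<Theta> \<theta>0 r) \<omega> = 0"
proof -
  note iidD = iid_sampleD[OF iid n]
  interpret M: prob_space M by (rule iidD(1))
  let ?C = "(\<lambda>\<theta>. subgraph (space (euclid m) \<times> space (euclid m)) (\<lambda>(z1, z2). f z1 z2 \<theta>)) ` \<Theta>"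
  have vc0: "vc_le ?C 0" using vc by (intro vc_dim_imp_vc_le) (simp add: VC_subgraph_class_def)
  have same: "((x, y), t) \<in> subgraph (space (euclid m) \<times> space (euclid m)) (\<lambda>(z1, z2). f z1 z2 \<theta>) \<longleftrightarrow>
      ((x, y), t) \<in> subgraph (space (euclid m) \<times> space (euclid m)) (\<lambda>(z1, z2). f z1 z2 \<theta>0)" if "\<theta> \<in> \<Theta>" for \<theta> x y t
  proof (rule ccontr)
    assume neg: "\<not> ?thesis"
    let ?q = "((x, y), t)"
    let ?g = "\<lambda>\<theta>. subgraph (space (euclid m) \<times> space (euclid m)) (\<lambda>(z1, z2). f z1 z2 \<theta>)"
    have "\<exists>c\<in>?C. c \<inter> {?q} = R" if "R \<subseteq> {?q}" for R
    proof -
      have "\<exists>\<theta>'\<in>{\<theta>, \<theta>0}. (?q \<in> ?g \<theta>') = (?q \<in> R)" using neg by auto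
      then obtain \<theta>' where t: "\<theta>' \<in> {\<theta>, \<theta>0}" "(?q \<in> ?g \<theta>') = (?q \<in> R)" by blast
      have "?g \<theta>' \<inter> {?q} = R" using t(2) that by blast
      moreover have "\<theta>' \<in> \<Theta>" using t(1) \<open>\<theta> \<in> \<Theta>\<close> \<theta>0 by auto
      ultimately show ?thesis by blast
    qed
    then have "shatters ?C {?q}" by (simp add: shatters_def)
    then have "card {?q} \<le> 0" using vc0 unfolding vc_le_def by blast
    then show False by simp
  qed
  have fz: "f x y \<theta> = 0" if "\<theta> \<in> \<Theta>" "x \<in> space (euclid m)" "y \<in> space (euclid m)" for \<theta> x y
  proof -
    have iff: "t < f x y \<theta> \<longleftrightarrow> t < 0" for t
      using same[OF that(1), of x y t] that(2,3) f0[OF that(2,3)] by (simp add: subgraph_def)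
    have "\<not> 0 < f x y \<theta>" using iff[of 0] less_irrefl[of "0 :: real"] by blast
    moreover have "\<not> f x y \<theta> < 0" using iff[of "f x y \<theta>"] less_irrefl[of "f x y \<theta>"] by blast
    ultimately show ?thesis by linarith
  qed
  have spP: "space P = space (euclid m)" by (rule sets_eq_imp_space_eq[OF iidD(3)])
  have Zs: "Z i \<omega>' \<in> space (euclid m)" if "i \<in> {1..n}" "\<omega>' \<in> space M" for i \<omega>'
    using measurable_space[OF iidD(2)[OF that(1)] that(2)] .
  have U0: "U_stat n (\<lambda>i. Z i \<omega>) (degenerate_kernel n M Z P f \<theta>) = 0" if "\<theta> \<in> \<Theta>" for \<theta>
  proof -
    have "U_stat n (\<lambda>i. Z i \<omega>') (\<lambda>z1 z2. f z1 z2 \<theta>) = 0" if "\<omega>' \<in> space M" for \<omega>'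
    proof -
      have "(\<Sum>(i, j)\<in>{(i, j). i \<in> {1..n} \<and> j \<in> {1..n} \<and> i \<noteq> j}. f (Z i \<omega>') (Z j \<omega>') \<theta>) = 0"
        by (rule sum.neutral) (use fz[OF \<open>\<theta> \<in> \<Theta>\<close> Zs Zs] that in auto)
      then show ?thesis by (simp add: U_stat_def)
    qed
    then have "Gamma_obj n M Z f \<theta> = (\<integral>\<omega>'. 0 \<partial>M)"
      unfolding Gamma_obj_def by (intro Bochner_Integration.integral_cong) auto
    then have G: "Gamma_obj n M Z f \<theta> = 0" by simp
    have "degenerate_kernel n M Z P f \<theta> x y = 0" if "x \<in> space (euclid m)" "y \<in> space (euclid m)" for x y
    proof -
      have "(\<integral>w. f x w \<theta> \<partial>P) = (\<integral>w. 0 \<partial>P)" "(\<integral>w. f w y \<theta> \<partial>P) = (\<integral>w. 0 \<partial>P)"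
        using fz[OF \<open>\<theta> \<in> \<Theta>\<close>] that by (intro Bochner_Integration.integral_cong; simp add: spP)+
      then show ?thesis using G fz[OF \<open>\<theta> \<in> \<Theta>\<close> that] by (simp add: degenerate_kernel_def)
    qed
    then have "(\<Sum>(i, j)\<in>{(i, j). i \<in> {1..n} \<and> j \<in> {1..n} \<and> i \<noteq> j}. degenerate_kernel n M Z P f \<theta> (Z i \<omega>) (Z j \<omega>)) = 0"
      using Zs \<omega> by (intro sum.neutral) auto
    then show ?thesis by (simp add: U_stat_def)
  qed
  have "param_ball p \<Theta> \<theta>0 r \<noteq> {}" using \<theta>0 r by (auto simp: param_ball_def L2_set_def)
  moreover have "\<bar>U_stat n (\<lambda>i. Z i \<omega>) (degenerate_kernel n M Z P f \<theta>)\<bar> = 0" if "\<theta> \<in> param_ball p \<Theta> \<theta>0 r" for \<theta>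
    using U0 that by (simp add: param_ball_def)
  ultimately show ?thesis unfolding sup_U_process_def by simp
qed

section \<open>Asymptotics along the array\<close>

text \<open>With \<open>y\<close> the fourth root of \<open>x\<close>, the logarithm is
  \<open>4 * ln (1 / y)\<close>, at most \<open>4 / y\<close>, while
  \<open>sqrt x = y\<^sup>2\<close>. One factor \<open>y\<close> survives and forces convergence to
  0.\<close>

lemma abs_ln_inverse_mult_sqrt_le:
  fixes x :: real
  assumes "0 \<le> x" "x \<le> 1"
  shows "\<bar>ln (1 / x) * sqrt x\<bar> \<le> 4 * sqrt (sqrt x)"
proof (cases "x = 0")
  case False
  define y where "y = sqrt (sqrt x)"
  have y: "0 < y" "y\<^sup>2 = sqrt x" using False assms by (auto simp: y_def)
  have "x = y ^ 4"
  proof -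
    have "y ^ 4 = (y\<^sup>2)\<^sup>2" by simp
    also have "\<dots> = x" unfolding y(2) using assms by simp
    finally show ?thesis ..
  qed
  then have "1 / x = (1 / y) ^ 4" by (simp add: power_divide)
  then have "ln (1 / x) = 4 * ln (1 / y)" unfolding \<open>1 / x = (1 / y) ^ 4\<close> ln_realpow by simp
  also have "ln (1 / y) \<le> 1 / y" using y by (intro order.strict_implies_order ln_less_self) auto
  finally have "ln (1 / x) * y\<^sup>2 \<le> 4 * (1 / y) * y\<^sup>2" by (intro mult_right_mono) auto
  also have "\<dots> = 4 * y" using y(1) by (simp only: power2_eq_square) simp
  finally have "ln (1 / x) * sqrt x \<le> 4 * y" by (simp add: y(2))
  moreover have "0 \<le> ln (1 / x) * sqrt x" using False assms by simp
  ultimately show ?thesis by (simp add: y_def)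
qed simp

definition maximal_constant :: "real \<Rightarrow> real" where
  "maximal_constant B = sqrt 2 * 21 * (228 * B + 4 / B)"

text \<open>
  The square root of the normalized bound on the expectation: by Markov's inequality it also bounds
  the probability that the deviation exceeds it.
\<close>

definition deviation_bound :: "real \<Rightarrow> real \<Rightarrow> nat \<Rightarrow> nat \<Rightarrow> real" where
  "deviation_bound B e v n = (let \<eta> = max (sqrt (real v / real n)) e
     in sqrt \<bar>maximal_constant B * (ln (1 / \<eta>) * sqrt \<eta>)\<bar>)"

text \<open>Once \<open>\<eta> n \<le> 1 / 4\<close> the row bound applies, so all claims reduce to
  it eventually. Setting \<open>B' \<ge> B\<close> apart ensures a positive bound, which the
  constant needs because it contains \<open>4 / B'\<close>.\<close>

lemma sup_U_process_array:
  fixes m p \<nu> :: "nat \<Rightarrow> nat" and M :: "nat \<Rightarrow> 'a measure" and P :: "nat \<Rightarrow> vec measure"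
    and Z :: "nat \<Rightarrow> nat \<Rightarrow> 'a \<Rightarrow> vec" and \<Theta> :: "nat \<Rightarrow> vec set"
    and f :: "nat \<Rightarrow> vec \<Rightarrow> vec \<Rightarrow> vec \<Rightarrow> real" and \<theta>0 :: "nat \<Rightarrow> vec"
    and r \<epsilon> \<eta> :: "nat \<Rightarrow> real" and B B' :: real
  defines "S \<equiv> \<lambda>n. sup_U_process n (M n) (Z n) (P n) (f n) (param_ball (p n) (\<Theta> n) (\<theta>0 n) (r n))"
  assumes row: "\<forall>n\<ge>2.
           iid_sample n (m n) (M n) (P n) (Z n) \<and>
           measurable_class (m n) (p n) (\<Theta> n) (f n) \<and>
           is_arg_max (Gamma_obj n (M n) (Z n) (f n)) (\<lambda>\<theta>. \<theta> \<in> \<Theta> n) (\<theta>0 n) \<and>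
           (\<forall>\<theta>\<in>\<Theta> n. \<forall>z1\<in>space (euclid (m n)). \<forall>z2\<in>space (euclid (m n)).
              \<bar>f n z1 z2 \<theta>\<bar> \<le> B) \<and>
           VC_subgraph_class (m n) (\<Theta> n) (f n) (\<nu> n) \<and>
           (\<forall>z1\<in>space (euclid (m n)). \<forall>z2\<in>space (euclid (m n)). f n z1 z2 (\<theta>0 n) = 0)"
    and \<nu>: "(\<lambda>n. real (\<nu> n) / real n) \<longlonglongrightarrow> 0"
    and r: "\<forall>n. 0 \<le> r n" and \<epsilon>: "\<forall>n. 0 \<le> \<epsilon> n" "\<epsilon> \<longlonglongrightarrow> 0"
    and sm: "\<forall>n\<ge>2. (SUP \<theta>\<in>param_ball (p n) (\<Theta> n) (\<theta>0 n) (r n).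
                    second_moment n (M n) (Z n) (P n) (f n) \<theta>) \<le> \<epsilon> n"
    and \<eta>_eq: "\<forall>n. \<eta> n = max (sqrt (real (\<nu> n) / real n)) (\<epsilon> n)"
    and B': "0 < B'" "B \<le> B'"
  shows "(\<lambda>n. deviation_bound B' (\<epsilon> n) (\<nu> n) n) \<longlonglongrightarrow> 0"
    and "(\<lambda>n. measure (completion (M n))
        {\<omega> \<in> space (M n). S n \<omega> \<le> deviation_bound B' (\<epsilon> n) (\<nu> n) n * real (\<nu> n) / real n}) \<longlonglongrightarrow> 1"
    and "\<forall>\<^sub>F n in sequentially. integrable (completion (M n)) (S n) \<and>
      (\<integral>\<omega>. S n \<omega> \<partial>completion (M n)) \<le> maximal_constant B' * ln (1 / \<eta> n) * sqrt (\<eta> n) * real (\<nu> n) / real n"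
proof -
  define C where "C = maximal_constant B'"
  have C: "0 < C" using B' by (simp add: C_def maximal_constant_def add_pos_pos)
  note C_eq = C_def[unfolded maximal_constant_def]
  let ?\<Delta> = "deviation_bound B'"
  have \<eta>_def: "\<eta> n = max (sqrt (real (\<nu> n) / real n)) (\<epsilon> n)" for n using \<eta>_eq by blast
  have \<Delta>0: "0 \<le> ?\<Delta> e v n" for e v n by (simp add: deviation_bound_def Let_def)
  have "(\<lambda>n. sqrt (real (\<nu> n) / real n)) \<longlonglongrightarrow> sqrt 0" by (intro tendsto_real_sqrt \<nu>)
  then have \<eta>_lim: "\<eta> \<longlonglongrightarrow> 0" unfolding \<eta>_def[abs_def] using tendsto_max[OF _ \<epsilon>(2)] by fastforce
  have \<eta>0: "0 \<le> \<eta> n" for n by (simp add: \<eta>_def le_max_iff_disj)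
  have ev: "\<forall>\<^sub>F n in sequentially. 2 \<le> n \<and> \<eta> n \<le> 1 / 4"
  proof -
    have "\<forall>\<^sub>F n in sequentially. \<eta> n < 1 / 4" using \<eta>_lim by (rule order_tendstoD(2)) simp
    then show ?thesis using eventually_ge_at_top[of 2] by eventually_elim simp
  qed
  have main: "S n \<in> borel_measurable (completion (M n)) \<and> (\<forall>\<omega>\<in>space (M n). 0 \<le> S n \<omega>) \<and>
      integrable (completion (M n)) (S n) \<and>
      (\<integral>\<omega>. S n \<omega> \<partial>completion (M n)) \<le> C * ln (1 / \<eta> n) * sqrt (\<eta> n) * real (\<nu> n) / real n"
    if n: "2 \<le> n" "\<eta> n \<le> 1 / 4" for n
  proof (cases "\<nu> n = 0")
    case True
    have iid: "iid_sample n (m n) (M n) (P n) (Z n)" using row n by blast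
    have "\<theta>0 n \<in> \<Theta> n" using row n unfolding is_arg_max_def by blast
    then have S0: "S n \<omega> = 0" if "\<omega> \<in> space (M n)" for \<omega>
      unfolding S_def using row n r True that
      by (intro sup_U_process_eq_0[OF iid, where f = "f n"]) auto
    have "S n \<in> borel_measurable (completion (M n)) \<longleftrightarrow> (\<lambda>_. 0 :: real) \<in> borel_measurable (completion (M n))"
      by (rule measurable_cong) (simp add: S0)
    moreover have "integrable (completion (M n)) (S n) \<longleftrightarrow> integrable (completion (M n)) (\<lambda>_. 0 :: real)"
      by (rule Bochner_Integration.integrable_cong) (simp_all add: S0)
    moreover have "(\<integral>\<omega>. S n \<omega> \<partial>completion (M n)) = (\<integral>\<omega>. 0 \<partial>completion (M n))"
      by (rule Bochner_Integration.integral_cong) (simp_all add: S0)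
    ultimately show ?thesis using S0 True by simp
  next
    case False
    show ?thesis
      unfolding S_def C_eq
    proof (rule sup_U_process_bound)
      show "iid_sample n (m n) (M n) (P n) (Z n)" "measurable_class (m n) (p n) (\<Theta> n) (f n)"
        "VC_subgraph_class (m n) (\<Theta> n) (f n) (\<nu> n)" using row n by blast+
      show "\<theta>0 n \<in> \<Theta> n" using row n unfolding is_arg_max_def by blast
      show "\<bar>f n x y \<theta>\<bar> \<le> B'" if "\<theta> \<in> \<Theta> n" "x \<in> space (euclid (m n))" "y \<in> space (euclid (m n))" for \<theta> x y
      proof -
        have "\<bar>f n x y \<theta>\<bar> \<le> B" using row n that by blast
        then show ?thesis using B' by linarith
      qed
      have "0 < sqrt (real (\<nu> n) / real n)" using False n by simp
      then show "0 < \<eta> n" unfolding \<eta>_def by (rule less_max_iff_disj[THEN iffD2, OF disjI1])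
      show "sqrt (real (\<nu> n) / real n) \<le> \<eta> n" by (simp add: \<eta>_def)
      have "(SUP \<theta>\<in>param_ball (p n) (\<Theta> n) (\<theta>0 n) (r n). second_moment n (M n) (Z n) (P n) (f n) \<theta>) \<le> \<epsilon> n"
        using sm n by blast
      also have "\<epsilon> n \<le> \<eta> n" by (simp add: \<eta>_def)
      finally show "(SUP \<theta>\<in>param_ball (p n) (\<Theta> n) (\<theta>0 n) (r n). second_moment n (M n) (Z n) (P n) (f n) \<theta>) \<le> \<eta> n" .
    qed (use n r B' False in auto)
  qed
  have \<Delta>_eq: "?\<Delta> (\<epsilon> n) (\<nu> n) n = sqrt \<bar>C * (ln (1 / \<eta> n) * sqrt (\<eta> n))\<bar>" for n
    by (simp add: deviation_bound_def \<eta>_def C_def Let_def)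
  have \<Delta>_lim: "(\<lambda>n. ?\<Delta> (\<epsilon> n) (\<nu> n) n) \<longlonglongrightarrow> 0"
  proof (rule tendsto_sandwich)
    show "\<forall>\<^sub>F n in sequentially. 0 \<le> ?\<Delta> (\<epsilon> n) (\<nu> n) n" using \<Delta>0 by simp
    show "\<forall>\<^sub>F n in sequentially. ?\<Delta> (\<epsilon> n) (\<nu> n) n \<le> sqrt (C * (4 * sqrt (sqrt (\<eta> n))))"
      using ev
    proof eventually_elim
      fix n assume n: "2 \<le> n \<and> \<eta> n \<le> 1 / 4"
      have "\<bar>ln (1 / \<eta> n) * sqrt (\<eta> n)\<bar> \<le> 4 * sqrt (sqrt (\<eta> n))"
        using n \<eta>0 by (intro abs_ln_inverse_mult_sqrt_le) auto
      then have "\<bar>C\<bar> * \<bar>ln (1 / \<eta> n) * sqrt (\<eta> n)\<bar> \<le> C * (4 * sqrt (sqrt (\<eta> n)))"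
        using C by (intro mult_mono) auto
      then show "?\<Delta> (\<epsilon> n) (\<nu> n) n \<le> sqrt (C * (4 * sqrt (sqrt (\<eta> n))))"
        unfolding \<Delta>_eq abs_mult[of C] by (rule real_sqrt_le_mono)
    qed
    have "(\<lambda>n. sqrt (C * (4 * sqrt (sqrt (\<eta> n))))) \<longlonglongrightarrow> sqrt (C * (4 * sqrt (sqrt 0)))"
      by (intro tendsto_intros \<eta>_lim)
    then show "(\<lambda>n. sqrt (C * (4 * sqrt (sqrt (\<eta> n))))) \<longlonglongrightarrow> 0" by simp
  qed simp
  have prob: "(\<lambda>n. measure (completion (M n)) {\<omega> \<in> space (M n). S n \<omega> \<le> ?\<Delta> (\<epsilon> n) (\<nu> n) n * real (\<nu> n) / real n}) \<longlonglongrightarrow> 1"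
  proof (rule tendsto_sandwich)
    have lower: "1 - ?\<Delta> (\<epsilon> n) (\<nu> n) n \<le> measure (completion (M n)) {\<omega> \<in> space (M n). S n \<omega> \<le> ?\<Delta> (\<epsilon> n) (\<nu> n) n * real (\<nu> n) / real n} \<and>
        measure (completion (M n)) {\<omega> \<in> space (M n). S n \<omega> \<le> ?\<Delta> (\<epsilon> n) (\<nu> n) n * real (\<nu> n) / real n} \<le> 1"
      if n: "2 \<le> n" "\<eta> n \<le> 1 / 4" for n
    proof -
      have iid: "iid_sample n (m n) (M n) (P n) (Z n)" using row n by blast
      interpret Mn: prob_space "M n" using iid by (simp add: iid_sample_def)
      interpret Cn: prob_space "completion (M n)" by (rule Mn.prob_space_completion)
      note S = main[OF n]
      define d where "d = ?\<Delta> (\<epsilon> n) (\<nu> n) n"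
      let ?A = "{\<omega> \<in> space (M n). S n \<omega> \<le> d * real (\<nu> n) / real n}"
      have A: "?A \<in> sets (completion (M n))"
        using borel_measurable_le[of "S n" "completion (M n)" "\<lambda>_. d * real (\<nu> n) / real n"] S by simp
      have "1 - d \<le> measure (completion (M n)) ?A"
      proof (cases "\<nu> n = 0")
        case True
        have "\<theta>0 n \<in> \<Theta> n" using row n unfolding is_arg_max_def by blast
        then have "S n \<omega> = 0" if "\<omega> \<in> space (M n)" for \<omega>
          unfolding S_def using row n r True that
          by (intro sup_U_process_eq_0[OF iid, where f = "f n"]) auto
        then have "?A = space (completion (M n))" using True by auto
        then have "measure (completion (M n)) ?A = 1" using Cn.prob_space by simp
        then show ?thesis using \<Delta>0 unfolding d_def by simp
      next
        case False
        have "0 < sqrt (real (\<nu> n) / real n)" using False n by simp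
        also have "\<dots> \<le> \<eta> n" by (simp add: \<eta>_def)
        finally have \<eta>p: "0 < \<eta> n" .
        have "1 < 1 / \<eta> n" using \<eta>p n by (simp add: field_simps)
        then have "0 < ln (1 / \<eta> n)" by (rule ln_gt_zero)
        then have pos: "0 < C * (ln (1 / \<eta> n) * sqrt (\<eta> n))" using C \<eta>p by simp
        \<comment> \<open>Since \<open>d\<close> squared is the normalised expectation bound, the
          expectation is at most \<open>d * t\<close> with \<open>t = d * \<nu> / n\<close>.
          Markov's inequality at level \<open>t\<close> then yields the same \<open>d\<close> as a
          probability.\<close>
        then have d: "0 < d" "d * d = C * (ln (1 / \<eta> n) * sqrt (\<eta> n))"
          unfolding d_def \<Delta>_eq by simp_all
        define t where "t = d * real (\<nu> n) / real n"
        have t: "0 < t" using d False n by (simp add: t_def)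
        have "measure (completion (M n)) {\<omega> \<in> space (completion (M n)). t \<le> S n \<omega>} \<le> (\<integral>\<omega>. S n \<omega> \<partial>completion (M n)) / t"
          by (rule integral_Markov_inequality_measure[where A = "space (completion (M n))"]) (use S t in auto)
        also have "\<dots> \<le> (C * ln (1 / \<eta> n) * sqrt (\<eta> n) * real (\<nu> n) / real n) / t"
          using S t by (intro divide_right_mono) auto
        also have "C * ln (1 / \<eta> n) * sqrt (\<eta> n) * real (\<nu> n) / real n = d * t"
          using d(2) by (simp add: t_def mult.assoc[symmetric])
        also have "d * t / t = d" using t by simp
        finally have mk: "measure (completion (M n)) {\<omega> \<in> space (completion (M n)). t \<le> S n \<omega>} \<le> d" .
        have B: "{\<omega> \<in> space (completion (M n)). t \<le> S n \<omega>} \<in> sets (completion (M n))"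
          using borel_measurable_le[of "\<lambda>_. t" "completion (M n)" "S n"] S by simp
        have "1 - measure (completion (M n)) {\<omega> \<in> space (completion (M n)). t \<le> S n \<omega>}
            = measure (completion (M n)) (space (completion (M n)) - {\<omega> \<in> space (completion (M n)). t \<le> S n \<omega>})"
          by (rule Cn.prob_compl[OF B, symmetric])
        also have "\<dots> \<le> measure (completion (M n)) ?A"
          by (rule Cn.finite_measure_mono[OF _ A]) (auto simp: t_def)
        finally show ?thesis using mk by linarith
      qed
      then show ?thesis using Cn.prob_le_1 unfolding d_def by blast
    qed
    show "\<forall>\<^sub>F n in sequentially. 1 - ?\<Delta> (\<epsilon> n) (\<nu> n) n \<le> measure (completion (M n)) {\<omega> \<in> space (M n). S n \<omega> \<le> ?\<Delta> (\<epsilon> n) (\<nu> n) n * real (\<nu> n) / real n}"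
      using ev by eventually_elim (use lower in blast)
    show "\<forall>\<^sub>F n in sequentially. measure (completion (M n)) {\<omega> \<in> space (M n). S n \<omega> \<le> ?\<Delta> (\<epsilon> n) (\<nu> n) n * real (\<nu> n) / real n} \<le> 1"
      using ev by eventually_elim (use lower in blast)
    show "(\<lambda>n. 1 - ?\<Delta> (\<epsilon> n) (\<nu> n) n) \<longlonglongrightarrow> 1"
      using tendsto_diff[OF tendsto_const \<Delta>_lim, of 1] by simp
  qed simp
  have expect: "\<forall>\<^sub>F n in sequentially. integrable (completion (M n)) (S n) \<and>
      (\<integral>\<omega>. S n \<omega> \<partial>completion (M n)) \<le> C * ln (1 / \<eta> n) * sqrt (\<eta> n) * real (\<nu> n) / real n"
    using ev by eventually_elim (use main in blast)
  show "(\<lambda>n. ?\<Delta> (\<epsilon> n) (\<nu> n) n) \<longlonglongrightarrow> 0" by (rule \<Delta>_lim)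
  show "(\<lambda>n. measure (completion (M n))
        {\<omega> \<in> space (M n). S n \<omega> \<le> ?\<Delta> (\<epsilon> n) (\<nu> n) n * real (\<nu> n) / real n}) \<longlonglongrightarrow> 1" by (rule prob)
  show "\<forall>\<^sub>F n in sequentially. integrable (completion (M n)) (S n) \<and>
      (\<integral>\<omega>. S n \<omega> \<partial>completion (M n)) \<le> maximal_constant B' * ln (1 / \<eta> n) * sqrt (\<eta> n) * real (\<nu> n) / real n"
    using expect by (simp only: C_def)
qed

text \<open>The function \<open>\<Delta>\<close> and the constant \<open>C\<close> are chosen before
  the array, so they depend on \<open>B\<close> alone; this expresses absolute constants and the
  restricted dependence of the deviation. Rows start at 2 because the normalisation of the
  U-statistic vanishes below. Probabilities and expectations refer to the completed measure, for
  which the suprema are measurable.\<close>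

theorem theorem2p1:
  fixes B :: real
  shows
    "\<exists>(\<Delta> :: real \<Rightarrow> nat \<Rightarrow> nat \<Rightarrow> real) (C :: real).
      (\<forall>e v n. 0 \<le> \<Delta> e v n) \<and> 0 < C \<and>
      (\<forall>(m :: nat \<Rightarrow> nat) (p :: nat \<Rightarrow> nat) (\<nu> :: nat \<Rightarrow> nat)
         (M :: nat \<Rightarrow> 'a measure) (P :: nat \<Rightarrow> vec measure) (Z :: nat \<Rightarrow> nat \<Rightarrow> 'a \<Rightarrow> vec)
         (\<Theta> :: nat \<Rightarrow> vec set) (f :: nat \<Rightarrow> vec \<Rightarrow> vec \<Rightarrow> vec \<Rightarrow> real) (\<theta>0 :: nat \<Rightarrow> vec).
        (\<forall>n\<ge>2.
           iid_sample n (m n) (M n) (P n) (Z n) \<and>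
           measurable_class (m n) (p n) (\<Theta> n) (f n) \<and>
           is_arg_max (Gamma_obj n (M n) (Z n) (f n)) (\<lambda>\<theta>. \<theta> \<in> \<Theta> n) (\<theta>0 n) \<and>
           (\<forall>\<theta>\<in>\<Theta> n. \<forall>z1\<in>space (euclid (m n)). \<forall>z2\<in>space (euclid (m n)).
              \<bar>f n z1 z2 \<theta>\<bar> \<le> B) \<and>
           VC_subgraph_class (m n) (\<Theta> n) (f n) (\<nu> n) \<and>
           (\<forall>z1\<in>space (euclid (m n)). \<forall>z2\<in>space (euclid (m n)). f n z1 z2 (\<theta>0 n) = 0)) \<and>
        (\<lambda>n. real (\<nu> n) / real n) \<longlonglongrightarrow> 0
        \<longrightarrow>
        (\<forall>(r :: nat \<Rightarrow> real) (\<epsilon> :: nat \<Rightarrow> real).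
           (\<forall>n. 0 \<le> r n) \<and> r \<longlonglongrightarrow> 0 \<and> (\<forall>n. 0 \<le> \<epsilon> n) \<and> \<epsilon> \<longlonglongrightarrow> 0 \<and>
           (\<forall>n\<ge>2. (SUP \<theta>\<in>param_ball (p n) (\<Theta> n) (\<theta>0 n) (r n).
                      second_moment n (M n) (Z n) (P n) (f n) \<theta>) \<le> \<epsilon> n)
           \<longrightarrow>
           (\<lambda>n. \<Delta> (\<epsilon> n) (\<nu> n) n) \<longlonglongrightarrow> 0 \<and>
           (\<lambda>n. measure (completion (M n))
              {\<omega> \<in> space (M n).
                 sup_U_process n (M n) (Z n) (P n) (f n)
                   (param_ball (p n) (\<Theta> n) (\<theta>0 n) (r n)) \<omega>
                 \<le> \<Delta> (\<epsilon> n) (\<nu> n) n * real (\<nu> n) / real n}) \<longlonglongrightarrow> 1)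
        \<and>
        (\<forall>(rfun :: nat \<Rightarrow> nat \<Rightarrow> nat \<Rightarrow> real) (efun :: nat \<Rightarrow> nat \<Rightarrow> nat \<Rightarrow> real \<Rightarrow> real)
           (r :: nat \<Rightarrow> real) (\<epsilon> :: nat \<Rightarrow> real) (\<eta> :: nat \<Rightarrow> real).
           (\<forall>n. r n = rfun (\<nu> n) (p n) n) \<and>
           (\<forall>n. \<epsilon> n = efun (\<nu> n) (p n) n (r n)) \<and>
           (\<forall>n. \<eta> n = max (sqrt (real (\<nu> n) / real n)) (\<epsilon> n)) \<and>
           (\<forall>n. 0 \<le> r n) \<and> r \<longlonglongrightarrow> 0 \<and> (\<forall>n. 0 \<le> \<epsilon> n) \<and> \<epsilon> \<longlonglongrightarrow> 0 \<and>
           (\<forall>n\<ge>2. (SUP \<theta>\<in>param_ball (p n) (\<Theta> n) (\<theta>0 n) (r n).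
                      second_moment n (M n) (Z n) (P n) (f n) \<theta>) \<le> \<epsilon> n)
           \<longrightarrow>
           (\<forall>\<^sub>F n in sequentially.
              integrable (completion (M n))
                (sup_U_process n (M n) (Z n) (P n) (f n)
                   (param_ball (p n) (\<Theta> n) (\<theta>0 n) (r n))) \<and>
              (\<integral>\<omega>. sup_U_process n (M n) (Z n) (P n) (f n)
                      (param_ball (p n) (\<Theta> n) (\<theta>0 n) (r n)) \<omega> \<partial>completion (M n))
              \<le> C * ln (1 / \<eta> n) * sqrt (\<eta> n) * real (\<nu> n) / real n)))"
proof (rule exI[of _ "deviation_bound (max B 1)"], rule exI[of _ "maximal_constant (max B 1)"],
    intro conjI allI impI; (elim conjE)?)
  \<comment> \<open>The witnesses use \<open>max B 1\<close> in place of \<open>B\<close>, which may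
    be 0 or negative.\<close>
  show "0 \<le> deviation_bound (max B 1) e v n" for e v n by (simp add: deviation_bound_def Let_def)
  show "0 < maximal_constant (max B 1)" by (simp add: maximal_constant_def add_pos_pos)
qed (rule sup_U_process_array,
    (assumption | rule max.cobounded1 less_le_trans[OF zero_less_one max.cobounded2] | (rule allI, rule refl))+)+

end
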